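(* Let $\mathcal{A}$ be a $\operatorname{Hom}$-finite idempotent complete $\mathbb{F}_q$-linear additive category. Suppose $\mathcal{A}$ is endowed with two $\operatorname{Ext}^1$-finite admissible exact structures $\mathcal{E}'<\mathcal{E}$. Suppose that for every $M\in\mathcal{A}$, the set of $P\in\operatorname{ind}(\mathcal{P}(\mathcal{E}'))\setminus\operatorname{ind}(\mathcal{P}(\mathcal{E}))$ with $\operatorname{Hom}_{\mathcal{A}}(P,M)\neq 0$ is finite. Then $\mathcal{H}(\mathcal{E}')$ is the associated graded algebra of $\mathcal{H}(\mathcal{E})$ with respect to the filtration given by the $\mathcal{E}$-valuation $w_{\mathcal{E},\mathcal{E}'}:\operatorname{Iso}(\mathcal{A})\to\mathbb{N}$ defined by $$w_{\mathcal{E},\mathcal{E}'}(M)=\sum_{P\in\operatorname{ind}(\mathcal{P}(\mathcal{E}'))\setminus\operatorname{ind}(\mathcal{P}(\mathcal{E}))}\dim\operatorname{Hom}_{\mathcal{A}}(P,M).$$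
   Context: All categories are essentially small; $\mathbb{N}$ contains $0$; $\operatorname{Iso}(\mathcal{A})$ is the set of isomorphism classes of objects, and $\operatorname{ind}(-)$ the set of isomorphism classes of indecomposable objects. An exact structure on $\mathcal{A}$ is a Quillen exact structure, i.e. a class of kernel-cokernel pairs, called conflations, closed under isomorphism and satisfying Quillen's axioms; $\mathcal{E}'<\mathcal{E}$ means that the class of conflations of $\mathcal{E}'$ is strictly contained in that of $\mathcal{E}$. $\mathcal{E}$ is $\operatorname{Ext}^1$-finite if all $\operatorname{Ext}^1_{\mathcal{E}}(A,B)$ are finite. $\mathcal{P}(\mathcal{E})$ is the full subcategory of objects $P$ that are projective in $\mathcal{E}$, i.e. $\operatorname{Ext}^1_{\mathcal{E}}(P,B)=0$ for all $B$. The contravariant defect of a conflation $\delta:A\to B\xrightarrow{g}C$ is $\delta^\sharp=\operatorname{Coker}(\operatorname{Hom}(-,g))$ in the category $\operatorname{Mod}\mathcal{A}$ of additive functors $\mathcal{A}^{\mathrm{op}}\to\mathbf{Ab}$; $\operatorname{eff}\mathcal{E}$ is the (abelian) full subcategory of $\operatorname{Mod}\mathcal{A}$ of modules isomorphic to defects $\delta^\sharp$ of conflations in $\mathcal{E}$. $\mathcal{E}$ is admissible if every object of $\operatorname{eff}\mathcal{E}$ has finite length. Hall algebra: $\mathcal{H}(\mathcal{E})$ is the $\mathbb{Q}$-vector space with basis $\{[A]\mid A\in\operatorname{Iso}(\mathcal{A})\}$ and multiplication $[A]\diamond[C]=\sum_{B}\frac{|\operatorname{Ext}^1_{\mathcal{E}}(A,C)_B|}{|\operatorname{Hom}(A,C)|}[B]$,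 where $\operatorname{Ext}^1_{\mathcal{E}}(A,C)_B$ is the set of classes of conflations $C\rightarrowtail B'\twoheadrightarrow A$ in $\mathcal{E}$ with $B'\cong B$; it is associative with unit $[0]$. A function $w:\operatorname{Iso}(\mathcal{A})\to\mathbb{N}$ is an $\mathcal{E}$-valuation if $w(X)\le w(M\oplus N)$ whenever there is a conflation $N\rightarrowtail X\twoheadrightarrow M$ in $\mathcal{E}$, and $w(M\oplus N)=w(M)+w(N)$ for all $M,N$. The filtration given by $w$ on $\mathcal{H}(\mathcal{E})$ has $n$-th term the span of the $[M]$ with $w(M)\le n$. The equality of the associated graded algebra with $\mathcal{H}(\mathcal{E}')$ is understood via the identification of the class of $[M]$ in degree $w(M)$ with the basis element $[M]$ of $\mathcal{H}(\mathcal{E}')$. *)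

theory Defs
  imports
    Complex_Main
    "HOL-Algebra.QuotRing"
    "HOL-Algebra.Module"
    "HOL-Library.Poly_Mapping"
begin

section \<open>Linear categories\<close>

text \<open>
  A small \<open>k\<close>-linear category has the type \<open>'o\<close> as its set of objects. Its morphism spaces
  are subspaces \<open>Hom C X Y\<close> of one vector space \<open>'m\<close>. Every small \<open>k\<close>-linear category is of
  this form: take for \<open>'m\<close> the direct sum of all morphism spaces. Elements of \<open>'m\<close> carry no
  domain or codomain; these are recorded separately wherever they matter.
  \<open>cmp C g f\<close> is the composite \<open>g\<close> after \<open>f\<close>; its values on pairs that are not composable are
  irrelevant.
\<close>

record ('o, 'm, 'k) lincat =
  Hom :: "'o \<Rightarrow> 'o \<Rightarrow> 'm set"
  ide :: "'o \<Rightarrow> 'm"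
  cmp :: "'m \<Rightarrow> 'm \<Rightarrow> 'm"
  scale :: "'k \<Rightarrow> 'm \<Rightarrow> 'm"

locale linear_category =
  fixes C :: "('o, 'm::ab_group_add, 'k::field) lincat"
  assumes vector_space: "vector_space (scale C)"
    and Hom_subspace: "Modules.module.subspace (scale C) (Hom C X Y)"
    and ide_Hom: "ide C X \<in> Hom C X X"
    and cmp_Hom: "\<lbrakk>f \<in> Hom C X Y; g \<in> Hom C Y Z\<rbrakk> \<Longrightarrow> cmp C g f \<in> Hom C X Z"
    and cmp_ide_left: "f \<in> Hom C X Y \<Longrightarrow> cmp C (ide C Y) f = f"
    and cmp_ide_right: "f \<in> Hom C X Y \<Longrightarrow> cmp C f (ide C X) = f"
    and cmp_assoc: "\<lbrakk>f \<in> Hom C W X; g \<in> Hom C X Y; h \<in> Hom C Y Z\<rbrakk>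
      \<Longrightarrow> cmp C (cmp C h g) f = cmp C h (cmp C g f)"
    and cmp_add_left: "\<lbrakk>f \<in> Hom C X Y; g \<in> Hom C Y Z; g' \<in> Hom C Y Z\<rbrakk>
      \<Longrightarrow> cmp C (g + g') f = cmp C g f + cmp C g' f"
    and cmp_add_right: "\<lbrakk>f \<in> Hom C X Y; f' \<in> Hom C X Y; g \<in> Hom C Y Z\<rbrakk>
      \<Longrightarrow> cmp C g (f + f') = cmp C g f + cmp C g f'"
    and cmp_scale_left: "\<lbrakk>f \<in> Hom C X Y; g \<in> Hom C Y Z\<rbrakk>
      \<Longrightarrow> cmp C (scale C c g) f = scale C c (cmp C g f)"
    and cmp_scale_right: "\<lbrakk>f \<in> Hom C X Y; g \<in> Hom C Y Z\<rbrakk>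
      \<Longrightarrow> cmp C g (scale C c f) = scale C c (cmp C g f)"

definition iso_morphism :: "('o, 'm, 'k) lincat \<Rightarrow> 'o \<Rightarrow> 'o \<Rightarrow> 'm \<Rightarrow> bool" where
  "iso_morphism C X Y f \<longleftrightarrow> f \<in> Hom C X Y \<and>
    (\<exists>g\<in>Hom C Y X. cmp C g f = ide C X \<and> cmp C f g = ide C Y)"

definition isomorphic :: "('o, 'm, 'k) lincat \<Rightarrow> 'o \<Rightarrow> 'o \<Rightarrow> bool" where
  "isomorphic C X Y \<longleftrightarrow> (\<exists>f. iso_morphism C X Y f)"

definition iso_class :: "('o, 'm, 'k) lincat \<Rightarrow> 'o \<Rightarrow> 'o set" where
  "iso_class C X = {Y. isomorphic C X Y}"

definition Iso :: "('o, 'm, 'k) lincat \<Rightarrow> 'o set set" where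
  "Iso C = range (iso_class C)"

definition rep :: "'o set \<Rightarrow> 'o" where
  "rep a = (SOME X. X \<in> a)"

definition zero_object :: "('o, 'm, 'k) lincat \<Rightarrow> 'o \<Rightarrow> bool" where
  "zero_object C Z \<longleftrightarrow> (\<forall>X. (\<exists>!f. f \<in> Hom C X Z) \<and> (\<exists>!f. f \<in> Hom C Z X))"

definition direct_sum :: "('o, 'm::ab_group_add, 'k) lincat \<Rightarrow> 'o \<Rightarrow> 'o \<Rightarrow> 'o \<Rightarrow> bool" where
  "direct_sum C M N S \<longleftrightarrow>
    (\<exists>i\<^sub>1\<in>Hom C M S. \<exists>i\<^sub>2\<in>Hom C N S. \<exists>p\<^sub>1\<in>Hom C S M. \<exists>p\<^sub>2\<in>Hom C S N.
      cmp C p\<^sub>1 i\<^sub>1 = ide C M \<and> cmp C p\<^sub>2 i\<^sub>2 = ide C N \<and>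
      cmp C p\<^sub>2 i\<^sub>1 = 0 \<and> cmp C p\<^sub>1 i\<^sub>2 = 0 \<and>
      cmp C i\<^sub>1 p\<^sub>1 + cmp C i\<^sub>2 p\<^sub>2 = ide C S)"

locale additive_category = linear_category +
  assumes zero_object_exists: "\<exists>Z. zero_object C Z"
    and direct_sum_exists: "\<exists>S. direct_sum C M N S"

definition hom_finite :: "('o, 'm::ab_group_add, 'k::field) lincat \<Rightarrow> bool" where
  "hom_finite C \<longleftrightarrow> (\<forall>X Y. \<exists>B. finite B \<and> Hom C X Y = Modules.module.span (scale C) B)"

definition idempotent_complete :: "('o, 'm, 'k) lincat \<Rightarrow> bool" where
  "idempotent_complete C \<longleftrightarrow> (\<forall>X. \<forall>e\<in>Hom C X X. cmp C e e = e \<longrightarrow>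
    (\<exists>Y. \<exists>r\<in>Hom C X Y. \<exists>s\<in>Hom C Y X. cmp C s r = e \<and> cmp C r s = ide C Y))"

text \<open>A set of objects stands for the full subcategory it spans.\<close>

definition indecomposable :: "('o, 'm::ab_group_add, 'k) lincat \<Rightarrow> 'o set \<Rightarrow> 'o \<Rightarrow> bool" where
  "indecomposable C S X \<longleftrightarrow> X \<in> S \<and> \<not> zero_object C X \<and>
    (\<forall>M\<in>S. \<forall>N\<in>S. direct_sum C M N X \<longrightarrow> zero_object C M \<or> zero_object C N)"

definition ind :: "('o, 'm::ab_group_add, 'k) lincat \<Rightarrow> 'o set \<Rightarrow> 'o set set" where
  "ind C S = {iso_class C X | X. indecomposable C S X}"

section \<open>Exact structures\<close>

definition is_kernel ::
  "('o, 'm::ab_group_add, 'k) lincat \<Rightarrow> 'o \<Rightarrow> 'm \<Rightarrow> 'o \<Rightarrow> 'm \<Rightarrow> 'o \<Rightarrow> bool" where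
  "is_kernel C A i B p D \<longleftrightarrow> i \<in> Hom C A B \<and> p \<in> Hom C B D \<and> cmp C p i = 0 \<and>
    (\<forall>X. \<forall>f\<in>Hom C X B. cmp C p f = 0 \<longrightarrow> (\<exists>!g. g \<in> Hom C X A \<and> cmp C i g = f))"

definition is_cokernel ::
  "('o, 'm::ab_group_add, 'k) lincat \<Rightarrow> 'o \<Rightarrow> 'm \<Rightarrow> 'o \<Rightarrow> 'm \<Rightarrow> 'o \<Rightarrow> bool" where
  "is_cokernel C A i B p D \<longleftrightarrow> i \<in> Hom C A B \<and> p \<in> Hom C B D \<and> cmp C p i = 0 \<and>
    (\<forall>X. \<forall>f\<in>Hom C B X. cmp C f i = 0 \<longrightarrow> (\<exists>!g. g \<in> Hom C D X \<and> cmp C g p = f))"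

text \<open>\<open>pushout C A B i A' f B' i' f'\<close>: the square \<open>f' i = i' f\<close> with \<open>i : A \<rightarrow> B\<close>,
  \<open>f : A \<rightarrow> A'\<close>, \<open>i' : A' \<rightarrow> B'\<close>, \<open>f' : B \<rightarrow> B'\<close> is a pushout.\<close>

definition pushout :: "('o, 'm, 'k) lincat \<Rightarrow>
    'o \<Rightarrow> 'o \<Rightarrow> 'm \<Rightarrow> 'o \<Rightarrow> 'm \<Rightarrow> 'o \<Rightarrow> 'm \<Rightarrow> 'm \<Rightarrow> bool" where
  "pushout C A B i A' f B' i' f' \<longleftrightarrow>
    i \<in> Hom C A B \<and> f \<in> Hom C A A' \<and> i' \<in> Hom C A' B' \<and> f' \<in> Hom C B B' \<and>
    cmp C f' i = cmp C i' f \<and>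
    (\<forall>X. \<forall>u\<in>Hom C B X. \<forall>v\<in>Hom C A' X. cmp C u i = cmp C v f \<longrightarrow>
      (\<exists>!h. h \<in> Hom C B' X \<and> cmp C h f' = u \<and> cmp C h i' = v))"

text \<open>\<open>pullback C B D p D' f B' p' f'\<close>: the square \<open>p f' = f p'\<close> with \<open>p : B \<rightarrow> D\<close>,
  \<open>f : D' \<rightarrow> D\<close>, \<open>p' : B' \<rightarrow> D'\<close>, \<open>f' : B' \<rightarrow> B\<close> is a pullback.\<close>

definition pullback :: "('o, 'm, 'k) lincat \<Rightarrow>
    'o \<Rightarrow> 'o \<Rightarrow> 'm \<Rightarrow> 'o \<Rightarrow> 'm \<Rightarrow> 'o \<Rightarrow> 'm \<Rightarrow> 'm \<Rightarrow> bool" where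
  "pullback C B D p D' f B' p' f' \<longleftrightarrow>
    p \<in> Hom C B D \<and> f \<in> Hom C D' D \<and> p' \<in> Hom C B' D' \<and> f' \<in> Hom C B' B \<and>
    cmp C p f' = cmp C f p' \<and>
    (\<forall>X. \<forall>u\<in>Hom C X B. \<forall>v\<in>Hom C X D'. cmp C p u = cmp C f v \<longrightarrow>
      (\<exists>!h. h \<in> Hom C X B' \<and> cmp C f' h = u \<and> cmp C p' h = v))"

text \<open>A conflation \<open>A \<rightarrow> B \<rightarrow> D\<close> with morphisms \<open>i\<close> and \<open>p\<close> is the tuple \<open>(A, i, B, p, D)\<close>.\<close>

type_synonym ('o, 'm) pair_of_maps = "'o \<times> 'm \<times> 'o \<times> 'm \<times> 'o"

definition inflation :: "('o, 'm) pair_of_maps set \<Rightarrow> 'o \<Rightarrow> 'o \<Rightarrow> 'm \<Rightarrow> bool" where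
  "inflation E A B i \<longleftrightarrow> (\<exists>p D. (A, i, B, p, D) \<in> E)"

definition deflation :: "('o, 'm) pair_of_maps set \<Rightarrow> 'o \<Rightarrow> 'o \<Rightarrow> 'm \<Rightarrow> bool" where
  "deflation E B D p \<longleftrightarrow> (\<exists>A i. (A, i, B, p, D) \<in> E)"

text \<open>Quillen's axioms in self-dual form (see Buehler, Exact categories, Def. 2.1).\<close>

locale exact_structure =
  fixes C :: "('o, 'm::ab_group_add, 'k) lincat" and E :: "('o, 'm) pair_of_maps set"
  assumes kernel_cokernel_pair:
      "(A, i, B, p, D) \<in> E \<Longrightarrow> is_kernel C A i B p D \<and> is_cokernel C A i B p D"
    and iso_closed:
      "\<lbrakk>(A, i, B, p, D) \<in> E; iso_morphism C A A' a; iso_morphism C B B' b; iso_morphism C D D' d;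
        i' \<in> Hom C A' B'; p' \<in> Hom C B' D';
        cmp C i' a = cmp C b i; cmp C p' b = cmp C d p\<rbrakk> \<Longrightarrow> (A', i', B', p', D') \<in> E"
    and inflation_ide: "inflation E X X (ide C X)"
    and deflation_ide: "deflation E X X (ide C X)"
    and inflation_cmp:
      "\<lbrakk>inflation E X Y f; inflation E Y Z g\<rbrakk> \<Longrightarrow> inflation E X Z (cmp C g f)"
    and deflation_cmp:
      "\<lbrakk>deflation E X Y f; deflation E Y Z g\<rbrakk> \<Longrightarrow> deflation E X Z (cmp C g f)"
    and inflation_pushout:
      "\<lbrakk>inflation E A B i; f \<in> Hom C A A'\<rbrakk>
        \<Longrightarrow> \<exists>B' i' f'. pushout C A B i A' f B' i' f' \<and> inflation E A' B' i'"
    and deflation_pullback: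
      "\<lbrakk>deflation E B D p; f \<in> Hom C D' D\<rbrakk>
        \<Longrightarrow> \<exists>B' p' f'. pullback C B D p D' f B' p' f' \<and> deflation E B' D' p'"

text \<open>\<open>Ext1 C E A D\<close> consists of the Yoneda classes of conflations \<open>D \<rightarrow> X \<rightarrow> A\<close>.\<close>

definition ext_conflations ::
  "('o, 'm) pair_of_maps set \<Rightarrow> 'o \<Rightarrow> 'o \<Rightarrow> ('m \<times> 'o \<times> 'm) set" where
  "ext_conflations E A D = {(i, X, p). (D, i, X, p, A) \<in> E}"

definition ext_equiv :: "('o, 'm) pair_of_maps set \<Rightarrow> ('o, 'm, 'k) lincat \<Rightarrow> 'o \<Rightarrow> 'o \<Rightarrow>
    (('m \<times> 'o \<times> 'm) \<times> ('m \<times> 'o \<times> 'm)) set" where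
  "ext_equiv E C A D = {((i, X, p), (i', X', p')).
    (i, X, p) \<in> ext_conflations E A D \<and> (i', X', p') \<in> ext_conflations E A D \<and>
    (\<exists>h. iso_morphism C X X' h \<and> cmp C h i = i' \<and> cmp C p' h = p)}"

definition Ext1 :: "('o, 'm, 'k) lincat \<Rightarrow> ('o, 'm) pair_of_maps set \<Rightarrow> 'o \<Rightarrow> 'o \<Rightarrow>
    ('m \<times> 'o \<times> 'm) set set" where
  "Ext1 C E A D = ext_conflations E A D // ext_equiv E C A D"

definition Ext1_mid :: "('o, 'm, 'k) lincat \<Rightarrow> ('o, 'm) pair_of_maps set \<Rightarrow> 'o \<Rightarrow> 'o \<Rightarrow> 'o \<Rightarrow>
    ('m \<times> 'o \<times> 'm) set set" where
  "Ext1_mid C E A D B = {\<xi> \<in> Ext1 C E A D. \<exists>(i, X, p)\<in>\<xi>. isomorphic C X B}"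

definition ext_finite :: "('o, 'm, 'k) lincat \<Rightarrow> ('o, 'm) pair_of_maps set \<Rightarrow> bool" where
  "ext_finite C E \<longleftrightarrow> (\<forall>A D. finite (Ext1 C E A D))"

text \<open>The group \<open>Ext1 C E P D\<close> vanishes iff its underlying set has exactly one element.\<close>

definition projectives :: "('o, 'm, 'k) lincat \<Rightarrow> ('o, 'm) pair_of_maps set \<Rightarrow> 'o set" where
  "projectives C E = {P. \<forall>D. is_singleton (Ext1 C E P D)}"

section \<open>Functor categories, defects and admissibility\<close>

text \<open>
  An object of \<open>Mod C\<close> is a contravariant additive functor to abelian groups; the latter are
  written multiplicatively. For \<open>\<phi> : X \<rightarrow> Y\<close>, \<open>fmor M X Y \<phi>\<close> maps \<open>fob M Y\<close> to \<open>fob M X\<close>.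
\<close>

record ('o, 'm, 'x) ab_functor =
  fob :: "'o \<Rightarrow> 'x monoid"
  fmor :: "'o \<Rightarrow> 'o \<Rightarrow> 'm \<Rightarrow> 'x \<Rightarrow> 'x"

definition right_module ::
  "('o, 'm::ab_group_add, 'k) lincat \<Rightarrow> ('o, 'm, 'x) ab_functor \<Rightarrow> bool" where
  "right_module C M \<longleftrightarrow>
    (\<forall>X. comm_group (fob M X)) \<and>
    (\<forall>X Y. \<forall>\<phi>\<in>Hom C X Y. fmor M X Y \<phi> \<in> hom (fob M Y) (fob M X)) \<and>
    (\<forall>X. \<forall>a\<in>carrier (fob M X). fmor M X X (ide C X) a = a) \<and>
    (\<forall>X Y Z. \<forall>\<phi>\<in>Hom C X Y. \<forall>\<psi>\<in>Hom C Y Z. \<forall>a\<in>carrier (fob M Z).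
      fmor M X Z (cmp C \<psi> \<phi>) a = fmor M X Y \<phi> (fmor M Y Z \<psi> a)) \<and>
    (\<forall>X Y. \<forall>\<phi>\<in>Hom C X Y. \<forall>\<psi>\<in>Hom C X Y. \<forall>a\<in>carrier (fob M Y).
      fmor M X Y (\<phi> + \<psi>) a = fmor M X Y \<phi> a \<otimes>\<^bsub>fob M X\<^esub> fmor M X Y \<psi> a)"

definition module_isomorphic :: "('o, 'm, 'k) lincat \<Rightarrow>
    ('o, 'm, 'x) ab_functor \<Rightarrow> ('o, 'm, 'y) ab_functor \<Rightarrow> bool" where
  "module_isomorphic C M N \<longleftrightarrow> (\<exists>\<eta>. (\<forall>X. \<eta> X \<in> iso (fob M X) (fob N X)) \<and>
    (\<forall>X Y. \<forall>\<phi>\<in>Hom C X Y. \<forall>a\<in>carrier (fob M Y).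
      \<eta> X (fmor M X Y \<phi> a) = fmor N X Y \<phi> (\<eta> Y a)))"

definition hom_group :: "('o, 'm::ab_group_add, 'k) lincat \<Rightarrow> 'o \<Rightarrow> 'o \<Rightarrow> 'm monoid" where
  "hom_group C X Y = \<lparr>carrier = Hom C X Y, monoid.mult = (+), one = 0\<rparr>"

text \<open>The cokernel of \<open>Hom(-, p)\<close> is computed objectwise. A coset of the image of
  \<open>Hom(Y, p)\<close> in \<open>Hom(Y, D)\<close> is composed with \<open>\<phi> : X \<rightarrow> Y\<close> and then
  enlarged to a coset of the image of \<open>Hom(X, p)\<close>.\<close>

fun defect :: "('o, 'm::ab_group_add, 'k) lincat \<Rightarrow> ('o, 'm) pair_of_maps \<Rightarrow>
    ('o, 'm, 'm set) ab_functor" where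
  "defect C (A, i, B, p, D) =
    \<lparr>fob = (\<lambda>X. hom_group C X D Mod cmp C p ` Hom C X B),
     fmor = (\<lambda>X Y \<phi> S. (cmp C p ` Hom C X B) <#>\<^bsub>hom_group C X D\<^esub> ((\<lambda>s. cmp C s \<phi>) ` S))\<rparr>"

definition eff :: "('o, 'm::ab_group_add, 'k) lincat \<Rightarrow> ('o, 'm) pair_of_maps set \<Rightarrow>
    ('o, 'm, 'x) ab_functor set" where
  "eff C E = {M. right_module C M \<and> (\<exists>\<delta>\<in>E. module_isomorphic C M (defect C \<delta>))}"

text \<open>
  Subobjects in the abelian category \<open>eff C E\<close>: as kernels in \<open>eff C E\<close> are kernels in
  \<open>Mod C\<close>, these are the subfunctors which themselves lie in \<open>eff C E\<close>.
\<close>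

definition restrict_module ::
  "('o, 'm, 'x) ab_functor \<Rightarrow> ('o \<Rightarrow> 'x set) \<Rightarrow> ('o, 'm, 'x) ab_functor" where
  "restrict_module M U = M\<lparr>fob := (\<lambda>X. (fob M X)\<lparr>carrier := U X\<rparr>)\<rparr>"

definition eff_subobject :: "('o, 'm::ab_group_add, 'k) lincat \<Rightarrow> ('o, 'm) pair_of_maps set \<Rightarrow>
    ('o, 'm, 'x) ab_functor \<Rightarrow> ('o \<Rightarrow> 'x set) \<Rightarrow> bool" where
  "eff_subobject C E M U \<longleftrightarrow>
    (\<forall>X. subgroup (U X) (fob M X)) \<and>
    (\<forall>X Y. \<forall>\<phi>\<in>Hom C X Y. fmor M X Y \<phi> ` U Y \<subseteq> U X) \<and>
    restrict_module M U \<in> eff C E"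

text \<open>Existence of a composition series in \<open>eff C E\<close>.\<close>

definition finite_length_in_eff :: "('o, 'm::ab_group_add, 'k) lincat \<Rightarrow>
    ('o, 'm) pair_of_maps set \<Rightarrow> ('o, 'm, 'x) ab_functor \<Rightarrow> bool" where
  "finite_length_in_eff C E M \<longleftrightarrow> (\<exists>n::nat. \<exists>U.
    U 0 = (\<lambda>X. {\<one>\<^bsub>fob M X\<^esub>}) \<and> U n = (\<lambda>X. carrier (fob M X)) \<and>
    (\<forall>j\<le>n. eff_subobject C E M (U j)) \<and>
    (\<forall>j<n. U j < U (Suc j) \<and> \<not> (\<exists>V. eff_subobject C E M V \<and> U j < V \<and> V < U (Suc j))))"

text \<open>The element type \<open>'m set\<close> suffices, as every object of \<open>eff C E\<close> is isomorphic to
  one with this element type.\<close>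

definition admissible ::
  "('o, 'm::ab_group_add, 'k) lincat \<Rightarrow> ('o, 'm) pair_of_maps set \<Rightarrow> bool" where
  "admissible C E \<longleftrightarrow>
    (\<forall>M \<in> (eff C E :: ('o, 'm, 'm set) ab_functor set). finite_length_in_eff C E M)"

section \<open>Hall algebras\<close>

definition qscale :: "rat \<Rightarrow> ('b \<Rightarrow>\<^sub>0 rat) \<Rightarrow> ('b \<Rightarrow>\<^sub>0 rat)" where
  "qscale c x = Poly_Mapping.map ((*) c) x"

text \<open>The sum runs over the classes \<open>b\<close> with nonzero coefficient only, so that it is finite.\<close>

definition hall_basis_mult :: "('o, 'm, 'k) lincat \<Rightarrow> ('o, 'm) pair_of_maps set \<Rightarrow>
    'o set \<Rightarrow> 'o set \<Rightarrow> ('o set \<Rightarrow>\<^sub>0 rat)" where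
  "hall_basis_mult C E a c =
    (\<Sum>b \<in> {b \<in> Iso C. Ext1_mid C E (rep a) (rep c) (rep b) \<noteq> {}}.
      Poly_Mapping.single b
        (of_nat (card (Ext1_mid C E (rep a) (rep c) (rep b))) /
         of_nat (card (Hom C (rep a) (rep c)))))"

definition hall_mult :: "('o, 'm, 'k) lincat \<Rightarrow> ('o, 'm) pair_of_maps set \<Rightarrow>
    ('o set \<Rightarrow>\<^sub>0 rat) \<Rightarrow> ('o set \<Rightarrow>\<^sub>0 rat) \<Rightarrow> ('o set \<Rightarrow>\<^sub>0 rat)" where
  "hall_mult C E x y =
    (\<Sum>a\<in>Poly_Mapping.keys x. \<Sum>c\<in>Poly_Mapping.keys y.
      qscale (Poly_Mapping.lookup x a * Poly_Mapping.lookup y c) (hall_basis_mult C E a c))"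

definition hall_basis :: "('o, 'm, 'k) lincat \<Rightarrow> 'o \<Rightarrow> ('o set \<Rightarrow>\<^sub>0 rat)" where
  "hall_basis C M = Poly_Mapping.single (iso_class C M) 1"

definition hall_algebra :: "('o, 'm, 'k) lincat \<Rightarrow> ('o, 'm) pair_of_maps set \<Rightarrow>
    (rat, 'o set \<Rightarrow>\<^sub>0 rat) module" where
  "hall_algebra C E =
    \<lparr>carrier = {x. Poly_Mapping.keys x \<subseteq> Iso C},
     monoid.mult = hall_mult C E,
     one = hall_basis C (SOME Z. zero_object C Z),
     zero = 0, add = (+), smult = qscale\<rparr>"

section \<open>Valuations and associated graded algebras\<close>

definition valuation :: "('o, 'm::ab_group_add, 'k) lincat \<Rightarrow> ('o, 'm) pair_of_maps set \<Rightarrow>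
    ('o set \<Rightarrow> nat) \<Rightarrow> bool" where
  "valuation C E w \<longleftrightarrow>
    (\<forall>N i X p M S. (N, i, X, p, M) \<in> E \<longrightarrow> direct_sum C M N S \<longrightarrow>
      w (iso_class C X) \<le> w (iso_class C S)) \<and>
    (\<forall>M N S. direct_sum C M N S \<longrightarrow>
      w (iso_class C S) = w (iso_class C M) + w (iso_class C N))"

definition hall_filtration ::
  "('o, 'm, 'k) lincat \<Rightarrow> ('o set \<Rightarrow> nat) \<Rightarrow> nat \<Rightarrow> ('o set \<Rightarrow>\<^sub>0 rat) set" where
  "hall_filtration C w n =
    Modules.module.span qscale {hall_basis C M | M. w (iso_class C M) \<le> n}"

definition algebra_filtration :: "('a, 'b) module \<Rightarrow> (nat \<Rightarrow> 'b set) \<Rightarrow> bool" where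
  "algebra_filtration H F \<longleftrightarrow>
    (\<forall>n. additive_subgroup (F n) H) \<and>
    (\<forall>n c. \<forall>x\<in>F n. c \<odot>\<^bsub>H\<^esub> x \<in> F n) \<and>
    (\<forall>n. F n \<subseteq> F (Suc n)) \<and>
    (\<Union>n. F n) = carrier H \<and>
    \<one>\<^bsub>H\<^esub> \<in> F 0 \<and>
    (\<forall>m n. \<forall>x\<in>F m. \<forall>y\<in>F n. x \<otimes>\<^bsub>H\<^esub> y \<in> F (m + n))"

text \<open>\<open>gr_prev H F n\<close> is the filtration step before \<open>F n\<close>, with \<open>F (-1) = 0\<close>.\<close>

definition gr_prev :: "('a, 'b) module \<Rightarrow> (nat \<Rightarrow> 'b set) \<Rightarrow> nat \<Rightarrow> 'b set" where
  "gr_prev H F n = (case n of 0 \<Rightarrow> {\<zero>\<^bsub>H\<^esub>} | Suc m \<Rightarrow> F m)"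

definition gr_coset :: "('a, 'b) module \<Rightarrow> (nat \<Rightarrow> 'b set) \<Rightarrow> nat \<Rightarrow> 'b \<Rightarrow> 'b set" where
  "gr_coset H F n x = gr_prev H F n +>\<^bsub>H\<^esub> x"

text \<open>The class of \<open>x\<close> in degree \<open>n\<close>, as a homogeneous element of the associated graded algebra.\<close>

definition gr_class :: "('a, 'b) module \<Rightarrow> (nat \<Rightarrow> 'b set) \<Rightarrow> nat \<Rightarrow> 'b \<Rightarrow> (nat \<Rightarrow> 'b set)" where
  "gr_class H F n x = (\<lambda>k. if k = n then gr_coset H F n x else gr_prev H F k)"

text \<open>
  The direct sum of the quotients \<open>F n / F (n - 1)\<close>. As for \<^const>\<open>rcoset_mult\<close>, operations on
  cosets are unions over all representatives; for an \<^const>\<open>algebra_filtration\<close> the result is a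
  single coset.
\<close>

definition assoc_graded :: "('a, 'b) module \<Rightarrow> (nat \<Rightarrow> 'b set) \<Rightarrow> ('a, nat \<Rightarrow> 'b set) module" where
  "assoc_graded H F =
    \<lparr>carrier = {\<xi>. (\<forall>n. \<xi> n \<in> gr_coset H F n ` F n) \<and> finite {n. \<xi> n \<noteq> gr_prev H F n}},
     monoid.mult = (\<lambda>\<xi> \<eta> n.
       \<Union>x\<in>Pi {..n} \<xi>. \<Union>y\<in>Pi {..n} \<eta>. gr_coset H F n (\<Oplus>\<^bsub>H\<^esub>k\<in>{..n}. x k \<otimes>\<^bsub>H\<^esub> y (n - k))),
     one = gr_class H F 0 \<one>\<^bsub>H\<^esub>,
     zero = gr_prev H F,
     add = (\<lambda>\<xi> \<eta> n. \<xi> n <+>\<^bsub>H\<^esub> \<eta> n),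
     smult = (\<lambda>c \<xi> n. \<Union>x\<in>\<xi> n. gr_coset H F n (c \<odot>\<^bsub>H\<^esub> x))\<rparr>"

text \<open>As in the multiplication of the Hall algebra, vanishing summands are left out.\<close>

definition w_val :: "('o, 'm::ab_group_add, 'k::field) lincat \<Rightarrow> ('o, 'm) pair_of_maps set \<Rightarrow>
    ('o, 'm) pair_of_maps set \<Rightarrow> 'o set \<Rightarrow> nat" where
  "w_val C E E' a =
    (\<Sum>P \<in> {P \<in> ind C (projectives C E') - ind C (projectives C E).
             Hom C (rep P) (rep a) \<noteq> {0}}.
      vector_space.dim (scale C) (Hom C (rep P) (rep a)))"

end

theory Submission
  imports Defs
begin

text \<open>
  The coefficient of \<open>[B]\<close> in a Hall product \<open>[A] [D]\<close> counts classes of conflations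
  \<open>D \<rightarrow> B \<rightarrow> A\<close>, and passing to the associated graded algebra keeps the terms with
  \<open>w B = w A + w D\<close>. The theorem therefore amounts to the following: every conflation
  \<open>N \<rightarrow> X \<rightarrow> M\<close> of \<open>E\<close> satisfies \<open>w X \<le> w M + w N\<close>, with equality exactly for the
  conflations of \<open>E'\<close> (\<open>w_conflation\<close>). The inequality is left exactness of the functors
  \<open>Hom(P, -)\<close> whose dimensions \<open>w\<close> adds up, and equality means that every morphism from one of
  these \<open>P\<close> to \<open>M\<close> lifts along \<open>X \<rightarrow> M\<close>. This holds if the conflation lies in \<open>E'\<close>, where
  each \<open>P\<close> is projective.

  The converse is the core, \<open>nonconflation_detected_by_projective\<close>. Let \<open>g : B \<rightarrow> D\<close> be
  a deflation of \<open>E\<close> but not of \<open>E'\<close>. Say that \<open>f : X \<rightarrow> D\<close> lifts locally if \<open>f h\<close> factors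
  through \<open>g\<close> for some deflation \<open>h\<close> of \<open>E'\<close>. Such morphisms are closed under sums and
  precomposition, and by the obscure axiom the identity of \<open>D\<close> is not among them. Choose a
  morphism \<open>f : X \<rightarrow> D\<close> that does not lift locally and generates a subfunctor of the defect of \<open>g\<close>
  of least possible length; among these choose \<open>X\<close> with the smallest endomorphism ring.
  The length makes sense because a composition series of the defect in \<open>eff E\<close> is also one in
  the category of all functors (\<open>finite_length_chain\<close>). The choice of \<open>X\<close> leaves it with
  no idempotents except \<open>0\<close> and \<open>1\<close>. Now let \<open>u : Z \<rightarrow> X\<close> be such that \<open>f u\<close> does not lift
  locally either. By minimality \<open>f u\<close> generates the same subfunctor as \<open>f\<close>, so
  \<open>f = f u v\<close> modulo \<open>g\<close> for some \<open>v\<close>; a power of \<open>u v\<close> is idempotent, it is not \<open>0\<close> because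
  \<open>f\<close> does not factor through \<open>g\<close>, hence it is \<open>1\<close> and \<open>u\<close> has a section. Every deflation of
  \<open>E'\<close> onto \<open>X\<close> is such a \<open>u\<close>, since a composite of deflations is a deflation. So \<open>X\<close> is
  projective in \<open>E'\<close>, and \<open>f\<close> is a morphism from it that does not lift along \<open>g\<close>.

  What remains is formal: an algebra with a weighted basis degenerates to the algebra in which only
  the structure constants of top weight are kept (\<open>symb_ring_iso\<close>).
\<close>

section \<open>Linear categories\<close>

context linear_category
begin

sublocale vs: vector_space "scale C"
  by (rule vector_space)

abbreviation comp (infixr "\<cdot>" 70)
  where "g \<cdot> f \<equiv> cmp C g f"

lemma Hom_0 [simp, intro]: "0 \<in> Hom C X Y"
  by (rule vs.subspace_0[OF Hom_subspace])

lemma Hom_add [intro]: "f \<in> Hom C X Y \<Longrightarrow> g \<in> Hom C X Y \<Longrightarrow> f + g \<in> Hom C X Y"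
  by (rule vs.subspace_add[OF Hom_subspace])

lemma Hom_diff [intro]: "f \<in> Hom C X Y \<Longrightarrow> g \<in> Hom C X Y \<Longrightarrow> f - g \<in> Hom C X Y"
  by (rule vs.subspace_diff[OF Hom_subspace])

lemma Hom_uminus [intro]: "f \<in> Hom C X Y \<Longrightarrow> - f \<in> Hom C X Y"
  by (rule vs.subspace_neg[OF Hom_subspace])

declare ide_Hom [simp, intro] cmp_Hom [intro]

lemma cmp_0_left [simp]: "f \<in> Hom C X Y \<Longrightarrow> 0 \<cdot> f = 0"
  using cmp_add_left[of f X Y 0 Y 0] by simp

lemma cmp_0_right [simp]: "g \<in> Hom C Y Z \<Longrightarrow> g \<cdot> 0 = 0"
  using cmp_add_right[of 0 Y Y 0 g Z] by simp

text \<open>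
  Associativity has side conditions naming the objects in between, which rewriting cannot guess.
  Most computations below are one of these two rearrangements.
\<close>

lemma cmp_reassoc:
  "\<lbrakk>h \<cdot> g = k; f \<in> Hom C W X; g \<in> Hom C X Y; h \<in> Hom C Y Z\<rbrakk> \<Longrightarrow> h \<cdot> (g \<cdot> f) = k \<cdot> f"
  using cmp_assoc[of f W X g Y h Z] by simp

lemma cmp_square:
  "\<lbrakk>a \<cdot> b = c \<cdot> d; h \<in> Hom C V X; b \<in> Hom C X Y; a \<in> Hom C Y Z; d \<in> Hom C X W; c \<in> Hom C W Z\<rbrakk>
    \<Longrightarrow> a \<cdot> (b \<cdot> h) = c \<cdot> (d \<cdot> h)"
  using cmp_assoc[of h V X b Y a Z] cmp_assoc[of h V X d W c Z] by simp

lemma cmp_diff_left: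
  "\<lbrakk>f \<in> Hom C X Y; g \<in> Hom C Y Z; g' \<in> Hom C Y Z\<rbrakk> \<Longrightarrow> (g - g') \<cdot> f = g \<cdot> f - g' \<cdot> f"
  using cmp_add_left[of f X Y "g - g'" Z g'] Hom_diff by simp

lemma cmp_diff_right:
  "\<lbrakk>f \<in> Hom C X Y; f' \<in> Hom C X Y; g \<in> Hom C Y Z\<rbrakk> \<Longrightarrow> g \<cdot> (f - f') = g \<cdot> f - g \<cdot> f'"
  using cmp_add_right[of "f - f'" X Y f' g Z] Hom_diff by simp

lemma iso_morphism_ide: "iso_morphism C X X (ide C X)"
  unfolding iso_morphism_def by (auto intro!: bexI[of _ "ide C X"] cmp_ide_left)

lemma isomorphic_refl: "isomorphic C X X"
  unfolding isomorphic_def using iso_morphism_ide by blast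

lemma isomorphic_sym: "isomorphic C X Y \<Longrightarrow> isomorphic C Y X"
  unfolding isomorphic_def iso_morphism_def by blast

lemma isomorphic_trans:
  assumes "isomorphic C X Y" "isomorphic C Y Z"
  shows "isomorphic C X Z"
proof -
  obtain f f' where f: "f \<in> Hom C X Y" "f' \<in> Hom C Y X" "f' \<cdot> f = ide C X" "f \<cdot> f' = ide C Y"
    using assms unfolding isomorphic_def iso_morphism_def by blast
  obtain g g' where g: "g \<in> Hom C Y Z" "g' \<in> Hom C Z Y" "g' \<cdot> g = ide C Y" "g \<cdot> g' = ide C Z"
    using assms unfolding isomorphic_def iso_morphism_def by blast
  have "(f' \<cdot> g') \<cdot> (g \<cdot> f) = ide C X"
    using f g cmp_assoc[of "g \<cdot> f" X Z g' Y f' X] cmp_assoc[of f X Y g Z g' Y, symmetric]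
    by (simp add: cmp_Hom cmp_ide_left)
  moreover have "(g \<cdot> f) \<cdot> (f' \<cdot> g') = ide C Z"
    using f g cmp_assoc[of "f' \<cdot> g'" Z X f Y g Z] cmp_assoc[of g' Z Y f' X f Y, symmetric]
    by (simp add: cmp_Hom cmp_ide_left)
  ultimately show ?thesis
    unfolding isomorphic_def iso_morphism_def using f g by blast
qed

lemma iso_class_eq_iff: "iso_class C X = iso_class C Y \<longleftrightarrow> isomorphic C X Y"
  unfolding iso_class_def using isomorphic_refl isomorphic_sym isomorphic_trans by blast

lemma iso_class_rep: "a \<in> Iso C \<Longrightarrow> iso_class C (rep a) = a"
proof -
  assume "a \<in> Iso C"
  then obtain X where X: "a = iso_class C X" unfolding Iso_def by blast
  have "rep a \<in> a" unfolding rep_def X iso_class_def by (rule someI[of _ X]) (simp add: isomorphic_refl)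
  thus ?thesis using X iso_class_eq_iff by (simp add: iso_class_def isomorphic_sym)
qed

lemma iso_class_in_Iso [simp]: "iso_class C X \<in> Iso C"
  unfolding Iso_def by blast

lemma rep_iso_class: "isomorphic C (rep (iso_class C X)) X"
  using iso_class_rep iso_class_eq_iff iso_class_in_Iso by metis

lemma zero_objectI: "ide C Z = 0 \<Longrightarrow> zero_object C Z"
  unfolding zero_object_def
  by (metis Hom_0 cmp_0_left cmp_0_right cmp_ide_left cmp_ide_right)

lemma zero_object_Hom:
  "zero_object C Z \<Longrightarrow> f \<in> Hom C X Z \<Longrightarrow> f = 0"
  "zero_object C Z \<Longrightarrow> f \<in> Hom C Z X \<Longrightarrow> f = 0"
  unfolding zero_object_def using Hom_0 by blast+

lemma kernel_mono:
  assumes "is_kernel C A i B p D" "u \<in> Hom C X A" "v \<in> Hom C X A" "i \<cdot> u = i \<cdot> v"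
  shows "u = v"
proof -
  have i: "i \<in> Hom C A B" "p \<in> Hom C B D" "p \<cdot> i = 0" using assms(1) unfolding is_kernel_def by auto
  have "p \<cdot> (i \<cdot> u) = 0" using i assms(2) by (metis cmp_assoc cmp_0_left)
  thus ?thesis using assms i unfolding is_kernel_def by (metis cmp_Hom)
qed

lemma kernel_factor:
  assumes "is_kernel C A i B p D" "f \<in> Hom C X B" "p \<cdot> f = 0"
  obtains g where "g \<in> Hom C X A" "i \<cdot> g = f"
  using assms unfolding is_kernel_def by blast

lemma kernelI:
  assumes "i \<in> Hom C A B" "p \<in> Hom C B D" "p \<cdot> i = 0"
    and "\<And>X f. f \<in> Hom C X B \<Longrightarrow> p \<cdot> f = 0 \<Longrightarrow> \<exists>g\<in>Hom C X A. i \<cdot> g = f"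
    and "\<And>X u. u \<in> Hom C X A \<Longrightarrow> i \<cdot> u = 0 \<Longrightarrow> u = 0"
  shows "is_kernel C A i B p D"
proof -
  have "u = v" if "u \<in> Hom C X A" "v \<in> Hom C X A" "i \<cdot> u = i \<cdot> v" for X u v
    using assms(5)[of "u - v" X] that assms(1) by (simp add: cmp_diff_right Hom_diff)
  with assms show ?thesis unfolding is_kernel_def by metis
qed

lemma cokernel_epi:
  assumes "is_cokernel C A i B p D" "u \<in> Hom C D X" "v \<in> Hom C D X" "u \<cdot> p = v \<cdot> p"
  shows "u = v"
proof -
  have i: "i \<in> Hom C A B" "p \<in> Hom C B D" "p \<cdot> i = 0" using assms(1) unfolding is_cokernel_def by auto
  have "(u \<cdot> p) \<cdot> i = 0" using i assms(2) by (metis cmp_assoc cmp_0_right)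
  thus ?thesis using assms i unfolding is_cokernel_def by (metis cmp_Hom)
qed

lemma cokernel_factor:
  assumes "is_cokernel C A i B p D" "f \<in> Hom C B X" "f \<cdot> i = 0"
  obtains g where "g \<in> Hom C D X" "g \<cdot> p = f"
  using assms unfolding is_cokernel_def by blast

end

section \<open>Exact categories\<close>

locale exact_category = additive_category C + exact_structure C E
  for C :: "('o, 'm::ab_group_add, 'k::field) lincat" and E :: "('o, 'm) pair_of_maps set"
begin

lemma conflationD:
  assumes "(A, i, B, p, D) \<in> E"
  shows "i \<in> Hom C A B" "p \<in> Hom C B D" "p \<cdot> i = 0"
    "is_kernel C A i B p D" "is_cokernel C A i B p D"
  using kernel_cokernel_pair[OF assms] unfolding is_kernel_def by auto

lemma deflation_Hom: "deflation E B D p \<Longrightarrow> p \<in> Hom C B D"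
  unfolding deflation_def using conflationD(2) by blast

text \<open>
  Kernels are unique up to isomorphism and conflations are closed under isomorphism, so any kernel of
  a deflation completes it to a conflation; dually for inflations.
\<close>

lemma deflation_kernel_conflation:
  assumes "deflation E B D p" "is_kernel C A i B p D"
  shows "(A, i, B, p, D) \<in> E"
proof -
  obtain A' i' where c: "(A', i', B, p, D) \<in> E" using assms(1) unfolding deflation_def by blast
  note c' = conflationD[OF c]
  have i: "i \<in> Hom C A B" "p \<cdot> i = 0" using assms(2) unfolding is_kernel_def by auto
  obtain a where a: "a \<in> Hom C A' A" "i \<cdot> a = i'" by (rule kernel_factor[OF assms(2) c'(1,3)])
  obtain b where b: "b \<in> Hom C A A'" "i' \<cdot> b = i" by (rule kernel_factor[OF c'(4) i])
  have "a \<cdot> b = ide C A"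
    by (rule kernel_mono[OF assms(2)]) (use a b i in \<open>auto simp: cmp_ide_right cmp_assoc[symmetric]\<close>)
  moreover have "b \<cdot> a = ide C A'"
    by (rule kernel_mono[OF c'(4)])
      (use a b c' in \<open>auto simp: cmp_ide_right cmp_assoc[symmetric]\<close>)
  ultimately have "iso_morphism C A' A a" unfolding iso_morphism_def using a b by blast
  then show ?thesis
    by (rule iso_closed[OF c _ iso_morphism_ide iso_morphism_ide])
      (use a i c' in \<open>auto simp: cmp_ide_left cmp_ide_right\<close>)
qed

lemma inflation_cokernel_conflation:
  assumes "inflation E A B i" "is_cokernel C A i B p D"
  shows "(A, i, B, p, D) \<in> E"
proof -
  obtain D' p' where c: "(A, i, B, p', D') \<in> E" using assms(1) unfolding inflation_def by blast
  note c' = conflationD[OF c]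
  have p: "p \<in> Hom C B D" "p \<cdot> i = 0" using assms(2) unfolding is_cokernel_def by auto
  obtain d where d: "d \<in> Hom C D' D" "d \<cdot> p' = p" by (rule cokernel_factor[OF c'(5) p])
  obtain e where e: "e \<in> Hom C D D'" "e \<cdot> p = p'" by (rule cokernel_factor[OF assms(2) c'(2,3)])
  have "d \<cdot> e = ide C D"
    by (rule cokernel_epi[OF assms(2)]) (use d e p in \<open>auto simp: cmp_ide_left cmp_assoc\<close>)
  moreover have "e \<cdot> d = ide C D'"
    by (rule cokernel_epi[OF c'(5)]) (use d e c' in \<open>auto simp: cmp_ide_left cmp_assoc\<close>)
  ultimately have "iso_morphism C D' D d" unfolding iso_morphism_def using d e by blast
  then show ?thesis
    by (rule iso_closed[OF c iso_morphism_ide iso_morphism_ide])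
      (use p d c' in \<open>auto simp: cmp_ide_left cmp_ide_right\<close>)
qed

lemma pullback_lift:
  assumes "pullback C B D p D' f B' p' f'" "u \<in> Hom C X B" "v \<in> Hom C X D'" "p \<cdot> u = f \<cdot> v"
  obtains h where "h \<in> Hom C X B'" "f' \<cdot> h = u" "p' \<cdot> h = v"
  using assms unfolding pullback_def by blast

lemma pullback_eq:
  assumes "pullback C B D p D' f B' p' f'" "h \<in> Hom C X B'" "h' \<in> Hom C X B'"
    "f' \<cdot> h = f' \<cdot> h'" "p' \<cdot> h = p' \<cdot> h'"
  shows "h = h'"
proof -
  have H: "p \<in> Hom C B D" "f \<in> Hom C D' D" "p' \<in> Hom C B' D'" "f' \<in> Hom C B' B"
      "p \<cdot> f' = f \<cdot> p'"
    using assms(1) unfolding pullback_def by auto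
  have "p \<cdot> (f' \<cdot> h) = f \<cdot> (p' \<cdot> h)" by (rule cmp_square[OF H(5) assms(2) H(4,1,3,2)])
  then show ?thesis using assms H unfolding pullback_def by (metis cmp_Hom)
qed

text \<open>
  The morphism \<open>A \<rightarrow> 0\<close> is a deflation, and its pullback along \<open>P \<rightarrow> 0\<close> is the projection
  from the direct sum of \<open>A\<close> and \<open>P\<close>.
\<close>

lemma split_conflation_exists:
  "\<exists>i B p s. (A, i, B, p, P) \<in> E \<and> s \<in> Hom C P B \<and> p \<cdot> s = ide C P"
proof -
  obtain Z z where z: "(A, ide C A, A, z, Z) \<in> E" using inflation_ide unfolding inflation_def by blast
  note z' = conflationD[OF z]
  have z0: "z = 0" using z' by (simp add: cmp_ide_right)
  have d: "deflation E A Z z" using z unfolding deflation_def by blast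
  obtain B p q where pb: "pullback C A Z z P 0 B p q" and p: "deflation E B P p"
    using deflation_pullback[OF d Hom_0[of P Z]] by blast
  have H: "p \<in> Hom C B P" "q \<in> Hom C B A" using pb unfolding pullback_def by auto
  obtain i where i: "i \<in> Hom C A B" "q \<cdot> i = ide C A" "p \<cdot> i = 0"
    by (rule pullback_lift[OF pb, of "ide C A" A 0]) (simp_all add: z0 cmp_ide_right)
  obtain s where s: "s \<in> Hom C P B" "q \<cdot> s = 0" "p \<cdot> s = ide C P"
    by (rule pullback_lift[OF pb, of 0 P "ide C P"]) (use z' in \<open>simp_all add: z0 cmp_ide_right\<close>)
  have "is_kernel C A i B p P"
  proof (rule kernelI)
    fix X f assume f: "f \<in> Hom C X B" "p \<cdot> f = 0"
    have "i \<cdot> (q \<cdot> f) = f"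
    proof (rule pullback_eq[OF pb])
      have "q \<cdot> f \<in> Hom C X A" using H f by blast
      then show "q \<cdot> i \<cdot> q \<cdot> f = q \<cdot> f" "p \<cdot> i \<cdot> q \<cdot> f = p \<cdot> f" 
        using cmp_reassoc[OF i(2) _ i(1) H(2)] cmp_reassoc[OF i(3) _ i(1) H(1)] cmp_reassoc[OF refl f(1) H(2)]
          f by (auto simp: cmp_ide_left)
    qed (use f H i in blast)+
    then show "\<exists>g\<in>Hom C X A. i \<cdot> g = f" using H f by blast
  next
    fix X u assume u: "u \<in> Hom C X A" "i \<cdot> u = 0"
    show "u = 0" using u cmp_reassoc[OF i(2) u(1) i(1) H(2)] H by (simp add: cmp_ide_left)
  qed (use i H in auto)
  then show ?thesis using deflation_kernel_conflation[OF p] s by blast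
qed

text \<open>
  The pullback of the conflation along \<open>f\<close> ends in \<open>P\<close> and is therefore equivalent to the
  split one; a section of it yields the lift.
\<close>

lemma projective_lift:
  assumes P: "P \<in> projectives C E" and c: "(A, i, B, p, D) \<in> E" and f: "f \<in> Hom C P D"
  shows "\<exists>h\<in>Hom C P B. p \<cdot> h = f"
proof -
  have "deflation E B D p" using c unfolding deflation_def by blast
  then obtain B' p' f' where pb: "pullback C B D p P f B' p' f'" and p': "deflation E B' P p'"
    using deflation_pullback[OF _ f] by blast
  obtain A' i' where c': "(A', i', B', p', P) \<in> E" using p' unfolding deflation_def by blast
  obtain i'' B'' p'' s where c'': "(A', i'', B'', p'', P) \<in> E" and s: "s \<in> Hom C P B''" "p'' \<cdot> s = ide C P"
    using split_conflation_exists by blast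
  let ?r = "ext_equiv E C P A'"
  let ?x = "(i', B', p')" let ?y = "(i'', B'', p'')"
  have xy: "?x \<in> ext_conflations E P A'" "?y \<in> ext_conflations E P A'"
    using c' c'' unfolding ext_conflations_def by auto
  have "is_singleton (Ext1 C E P A')" using P unfolding projectives_def by blast
  then have "?r `` {?y} = ?r `` {?x}"
    using xy unfolding Ext1_def by (metis is_singletonE quotientI singletonD)
  moreover have "?x \<in> ?r `` {?x}"
    using xy c' conflationD[OF c'] iso_morphism_ide[of B'] unfolding ext_equiv_def
    by (auto intro!: exI[of _ "ide C B'"] simp: cmp_ide_left cmp_ide_right)
  ultimately have "(?y, ?x) \<in> ?r" by blast
  then obtain h where h: "iso_morphism C B'' B' h" "p' \<cdot> h = p''"
    unfolding ext_equiv_def by auto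
  have hH: "h \<in> Hom C B'' B'" using h unfolding iso_morphism_def by blast
  have H: "p \<in> Hom C B D" "p' \<in> Hom C B' P" "f' \<in> Hom C B' B" "p \<cdot> f' = f \<cdot> p'"
    using pb unfolding pullback_def by auto
  have hs: "h \<cdot> s \<in> Hom C P B'" "p' \<cdot> (h \<cdot> s) = ide C P"
    using hH s h H by (auto simp: cmp_assoc[symmetric])
  have "p \<cdot> (f' \<cdot> (h \<cdot> s)) = f \<cdot> (p' \<cdot> (h \<cdot> s))"
    by (rule cmp_square[OF H(4) hs(1) H(3,1,2) f])
  also have "\<dots> = f" using hs f by (simp add: cmp_ide_right)
  finally show ?thesis using H hs by blast
qed

lemma split_conflation_retraction:
  assumes c: "(A, i, B, p, P) \<in> E" and s: "s \<in> Hom C P B" "p \<cdot> s = ide C P"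
  obtains r where "r \<in> Hom C B A" "r \<cdot> i = ide C A" "r \<cdot> s = 0" "i \<cdot> r + s \<cdot> p = ide C B"
proof -
  note c' = conflationD[OF c]
  have "p \<cdot> (ide C B - s \<cdot> p) = p \<cdot> ide C B - (p \<cdot> s) \<cdot> p"
    using c' s cmp_reassoc[OF s(2) c'(2) s(1) c'(2)] by (subst cmp_diff_right) auto
  then have z: "p \<cdot> (ide C B - s \<cdot> p) = 0" using c' s by (simp add: cmp_ide_left cmp_ide_right)
  have "ide C B - s \<cdot> p \<in> Hom C B B" using c' s by blast
  from kernel_factor[OF c'(4) this z]
  obtain r where r: "r \<in> Hom C B A" "i \<cdot> r = ide C B - s \<cdot> p" by blast
  have "r \<cdot> i = ide C A"
  proof (rule kernel_mono[OF c'(4)])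
    have "i \<cdot> (r \<cdot> i) = (ide C B - s \<cdot> p) \<cdot> i" by (rule cmp_reassoc[OF r(2) c'(1) r(1) c'(1)])
    also have "\<dots> = i - s \<cdot> (p \<cdot> i)"
      using c' s by (subst cmp_diff_left) (auto simp: cmp_assoc cmp_ide_left)
    also have "\<dots> = i \<cdot> ide C A" using c' s by (simp add: cmp_ide_right)
    finally show "i \<cdot> (r \<cdot> i) = i \<cdot> ide C A" .
  qed (use r c' in auto)
  moreover have "r \<cdot> s = 0"
  proof (rule kernel_mono[OF c'(4)])
    have "i \<cdot> (r \<cdot> s) = (ide C B - s \<cdot> p) \<cdot> s" by (rule cmp_reassoc[OF r(2) s(1) r(1) c'(1)])
    also have "\<dots> = s - s \<cdot> (p \<cdot> s)"
      using c' s by (subst cmp_diff_left) (auto simp: cmp_assoc cmp_ide_left)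
    also have "\<dots> = i \<cdot> 0" using c' s by (simp add: cmp_ide_right)
    finally show "i \<cdot> (r \<cdot> s) = i \<cdot> 0" .
  qed (use r c' s in auto)
  ultimately show ?thesis using that[of r] r by simp
qed

text \<open>
  A section identifies \<open>B\<close> with the direct sum of \<open>A\<close> and \<open>P\<close>; the equivalence matches the
  summands.
\<close>

lemma split_conflations_equiv:
  assumes c: "(A, i, B, p, P) \<in> E" and s: "s \<in> Hom C P B" "p \<cdot> s = ide C P"
    and c2: "(A, i', B', p', P) \<in> E" and s2: "s' \<in> Hom C P B'" "p' \<cdot> s' = ide C P"
  shows "((i, B, p), (i', B', p')) \<in> ext_equiv E C P A"
proof -
  note H = conflationD(1,2,3)[OF c] and H' = conflationD(1,2,3)[OF c2]
  obtain r where r: "r \<in> Hom C B A" "r \<cdot> i = ide C A" "r \<cdot> s = 0" "i \<cdot> r + s \<cdot> p = ide C B"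
    by (rule split_conflation_retraction[OF c s])
  obtain r' where r': "r' \<in> Hom C B' A" "r' \<cdot> i' = ide C A" "r' \<cdot> s' = 0"
      "i' \<cdot> r' + s' \<cdot> p' = ide C B'"
    by (rule split_conflation_retraction[OF c2 s2])
  define h where "h = i' \<cdot> r + s' \<cdot> p"
  define k where "k = i \<cdot> r' + s \<cdot> p'"
  have hk: "h \<in> Hom C B B'" "k \<in> Hom C B' B"
    unfolding h_def k_def using H H' r r' s s2 by blast+
  have hi: "h \<cdot> i = i'" "h \<cdot> s = s'" "p' \<cdot> h = p"
  proof -
    have "h \<cdot> i = i' \<cdot> (r \<cdot> i) + s' \<cdot> (p \<cdot> i)" unfolding h_def using H H' r s s2
      by (subst cmp_add_left[of _ A B _ B']) (auto simp: cmp_assoc)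
    then show "h \<cdot> i = i'" using H H' r s2 by (simp add: cmp_ide_right)
    have "h \<cdot> s = i' \<cdot> (r \<cdot> s) + s' \<cdot> (p \<cdot> s)" unfolding h_def using H H' r s s2
      by (subst cmp_add_left[of _ P B _ B']) (auto simp: cmp_assoc)
    then show "h \<cdot> s = s'" using H H' r s s2 by (simp add: cmp_ide_right)
    have "p' \<cdot> h = (p' \<cdot> i') \<cdot> r + (p' \<cdot> s') \<cdot> p" unfolding h_def
      using H H' r s s2 cmp_reassoc[OF refl r(1) H'(1,2)] cmp_reassoc[OF refl H(2) s2(1) H'(2)]
      by (subst cmp_add_right[of _ B B' _ _ P]) auto
    then show "p' \<cdot> h = p" using H H' r s s2 by (simp add: cmp_ide_left)
  qed
  have ki: "k \<cdot> i' = i" "k \<cdot> s' = s"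
  proof -
    have "k \<cdot> i' = i \<cdot> (r' \<cdot> i') + s \<cdot> (p' \<cdot> i')" unfolding k_def using H H' r' s s2
      by (subst cmp_add_left[of _ A B' _ B]) (auto simp: cmp_assoc)
    then show "k \<cdot> i' = i" using H H' r' s by (simp add: cmp_ide_right)
    have "k \<cdot> s' = i \<cdot> (r' \<cdot> s') + s \<cdot> (p' \<cdot> s')" unfolding k_def using H H' r' s s2
      by (subst cmp_add_left[of _ P B' _ B]) (auto simp: cmp_assoc)
    then show "k \<cdot> s' = s" using H H' r' s s2 by (simp add: cmp_ide_right)
  qed
  have "k \<cdot> h = (k \<cdot> i') \<cdot> r + (k \<cdot> s') \<cdot> p"
    unfolding h_def using H H' r s s2 hk
      cmp_reassoc[OF refl r(1) H'(1) hk(2)] cmp_reassoc[OF refl H(2) s2(1) hk(2)]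
    by (subst cmp_add_right[of _ B B' _ _ B]) auto
  then have kh: "k \<cdot> h = ide C B" using ki r by simp
  have "h \<cdot> k = (h \<cdot> i) \<cdot> r' + (h \<cdot> s) \<cdot> p'"
    unfolding k_def using H H' r' s s2 hk
      cmp_reassoc[OF refl r'(1) H(1) hk(1)] cmp_reassoc[OF refl H'(2) s(1) hk(1)]
    by (subst cmp_add_right[of _ B' B _ _ B']) auto
  then have "h \<cdot> k = ide C B'" using hi r' by simp
  with kh hk have "iso_morphism C B B' h" unfolding iso_morphism_def by blast
  then show ?thesis using hi c c2 unfolding ext_equiv_def ext_conflations_def by auto
qed

text \<open>
  All conflations \<open>A \<rightarrow> B \<rightarrow> P\<close> split by assumption and are hence equivalent to each other,
  so \<open>Ext1\<close> has exactly one element.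
\<close>

lemma projectiveI:
  assumes "\<And>B p. deflation E B P p \<Longrightarrow> \<exists>s\<in>Hom C P B. p \<cdot> s = ide C P"
  shows "P \<in> projectives C E"
  unfolding projectives_def
proof (intro CollectI allI)
  fix A
  have sp: "\<exists>s\<in>Hom C P B. p \<cdot> s = ide C P" if "(A, i, B, p, P) \<in> E" for i B p
    using assms that unfolding deflation_def by blast
  have all: "(x, y) \<in> ext_equiv E C P A"
    if "x \<in> ext_conflations E P A" "y \<in> ext_conflations E P A" for x y
  proof -
    obtain i B p i' B' p' where xy: "x = (i, B, p)" "y = (i', B', p')" by (cases x, cases y) blast
    with that have c: "(A, i, B, p, P) \<in> E" "(A, i', B', p', P) \<in> E"
      unfolding ext_conflations_def by auto
    obtain s s' where "s \<in> Hom C P B" "p \<cdot> s = ide C P" "s' \<in> Hom C P B'" "p' \<cdot> s' = ide C P"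
      using sp[OF c(1)] sp[OF c(2)] by blast
    then show ?thesis unfolding xy using split_conflations_equiv c by blast
  qed
  have "ext_equiv E C P A `` {x} = ext_conflations E P A" if "x \<in> ext_conflations E P A" for x
    using all[OF that] by (auto simp: ext_equiv_def)
  moreover obtain x where "x \<in> ext_conflations E P A"
    using split_conflation_exists unfolding ext_conflations_def by blast
  ultimately have "Ext1 C E P A = {ext_conflations E P A}"
    unfolding Ext1_def quotient_def by auto
  then show "is_singleton (Ext1 C E P A)" by simp
qed

text \<open>
  Let \<open>d' : P \<rightarrow> B\<close> and \<open>q : P \<rightarrow> Y\<close> be the pullback of \<open>g h\<close> and \<open>g\<close>. As \<open>g h\<close> factors
  through \<open>g\<close>, the morphism \<open>q\<close> has a section, so that \<open>P\<close> is the direct sum of \<open>Y\<close> and \<open>A\<close>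
  and \<open>d'\<close> has the components \<open>h\<close> and \<open>i\<close>. Being a deflation, \<open>d'\<close> is the cokernel of its
  kernel, and that kernel is \<open>K\<close> embedded by \<open>k\<close> and \<open>-a\<close>. This is the universal property
  of the pushout.
\<close>

lemma obscure_pushout:
  assumes g: "is_kernel C A i B g D" and h: "h \<in> Hom C Y B"
    and k: "(K, k, Y, g \<cdot> h, D) \<in> E" and a: "a \<in> Hom C K A" "i \<cdot> a = h \<cdot> k"
  shows "pushout C K Y k A a B i h"
proof -
  have H: "i \<in> Hom C A B" "g \<in> Hom C B D" "g \<cdot> i = 0" using g unfolding is_kernel_def by auto
  note K = conflationD[OF k]
  obtain P d' q where pb: "pullback C Y D (g \<cdot> h) B g P d' q" and d': "deflation E P B d'"
    using deflation_pullback[of Y D "g \<cdot> h" g B] H k unfolding deflation_def by blast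
  have pbH: "d' \<in> Hom C P B" "q \<in> Hom C P Y" "(g \<cdot> h) \<cdot> q = g \<cdot> d'"
    using pb unfolding pullback_def by auto
  obtain K' \<kappa> where \<kappa>: "(K', \<kappa>, P, d', B) \<in> E" using d' unfolding deflation_def by blast
  note K' = conflationD[OF \<kappa>]
  obtain s where s: "s \<in> Hom C Y P" "q \<cdot> s = ide C Y" "d' \<cdot> s = h"
    by (rule pullback_lift[OF pb, of "ide C Y" Y h]) 
      (use h H K in \<open>auto simp: cmp_ide_right\<close>)
  obtain j where j: "j \<in> Hom C A P" "q \<cdot> j = 0" "d' \<cdot> j = i"
    by (rule pullback_lift[OF pb, of 0 A i]) (use h H K in \<open>auto simp: cmp_ide_right\<close>)
  have "g \<cdot> (d' - h \<cdot> q) = 0"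
    using H pbH h by (subst cmp_diff_right[of _ P B]) (auto simp: cmp_assoc)
  then obtain r where r: "r \<in> Hom C P A" "i \<cdot> r = d' - h \<cdot> q"
    using kernel_factor[OF g, of "d' - h \<cdot> q" P] pbH h by blast
  have d'_eq: "d' = i \<cdot> r + h \<cdot> q" using r by simp
  have ir: "i \<cdot> (r \<cdot> u) = d' \<cdot> u - h \<cdot> (q \<cdot> u)" if "u \<in> Hom C X P" for X u
  proof -
    have "i \<cdot> (r \<cdot> u) = (d' - h \<cdot> q) \<cdot> u" by (rule cmp_reassoc[OF r(2) that r(1) H(1)])
    then show ?thesis using that pbH h
      by (subst (asm) cmp_diff_left[of _ X P _ B]) (auto simp: cmp_assoc)
  qed
  have rs: "r \<cdot> s = 0"
    by (rule kernel_mono[OF g]) (use ir[OF s(1)] s r h H in \<open>auto simp: cmp_ide_right\<close>)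
  have rj: "r \<cdot> j = ide C A"
    by (rule kernel_mono[OF g]) (use ir[OF j(1)] j r h H in \<open>auto simp: cmp_ide_right\<close>)
  have "(g \<cdot> h) \<cdot> (q \<cdot> \<kappa>) = g \<cdot> (d' \<cdot> \<kappa>)" 
    by (rule cmp_square[OF pbH(3) K'(1) pbH(2) _ pbH(1)]) (use H h in auto)
  then have "(g \<cdot> h) \<cdot> (q \<cdot> \<kappa>) = 0" using K' H by simp
  then obtain l where l: "l \<in> Hom C K' K" "k \<cdot> l = q \<cdot> \<kappa>"
    using kernel_factor[OF K(4), of "q \<cdot> \<kappa>" K'] pbH K' by blast
  have r\<kappa>: "r \<cdot> \<kappa> = - (a \<cdot> l)"
  proof (rule kernel_mono[OF g])
    have "i \<cdot> (r \<cdot> \<kappa>) = - (h \<cdot> (k \<cdot> l))" using ir[OF K'(1)] K' l by simp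
    also have "\<dots> = - (i \<cdot> (a \<cdot> l))" using cmp_square[OF a(2) l(1) a(1) H(1) K(1) h] by simp
    also have "\<dots> = i \<cdot> (0 - a \<cdot> l)" using H a l by (subst cmp_diff_right[of _ K' A]) auto
    finally show "i \<cdot> (r \<cdot> \<kappa>) = i \<cdot> (- (a \<cdot> l))" by simp
  qed (use r K' a l in auto)
  show ?thesis
    unfolding pushout_def
  proof (intro conjI allI ballI impI)
    fix X u v assume u: "u \<in> Hom C Y X" and v: "v \<in> Hom C A X" and uv: "u \<cdot> k = v \<cdot> a"
    \<comment> \<open>In the decomposition of \<open>P\<close> this is the map with components \<open>u\<close> and \<open>v\<close>.\<close>
    define m' where "m' = v \<cdot> r + u \<cdot> q"
    have m': "m' \<in> Hom C P X" unfolding m'_def using u v r pbH by blast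
    have m'_cmp: "m' \<cdot> t = v \<cdot> (r \<cdot> t) + u \<cdot> (q \<cdot> t)" if "t \<in> Hom C W P" for t W
      unfolding m'_def using u v r pbH that
      by (subst cmp_add_left[of _ W P _ X]) (auto simp: cmp_assoc)
    have "m' \<cdot> \<kappa> = v \<cdot> (0 - a \<cdot> l) + u \<cdot> (k \<cdot> l)" using m'_cmp[OF K'(1)] r\<kappa> l by simp
    also have "v \<cdot> (0 - a \<cdot> l) = - ((v \<cdot> a) \<cdot> l)"
      using v a l by (subst cmp_diff_right[of _ K' A]) (auto simp: cmp_assoc)
    also have "u \<cdot> (k \<cdot> l) = (v \<cdot> a) \<cdot> l" by (rule cmp_reassoc[OF uv l(1) K(1) u])
    finally have "m' \<cdot> \<kappa> = 0" by simp
    then obtain m where m: "m \<in> Hom C B X" "m \<cdot> d' = m'" using cokernel_factor[OF K'(5) m'] by blast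
    have "m \<cdot> h = m' \<cdot> s" using cmp_reassoc[OF m(2) s(1) pbH(1) m(1)] s by simp
    then have mh: "m \<cdot> h = u" using m'_cmp[OF s(1)] s rs v u by (simp add: cmp_ide_right)
    have "m \<cdot> i = m' \<cdot> j" using cmp_reassoc[OF m(2) j(1) pbH(1) m(1)] j by simp
    then have mi: "m \<cdot> i = v" using m'_cmp[OF j(1)] j rj v u by (simp add: cmp_ide_right)
    show "\<exists>!m. m \<in> Hom C B X \<and> m \<cdot> h = u \<and> m \<cdot> i = v"
    proof (rule ex1I[of _ m])
      fix n assume n: "n \<in> Hom C B X \<and> n \<cdot> h = u \<and> n \<cdot> i = v"
      have "n \<cdot> d' = (n \<cdot> i) \<cdot> r + (n \<cdot> h) \<cdot> q"
        unfolding d'_eq using n H r h pbH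
        by (subst cmp_add_right[of _ P B _ _ X]) (auto simp: cmp_assoc)
      then have "n \<cdot> d' = m \<cdot> d'" using n m m'_def by simp
      then show "n = m" using cokernel_epi[OF K'(5)] n m by blast
    qed (use m mh mi in blast)
  qed (use K a H h in auto)
qed

lemma pushout_iso:
  assumes p: "pushout C A B i A' f B' i' f'" and p2: "pushout C A B i A' f B2 i2 f2"
  obtains b where "iso_morphism C B' B2 b" "b \<cdot> i' = i2"
proof -
  have H: "i' \<in> Hom C A' B'" "f' \<in> Hom C B B'" "f' \<cdot> i = i' \<cdot> f"
      "i2 \<in> Hom C A' B2" "f2 \<in> Hom C B B2" "f2 \<cdot> i = i2 \<cdot> f"
    using p p2 unfolding pushout_def by auto
  obtain b where b: "b \<in> Hom C B' B2" "b \<cdot> f' = f2" "b \<cdot> i' = i2"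
    using p H unfolding pushout_def by metis
  obtain c where c: "c \<in> Hom C B2 B'" "c \<cdot> f2 = f'" "c \<cdot> i2 = i'"
    using p2 H unfolding pushout_def by metis
  have "(c \<cdot> b) \<cdot> f' = f'" "(c \<cdot> b) \<cdot> i' = i'"
    using b c H cmp_assoc[OF _ b(1) c(1)] by auto
  moreover have "ide C B' \<cdot> f' = f'" "ide C B' \<cdot> i' = i'" using H cmp_ide_left by blast+
  moreover have "c \<cdot> b \<in> Hom C B' B'" using b c by blast
  ultimately have cb: "c \<cdot> b = ide C B'" using p H ide_Hom[of B'] unfolding pushout_def by metis
  have "(b \<cdot> c) \<cdot> f2 = f2" "(b \<cdot> c) \<cdot> i2 = i2"
    using b c H cmp_assoc[OF _ c(1) b(1)] by auto
  moreover have "ide C B2 \<cdot> f2 = f2" "ide C B2 \<cdot> i2 = i2" using H cmp_ide_left by blast+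
  moreover have "b \<cdot> c \<in> Hom C B2 B2" using b c by blast
  ultimately have bc: "b \<cdot> c = ide C B2" using p2 H ide_Hom[of B2] unfolding pushout_def by metis
  show ?thesis using that b c cb bc unfolding iso_morphism_def by blast
qed

text \<open>
  Quillen's obscure axiom. By the preceding lemma, \<open>i\<close> is up to isomorphism the pushout of the
  inflation \<open>k\<close>, hence itself an inflation.
\<close>

lemma obscure_axiom:
  assumes g: "is_kernel C A i B g D" "is_cokernel C A i B g D"
    and h: "h \<in> Hom C Y B" and d: "deflation E Y D (g \<cdot> h)"
  shows "(A, i, B, g, D) \<in> E"
proof -
  have H: "i \<in> Hom C A B" "g \<in> Hom C B D" "g \<cdot> i = 0" using g unfolding is_kernel_def by auto
  obtain K k where k: "(K, k, Y, g \<cdot> h, D) \<in> E" using d unfolding deflation_def by blast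
  note K = conflationD[OF k]
  have "g \<cdot> (h \<cdot> k) = 0" using K(3) cmp_assoc[OF K(1) h H(2)] by simp
  then obtain a where a: "a \<in> Hom C K A" "i \<cdot> a = h \<cdot> k"
    using kernel_factor[OF g(1), of "h \<cdot> k" K] h K by blast
  have ik: "inflation E K Y k" using k unfolding inflation_def by blast
  obtain B' i' f' where po: "pushout C K Y k A a B' i' f'" and i': "inflation E A B' i'"
    using inflation_pushout[OF ik a(1)] by blast
  obtain b where b: "iso_morphism C B' B b" "b \<cdot> i' = i"
    by (rule pushout_iso[OF po obscure_pushout[OF g(1) h k a]])
  obtain p' D' where c: "(A, i', B', p', D') \<in> E" using i' unfolding inflation_def by blast
  note c' = conflationD[OF c]
  obtain b' where b': "b \<in> Hom C B' B" "b' \<in> Hom C B B'" "b' \<cdot> b = ide C B'" "b \<cdot> b' = ide C B"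
    using b unfolding iso_morphism_def by blast
  have "(A, i, B, p' \<cdot> b', D') \<in> E"
  proof (rule iso_closed[OF c iso_morphism_ide b(1) iso_morphism_ide])
    show "(p' \<cdot> b') \<cdot> b = ide C D' \<cdot> p'" 
      using cmp_assoc[OF b'(1,2) c'(2)] b' c' by (simp add: cmp_ide_left cmp_ide_right)
  qed (use H b b' c' in \<open>auto simp: cmp_ide_right\<close>)
  then have "inflation E A B i" unfolding inflation_def by blast
  then show ?thesis by (rule inflation_cokernel_conflation[OF _ g(2)])
qed

end

section \<open>Defects and their subfunctors\<close>

context linear_category
begin

text \<open>
  As introduction rules the closure properties make classical search diverge as soon as an object
  or a morphism is unknown. From here on they are applied explicitly.
\<close>

declare cmp_Hom [rule del] Hom_add [rule del] Hom_diff [rule del] Hom_uminus [rule del]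
lemmas Hom_closed = Hom_add Hom_diff Hom_uminus

text \<open>
  The defect of \<open>g : B \<rightarrow> D\<close> at \<open>X\<close> consists of the cosets of \<open>img g B X\<close> in \<open>Hom C X D\<close>.
\<close>

definition img :: "'m \<Rightarrow> 'o \<Rightarrow> 'o \<Rightarrow> 'm set"
  where "img g B X = cmp C g ` Hom C X B"

definition coset :: "'m \<Rightarrow> 'o \<Rightarrow> 'o \<Rightarrow> 'm \<Rightarrow> 'm set"
  where "coset g B X f = (\<lambda>h. f + h) ` img g B X"

lemma imgE:
  assumes "h \<in> img g B X"
  obtains b where "b \<in> Hom C X B" "h = g \<cdot> b"
  using assms unfolding img_def by (rule imageE)

lemma imgI: "b \<in> Hom C X B \<Longrightarrow> g \<cdot> b \<in> img g B X"
  unfolding img_def by (rule imageI)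

lemma img_closed:
  assumes g: "g \<in> Hom C B D"
  shows "img g B X \<subseteq> Hom C X D" "0 \<in> img g B X"
    "h \<in> img g B X \<Longrightarrow> h' \<in> img g B X \<Longrightarrow> h + h' \<in> img g B X"
    "h \<in> img g B X \<Longrightarrow> h' \<in> img g B X \<Longrightarrow> h - h' \<in> img g B X"
    "h \<in> img g B X \<Longrightarrow> - h \<in> img g B X"
    "h \<in> img g B X \<Longrightarrow> u \<in> Hom C Y X \<Longrightarrow> h \<cdot> u \<in> img g B Y"
proof -
  show *: "h - h' \<in> img g B X" if hh: "h \<in> img g B X" "h' \<in> img g B X" for h h'
  proof -
    obtain b where b: "b \<in> Hom C X B" "h = g \<cdot> b" by (rule imgE[OF hh(1)])
    obtain b' where b': "b' \<in> Hom C X B" "h' = g \<cdot> b'" by (rule imgE[OF hh(2)])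
    have "h - h' = g \<cdot> (b - b')" using cmp_diff_right[OF b(1) b'(1) g] b b' by simp
    then show ?thesis using imgI[OF Hom_diff[OF b(1) b'(1)]] by simp
  qed
  show z: "0 \<in> img g B X"
    using imgI[OF Hom_0, of g B X] cmp_0_right[OF g] by simp
  show m: "- h \<in> img g B X" if "h \<in> img g B X" for h using *[OF z that] by simp
  show "h + h' \<in> img g B X" if "h \<in> img g B X" "h' \<in> img g B X"
    using *[OF that(1) m[OF that(2)]] by simp
  show "img g B X \<subseteq> Hom C X D" using g unfolding img_def by (auto intro: cmp_Hom[OF _ g])
  show "h \<cdot> u \<in> img g B Y" if hu: "h \<in> img g B X" "u \<in> Hom C Y X"
  proof -
    obtain b where b: "b \<in> Hom C X B" "h = g \<cdot> b" by (rule imgE[OF hu(1)])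
    then have "h \<cdot> u = g \<cdot> (b \<cdot> u)" using cmp_assoc[OF that(2) b(1) g] by simp
    then show ?thesis using imgI[OF cmp_Hom[OF that(2) b(1)]] by simp
  qed
qed

lemma mem_coset: "f' \<in> coset g B X f \<longleftrightarrow> f' - f \<in> img g B X"
  unfolding coset_def by (force simp: image_iff)

lemma coset_eq_iff:
  assumes g: "g \<in> Hom C B D"
  shows "coset g B X f = coset g B X f' \<longleftrightarrow> f - f' \<in> img g B X"
proof
  assume "coset g B X f = coset g B X f'"
  moreover have "f \<in> coset g B X f" using img_closed[OF g] by (simp add: mem_coset)
  ultimately show "f - f' \<in> img g B X" using mem_coset by metis
next
  assume a: "f - f' \<in> img g B X"
  have "h - f \<in> img g B X \<longleftrightarrow> h - f' \<in> img g B X" for h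
    using img_closed(3)[OF g _ a, of "h - f"] img_closed(4)[OF g _ a, of "h - f'"] by auto
  then show "coset g B X f = coset g B X f'" by (auto simp: mem_coset)
qed

lemma comm_group_hom_group: "comm_group (hom_group C X D)"
proof (rule comm_groupI)
  fix x assume "x \<in> carrier (hom_group C X D)"
  then show "\<exists>y\<in>carrier (hom_group C X D). y \<otimes>\<^bsub>hom_group C X D\<^esub> x = \<one>\<^bsub>hom_group C X D\<^esub>"
    by (intro bexI[of _ "- x"]) (auto simp: hom_group_def Hom_closed)
qed (auto simp: hom_group_def add_ac Hom_closed)

lemma subgroup_img:
  assumes g: "g \<in> Hom C B D"
  shows "subgroup (img g B X) (hom_group C X D)"
proof -
  interpret comm_group "hom_group C X D" by (rule comm_group_hom_group)
  show ?thesis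
  proof (rule subgroupI)
    show "inv\<^bsub>hom_group C X D\<^esub> a \<in> img g B X" if "a \<in> img g B X" for a
    proof -
      have "inv\<^bsub>hom_group C X D\<^esub> a = - a"
        by (rule inv_equality) (use that img_closed[OF g, where X=X] in \<open>auto simp: hom_group_def\<close>)
      then show ?thesis using img_closed[OF g] that by simp
    qed
  qed (use img_closed[OF g, where X=X] in \<open>auto simp: hom_group_def\<close>)
qed

lemma r_coset_hom_group: "img g B X #>\<^bsub>hom_group C X D\<^esub> f = coset g B X f"
  unfolding r_coset_def coset_def hom_group_def by (auto simp: add.commute)

context
  fixes A :: 'o and i :: 'm and B :: 'o and g :: 'm and D :: 'o
  assumes g: "g \<in> Hom C B D"
begin

abbreviation "defect_module \<equiv> defect C (A, i, B, g, D)"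

lemma fob_defect: "fob defect_module X = hom_group C X D Mod img g B X"
  by (simp add: img_def)

lemma carrier_defect: "carrier (fob defect_module X) = coset g B X ` Hom C X D"
  unfolding fob_defect FactGroup_def RCOSETS_def r_coset_hom_group by (auto simp: hom_group_def)

lemma one_defect: "\<one>\<^bsub>fob defect_module X\<^esub> = coset g B X 0"
  unfolding fob_defect FactGroup_def by (simp add: coset_def)

lemma mult_defect:
  assumes "f \<in> Hom C X D" "f' \<in> Hom C X D"
  shows "coset g B X f \<otimes>\<^bsub>fob defect_module X\<^esub> coset g B X f' = coset g B X (f + f')"
proof -
  interpret comm_group "hom_group C X D" by (rule comm_group_hom_group)
  interpret N: normal "img g B X" "hom_group C X D"
    by (rule subgroup_imp_normal[OF subgroup_img[OF g]])
  show ?thesis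
    using N.rcos_sum[of f f'] assms
    unfolding fob_defect FactGroup_def r_coset_hom_group by (simp add: hom_group_def r_coset_hom_group)
qed

lemma comm_group_defect: "comm_group (fob defect_module X)"
  unfolding fob_defect
  by (rule comm_group.abelian_FactGroup[OF comm_group_hom_group subgroup_img[OF g]])

lemma fmor_defect:
  assumes "f \<in> Hom C Y D" "u \<in> Hom C X Y"
  shows "fmor defect_module X Y u (coset g B Y f) = coset g B X (f \<cdot> u)"
proof -
  have "fmor defect_module X Y u (coset g B Y f) = img g B X <#>\<^bsub>hom_group C X D\<^esub> ((\<lambda>s. s \<cdot> u) ` coset g B Y f)"
    by (simp add: img_def)
  also have "\<dots> = {h + (f + h') \<cdot> u | h h'. h \<in> img g B X \<and> h' \<in> img g B Y}"
    unfolding set_mult_def coset_def hom_group_def by auto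
  also have "\<dots> = coset g B X (f \<cdot> u)"
  proof (intro equalityI subsetI)
    fix s assume "s \<in> {h + (f + h') \<cdot> u | h h'. h \<in> img g B X \<and> h' \<in> img g B Y}"
    then obtain h h' where s: "s = h + (f + h') \<cdot> u" "h \<in> img g B X" "h' \<in> img g B Y" by blast
    have "(f + h') \<cdot> u = f \<cdot> u + h' \<cdot> u"
      using s img_closed(1)[OF g] by (intro cmp_add_left[OF assms(2,1)]) auto
    then have "s = f \<cdot> u + (h + h' \<cdot> u)" using s by (simp add: algebra_simps)
    moreover have "h + h' \<cdot> u \<in> img g B X"
      by (rule img_closed(3)[OF g s(2) img_closed(6)[OF g s(3) assms(2)]])
    ultimately show "s \<in> coset g B X (f \<cdot> u)" unfolding coset_def by blast
  next
    fix s assume "s \<in> coset g B X (f \<cdot> u)"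
    then obtain h where "h \<in> img g B X" "s = h + (f + 0) \<cdot> u" unfolding coset_def by (auto simp: add.commute)
    then show "s \<in> {h + (f + h') \<cdot> u | h h'. h \<in> img g B X \<and> h' \<in> img g B Y}"
      using img_closed(2)[OF g] by blast
  qed
  finally show ?thesis .
qed

lemma right_module_defect: "right_module C defect_module"
  unfolding right_module_def
proof (intro conjI allI ballI)
  fix X Y u assume u: "u \<in> Hom C X Y"
  show "fmor defect_module X Y u \<in> Group.hom (fob defect_module Y) (fob defect_module X)"
  proof (rule homI)
    fix x y assume "x \<in> carrier (fob defect_module Y)" "y \<in> carrier (fob defect_module Y)"
    then obtain f f' where f: "x = coset g B Y f" "y = coset g B Y f'" "f \<in> Hom C Y D" "f' \<in> Hom C Y D"
      unfolding carrier_defect by blast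
    show "fmor defect_module X Y u x \<in> carrier (fob defect_module X)"
      unfolding f(1) fmor_defect[OF f(3) u] carrier_defect using cmp_Hom[OF u f(3)] by blast
    show "fmor defect_module X Y u (x \<otimes>\<^bsub>fob defect_module Y\<^esub> y) = fmor defect_module X Y u x \<otimes>\<^bsub>fob defect_module X\<^esub> fmor defect_module X Y u y"
      unfolding f(1,2) mult_defect[OF f(3,4)] fmor_defect[OF f(3) u] fmor_defect[OF f(4) u]
        fmor_defect[OF Hom_add[OF f(3,4)] u]
        mult_defect[OF cmp_Hom[OF u f(3)] cmp_Hom[OF u f(4)]] cmp_add_left[OF u f(3,4)] ..
  qed
next
  fix X a assume "a \<in> carrier (fob defect_module X)"
  then show "fmor defect_module X X (ide C X) a = a"
    unfolding carrier_defect by (auto simp del: defect.simps simp: fmor_defect cmp_ide_right)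
next
  fix X Y Z u v a assume u: "u \<in> Hom C X Y" and v: "v \<in> Hom C Y Z" and "a \<in> carrier (fob defect_module Z)"
  then obtain f where f: "a = coset g B Z f" "f \<in> Hom C Z D" unfolding carrier_defect by blast
  show "fmor defect_module X Z (v \<cdot> u) a = fmor defect_module X Y u (fmor defect_module Y Z v a)"
    unfolding f(1) fmor_defect[OF f(2) cmp_Hom[OF u v]] fmor_defect[OF f(2) v]
      fmor_defect[OF cmp_Hom[OF v f(2)] u] cmp_assoc[OF u v f(2)] ..
next
  fix X Y u v a assume u: "u \<in> Hom C X Y" and v: "v \<in> Hom C X Y" and "a \<in> carrier (fob defect_module Y)"
  then obtain f where f: "a = coset g B Y f" "f \<in> Hom C Y D" unfolding carrier_defect by blast
  show "fmor defect_module X Y (u + v) a = fmor defect_module X Y u a \<otimes>\<^bsub>fob defect_module X\<^esub> fmor defect_module X Y v a"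
    unfolding f(1) fmor_defect[OF f(2) Hom_add[OF u v]] fmor_defect[OF f(2) u] fmor_defect[OF f(2) v]
      mult_defect[OF cmp_Hom[OF u f(2)] cmp_Hom[OF v f(2)]] cmp_add_right[OF u v f(2)] ..
qed (rule comm_group_defect)

end

lemma right_module_restrict:
  assumes M: "right_module C M" and U: "\<And>X. subgroup (U X) (fob M X)"
    and cl: "\<And>X Y \<phi>. \<phi> \<in> Hom C X Y \<Longrightarrow> fmor M X Y \<phi> ` U Y \<subseteq> U X"
  shows "right_module C (restrict_module M U)"
proof -
  have sub: "U X \<subseteq> carrier (fob M X)" for X using subgroup.subset[OF U] .
  have cg: "comm_group (fob M X)" for X using M unfolding right_module_def by blast
  have "comm_group ((fob M X)\<lparr>carrier := U X\<rparr>)" for X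
  proof -
    interpret comm_group "fob M X" by (rule cg)
    interpret S: subgroup "U X" "fob M X" by (rule U)
    have "group ((fob M X)\<lparr>carrier := U X\<rparr>)" by (rule subgroup_imp_group[OF U])
    then show ?thesis
      by (rule group.group_comm_groupI) (use m_comm sub in auto)
  qed
  moreover have "fmor M X Y \<phi> \<in> Group.hom ((fob M Y)\<lparr>carrier := U Y\<rparr>) ((fob M X)\<lparr>carrier := U X\<rparr>)"
    if "\<phi> \<in> Hom C X Y" for X Y \<phi>
  proof -
    have "fmor M X Y \<phi> \<in> Group.hom (fob M Y) (fob M X)" using M that unfolding right_module_def by blast
    then show ?thesis using cl[OF that] sub unfolding Group.hom_def by (auto simp: Pi_iff) (meson subsetD)+
  qed
  ultimately show ?thesis
    using M sub unfolding right_module_def restrict_module_def by (simp add: subset_iff)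
qed

end

context exact_category
begin

text \<open>
  In terms of defects: \<open>u \<mapsto> f u\<close> embeds the defect of the pulled back deflation \<open>p'\<close> into the
  defect of \<open>g\<close>.
\<close>

lemma pullback_img_iff:
  assumes pb: "pullback C B D g Y f B' p' f'" and u: "u \<in> Hom C X Y"
  shows "f \<cdot> u \<in> img g B X \<longleftrightarrow> u \<in> img p' B' X"
proof -
  have H: "g \<in> Hom C B D" "f \<in> Hom C Y D" "p' \<in> Hom C B' Y" "f' \<in> Hom C B' B" "g \<cdot> f' = f \<cdot> p'"
    using pb unfolding pullback_def by auto
  show ?thesis
  proof
    assume "f \<cdot> u \<in> img g B X"
    then obtain b where b: "b \<in> Hom C X B" "f \<cdot> u = g \<cdot> b" by (rule imgE)
    obtain h where h: "h \<in> Hom C X B'" "p' \<cdot> h = u"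
      by (rule pullback_lift[OF pb b(1) u b(2)[symmetric]])
    then show "u \<in> img p' B' X" using imgI[of h X B' p'] by simp
  next
    assume "u \<in> img p' B' X"
    then obtain h where h: "h \<in> Hom C X B'" "u = p' \<cdot> h" by (rule imgE)
    have "f \<cdot> u = g \<cdot> (f' \<cdot> h)" using cmp_square[OF H(5) h(1) H(4,1,3,2)] h by simp
    then show "f \<cdot> u \<in> img g B X" using imgI[OF cmp_Hom[OF h(1) H(4)]] by simp
  qed
qed

definition cyclic :: "'m \<Rightarrow> 'o \<Rightarrow> 'o \<Rightarrow> 'm \<Rightarrow> 'o \<Rightarrow> 'm set set"
  where "cyclic g B Y f X = (\<lambda>u. coset g B X (f \<cdot> u)) ` Hom C X Y"

text \<open>
  The subfunctor of the defect generated by the class of \<open>f\<close> is isomorphic to the defect of the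
  pullback of the conflation along \<open>f\<close>, which is again a conflation.
\<close>

lemma eff_subobject_cyclic:
  assumes c: "(A, i, B, g, D) \<in> E" and f: "f \<in> Hom C Y D"
  shows "eff_subobject C E (defect C (A, i, B, g, D)) (cyclic g B Y f)"
proof -
  let ?M = "defect C (A, i, B, g, D)"
  let ?U = "cyclic g B Y f"
  have g: "g \<in> Hom C B D" using conflationD[OF c] by blast
  have "deflation E B D g" using c unfolding deflation_def by blast
  then obtain B' p' f' where pb: "pullback C B D g Y f B' p' f'" and p': "deflation E B' Y p'"
    using deflation_pullback f by blast
  obtain A' i' where c': "(A', i', B', p', Y) \<in> E" using p' unfolding deflation_def by blast
  have p'H: "p' \<in> Hom C B' Y" using conflationD[OF c'] by blast
  let ?N = "defect C (A', i', B', p', Y)"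
  have coset_iff: "coset g B X (f \<cdot> u) = coset g B X (f \<cdot> v) \<longleftrightarrow> coset p' B' X u = coset p' B' X v"
    if "u \<in> Hom C X Y" "v \<in> Hom C X Y" for X u v
    using pullback_img_iff[OF pb Hom_diff[OF that]] that f
    unfolding coset_eq_iff[OF g] coset_eq_iff[OF p'H] by (simp add: cmp_diff_right)
  have sub: "subgroup (?U X) (fob ?M X)" for X
  proof -
    interpret comm_group "fob ?M X" by (rule comm_group_defect[OF g])
    show ?thesis
    proof (rule subgroupI)
      show "?U X \<subseteq> carrier (fob ?M X)"
        unfolding cyclic_def carrier_defect[OF g] using cmp_Hom[OF _ f] by blast
      show "?U X \<noteq> {}" unfolding cyclic_def using Hom_0 by blast
    next
      fix a assume "a \<in> ?U X"
      then obtain u where u: "u \<in> Hom C X Y" "a = coset g B X (f \<cdot> u)" unfolding cyclic_def by blast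
      have fu: "f \<cdot> u \<in> Hom C X D" by (rule cmp_Hom[OF u(1) f])
      have fu': "f \<cdot> (- u) = - (f \<cdot> u)" using cmp_diff_right[OF Hom_0 u(1) f] f by simp
      have "inv\<^bsub>fob ?M X\<^esub> a = coset g B X (f \<cdot> (- u))"
        unfolding u(2)
      proof (rule inv_equality)
        show "coset g B X (f \<cdot> (- u)) \<otimes>\<^bsub>fob ?M X\<^esub> coset g B X (f \<cdot> u) = \<one>\<^bsub>fob ?M X\<^esub>"
          unfolding fu' mult_defect[OF g Hom_uminus[OF fu] fu] one_defect[OF g] by simp
        show "coset g B X (f \<cdot> u) \<in> carrier (fob ?M X)"
          unfolding carrier_defect[OF g] by (rule imageI[OF fu])
        show "coset g B X (f \<cdot> (- u)) \<in> carrier (fob ?M X)"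
          unfolding carrier_defect[OF g] fu' by (rule imageI[OF Hom_uminus[OF fu]])
      qed
      then show "inv\<^bsub>fob ?M X\<^esub> a \<in> ?U X"
        unfolding cyclic_def using Hom_uminus[OF u(1)] by blast
    next
      fix a b assume "a \<in> ?U X" "b \<in> ?U X"
      then obtain u v where u: "u \<in> Hom C X Y" "a = coset g B X (f \<cdot> u)"
        and v: "v \<in> Hom C X Y" "b = coset g B X (f \<cdot> v)" unfolding cyclic_def by blast
      have "a \<otimes>\<^bsub>fob ?M X\<^esub> b = coset g B X (f \<cdot> (u + v))"
        unfolding u(2) v(2) mult_defect[OF g cmp_Hom[OF u(1) f] cmp_Hom[OF v(1) f]]
          cmp_add_right[OF u(1) v(1) f] ..
      then show "a \<otimes>\<^bsub>fob ?M X\<^esub> b \<in> ?U X"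
        unfolding cyclic_def using Hom_add[OF u(1) v(1)] by blast
    qed
  qed
  have fmor_cyclic: "fmor ?M X Z v (coset g B Z (f \<cdot> u)) = coset g B X (f \<cdot> (u \<cdot> v))"
    if "v \<in> Hom C X Z" "u \<in> Hom C Z Y" for X Z u v
    unfolding fmor_defect[OF g cmp_Hom[OF that(2) f] that(1)] cmp_assoc[OF that f] ..
  have cl: "fmor ?M X Z v ` ?U Z \<subseteq> ?U X" if v: "v \<in> Hom C X Z" for X Z v
  proof
    fix a assume "a \<in> fmor ?M X Z v ` ?U Z"
    then obtain u where u: "u \<in> Hom C Z Y" "a = coset g B X (f \<cdot> (u \<cdot> v))"
      unfolding cyclic_def using fmor_cyclic[OF v] by (auto simp del: defect.simps)
    then show "a \<in> ?U X" unfolding cyclic_def using cmp_Hom[OF v u(1)] by blast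
  qed
  have rm: "right_module C (restrict_module ?M ?U)"
    by (rule right_module_restrict[OF right_module_defect[OF g] sub cl])
  \<comment> \<open>The inverse of \<open>u \<mapsto> f u\<close> takes a coset to its preimage, which is again a coset.\<close>
  define \<eta> where "\<eta> X S = {u \<in> Hom C X Y. f \<cdot> u \<in> S}" for X S
  have eta: "\<eta> X (coset g B X (f \<cdot> u)) = coset p' B' X u" if u: "u \<in> Hom C X Y" for X u
  proof -
    have "v \<in> Hom C X Y \<and> f \<cdot> v - f \<cdot> u \<in> img g B X \<longleftrightarrow> v - u \<in> img p' B' X" for v
    proof (cases "v \<in> Hom C X Y")
      case True
      then show ?thesis using pullback_img_iff[OF pb Hom_diff[OF True u]] u f by (simp add: cmp_diff_right)
    next
      case False
      have "v - u \<notin> img p' B' X"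
      proof
        assume "v - u \<in> img p' B' X"
        then have "v - u \<in> Hom C X Y" using img_closed(1)[OF p'H] by blast
        then have "v - u + u \<in> Hom C X Y" using u by (rule Hom_add)
        then show False using False by simp
      qed
      then show ?thesis using False by blast
    qed
    then show ?thesis unfolding \<eta>_def by (auto simp: mem_coset)
  qed
  have "module_isomorphic C (restrict_module ?M ?U) ?N"
    unfolding module_isomorphic_def
  proof (intro exI[of _ \<eta>] conjI allI ballI)
    fix X
    have car: "carrier (fob (restrict_module ?M ?U) X) = ?U X" 
      and mul: "mult (fob (restrict_module ?M ?U) X) = mult (fob ?M X)"
      unfolding restrict_module_def by (simp_all del: defect.simps)
    show "\<eta> X \<in> iso (fob (restrict_module ?M ?U) X) (fob ?N X)"
      unfolding iso_def mem_Collect_eq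
    proof
      show "\<eta> X \<in> Group.hom (fob (restrict_module ?M ?U) X) (fob ?N X)"
      proof (rule homI, unfold car mul carrier_defect[OF p'H])
        fix a b assume "a \<in> ?U X" "b \<in> ?U X"
        then obtain u v where u: "u \<in> Hom C X Y" "a = coset g B X (f \<cdot> u)"
          and v: "v \<in> Hom C X Y" "b = coset g B X (f \<cdot> v)" unfolding cyclic_def by blast
        show "\<eta> X a \<in> coset p' B' X ` Hom C X Y" using eta[OF u(1)] u by blast
        have "a \<otimes>\<^bsub>fob ?M X\<^esub> b = coset g B X (f \<cdot> (u + v))"
          unfolding u(2) v(2) mult_defect[OF g cmp_Hom[OF u(1) f] cmp_Hom[OF v(1) f]]
            cmp_add_right[OF u(1) v(1) f] ..
        then show "\<eta> X (a \<otimes>\<^bsub>fob ?M X\<^esub> b) = \<eta> X a \<otimes>\<^bsub>fob ?N X\<^esub> \<eta> X b"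
          using eta[OF u(1)] eta[OF v(1)] eta[OF Hom_add[OF u(1) v(1)]] u(2) v(2)
            mult_defect[OF p'H u(1) v(1)] by (simp del: defect.simps)
      qed
      have "inj_on (\<eta> X) (?U X)"
      proof (rule inj_onI)
        fix a b assume "a \<in> ?U X" "b \<in> ?U X" and ab: "\<eta> X a = \<eta> X b"
        then obtain u v where u: "u \<in> Hom C X Y" "a = coset g B X (f \<cdot> u)"
          and v: "v \<in> Hom C X Y" "b = coset g B X (f \<cdot> v)" unfolding cyclic_def by blast
        show "a = b" using ab unfolding u(2) v(2) eta[OF u(1)] eta[OF v(1)] coset_iff[OF u(1) v(1)] .
      qed
      moreover have "\<eta> X ` ?U X = coset p' B' X ` Hom C X Y"
        unfolding cyclic_def image_image using eta by (intro image_cong) auto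
      ultimately show "bij_betw (\<eta> X) (carrier (fob (restrict_module ?M ?U) X)) (carrier (fob ?N X))"
        unfolding bij_betw_def car carrier_defect[OF p'H] by blast
    qed
  next
    fix X Z v a assume v: "v \<in> Hom C X Z" and "a \<in> carrier (fob (restrict_module ?M ?U) Z)"
    then have "a \<in> ?U Z" unfolding restrict_module_def by simp
    then obtain u where u: "u \<in> Hom C Z Y" "a = coset g B Z (f \<cdot> u)" unfolding cyclic_def by blast
    have "fmor (restrict_module ?M ?U) X Z v a = coset g B X (f \<cdot> (u \<cdot> v))"
      unfolding restrict_module_def using fmor_cyclic[OF v u(1)] u by (simp del: defect.simps)
    then show "\<eta> X (fmor (restrict_module ?M ?U) X Z v a) = fmor ?N X Z v (\<eta> Z a)"
      using eta[OF u(1)] eta[OF cmp_Hom[OF v u(1)]] fmor_defect[OF p'H u(1) v] u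
      by (simp del: defect.simps)
  qed
  then have "restrict_module ?M ?U \<in> eff C E" unfolding eff_def using rm c' by blast
  then show ?thesis unfolding eff_subobject_def using sub cl by blast
qed

text \<open>
  A subobject is isomorphic to some defect, whose values are quotients of \<open>Hom C X Y\<close>. By
  Yoneda's argument it is generated by the element that corresponds to the class of the
  identity of \<open>Y\<close>.
\<close>

lemma eff_subobject_is_cyclic:
  assumes c: "(A, i, B, g, D) \<in> E" and U: "eff_subobject C E (defect C (A, i, B, g, D)) U"
  obtains Y f where "f \<in> Hom C Y D" "U = cyclic g B Y f"
proof -
  let ?M = "defect C (A, i, B, g, D)"
  have g: "g \<in> Hom C B D" using conflationD[OF c] by blast
  obtain \<delta> where "\<delta> \<in> E" "module_isomorphic C (restrict_module ?M U) (defect C \<delta>)"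
    using U unfolding eff_subobject_def eff_def by blast
  moreover obtain A' i' B' p' Y where "\<delta> = (A', i', B', p', Y)" by (cases \<delta>) blast
  ultimately have c': "(A', i', B', p', Y) \<in> E"
    and iso: "module_isomorphic C (restrict_module ?M U) (defect C (A', i', B', p', Y))" by blast+
  let ?N = "defect C (A', i', B', p', Y)"
  have p'H: "p' \<in> Hom C B' Y" using conflationD[OF c'] by blast
  have car: "carrier (fob (restrict_module ?M U) X) = U X" 
    and fm: "fmor (restrict_module ?M U) = fmor ?M" for X
    unfolding restrict_module_def by (simp_all del: defect.simps)
  obtain \<eta> where iso_eta: "\<And>X. \<eta> X \<in> iso (fob (restrict_module ?M U) X) (fob ?N X)"
    and nat: "\<And>X Z v a. v \<in> Hom C X Z \<Longrightarrow> a \<in> U Z \<Longrightarrow> \<eta> X (fmor ?M X Z v a) = fmor ?N X Z v (\<eta> Z a)"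
    using iso unfolding module_isomorphic_def fm car by blast
  have bij: "bij_betw (\<eta> X) (U X) (coset p' B' X ` Hom C X Y)" for X
    using iso_eta[of X] unfolding iso_def car carrier_defect[OF p'H] by blast
  have cl: "fmor ?M X Z v a \<in> U X" if "v \<in> Hom C X Z" "a \<in> U Z" for X Z v a
    using U that unfolding eff_subobject_def by blast
  have "subgroup (U Y) (fob ?M Y)" using U unfolding eff_subobject_def by blast
  from subgroup.subset[OF this] have UM: "U Y \<subseteq> coset g B Y ` Hom C Y D"
    unfolding carrier_defect[OF g] .
  have "coset p' B' Y (ide C Y) \<in> coset p' B' Y ` Hom C Y Y" using ide_Hom by blast
  then obtain e where e: "e \<in> U Y" "\<eta> Y e = coset p' B' Y (ide C Y)"
    using bij[of Y] unfolding bij_betw_def by (metis imageE)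
  obtain f where f: "f \<in> Hom C Y D" "e = coset g B Y f" using e UM by blast
  have key: "coset g B X (f \<cdot> u) \<in> U X" "\<eta> X (coset g B X (f \<cdot> u)) = coset p' B' X u"
    if u: "u \<in> Hom C X Y" for X u
  proof -
    have fe: "fmor ?M X Y u e = coset g B X (f \<cdot> u)" unfolding f(2) by (rule fmor_defect[OF g f(1) u])
    show "coset g B X (f \<cdot> u) \<in> U X" using cl[OF u e(1)] unfolding fe .
    have "\<eta> X (coset g B X (f \<cdot> u)) = fmor ?N X Y u (coset p' B' Y (ide C Y))"
      using nat[OF u e(1)] unfolding fe e(2) .
    also have "\<dots> = coset p' B' X u"
      unfolding fmor_defect[OF p'H ide_Hom u] cmp_ide_left[OF u] ..
    finally show "\<eta> X (coset g B X (f \<cdot> u)) = coset p' B' X u" .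
  qed
  have "U = cyclic g B Y f"
  proof
    fix X
    show "U X = cyclic g B Y f X"
    proof (intro equalityI subsetI)
      fix a assume a: "a \<in> U X"
      then have "\<eta> X a \<in> coset p' B' X ` Hom C X Y" using bij[of X] unfolding bij_betw_def by blast
      then obtain u where u: "u \<in> Hom C X Y" "\<eta> X a = coset p' B' X u" by blast
      have "a = coset g B X (f \<cdot> u)"
        using bij[of X] a key[OF u(1)] u(2) unfolding bij_betw_def inj_on_def by metis
      then show "a \<in> cyclic g B Y f X" using u unfolding cyclic_def by blast
    qed (use key in \<open>auto simp: cyclic_def\<close>)
  qed
  then show ?thesis using that f by blast
qed

text \<open>
  Successive quotients of a composition series in \<open>eff E\<close> are simple as functors. Indeed, if \<open>U\<close> is a
  step of the series, generated by \<open>f\<close>, and \<open>x\<close> lies in the next step but not in \<open>U\<close>, then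
  \<open>U\<close> and \<open>x\<close> together generate a subfunctor that is again generated by a single element, namely
  by the morphism with components \<open>f\<close> and \<open>x\<close> on a direct sum. So it lies in \<open>eff E\<close> and must
  be the whole next step. The conclusion describes the series by its preimages \<open>F j X\<close> in
  \<open>Hom C X D\<close>.
\<close>

lemma finite_length_chain:
  assumes c: "(A, i, B, g, D) \<in> E" and adm: "admissible C E"
  obtains n :: nat and F :: "nat \<Rightarrow> 'o \<Rightarrow> 'm set"
  where "\<And>X. F 0 X = img g B X" and "\<And>X. F n X = Hom C X D"
    and "\<And>j X Y x y. \<lbrakk>j < n; x \<in> F (Suc j) X; x \<notin> F j X; y \<in> F (Suc j) Y\<rbrakk>
      \<Longrightarrow> \<exists>\<phi>\<in>Hom C Y X. y - x \<cdot> \<phi> \<in> F j Y"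
proof -
  let ?M = "defect C (A, i, B, g, D)"
  have g: "g \<in> Hom C B D" using conflationD[OF c] by blast
  have "module_isomorphic C ?M ?M"
    unfolding module_isomorphic_def
    by (intro exI[of _ "\<lambda>X x. x"]) (auto simp del: defect.simps simp: iso_def hom_def bij_betw_def)
  then have "?M \<in> eff C E" unfolding eff_def using right_module_defect[OF g] c by blast
  then have "finite_length_in_eff C E ?M" using adm unfolding admissible_def by blast
  then obtain n U where U0: "U 0 = (\<lambda>X. {\<one>\<^bsub>fob ?M X\<^esub>})" and Un: "U n = (\<lambda>X. carrier (fob ?M X))"
    and Usub: "\<And>j. j \<le> n \<Longrightarrow> eff_subobject C E ?M (U j)"
    and Uless: "\<And>j. j < n \<Longrightarrow> U j < U (Suc j)"
    and Usimple: "\<And>j V. \<lbrakk>j < n; eff_subobject C E ?M V; U j < V; V < U (Suc j)\<rbrakk> \<Longrightarrow> False"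
    unfolding finite_length_in_eff_def by blast
  define F where "F j X = {f \<in> Hom C X D. coset g B X f \<in> U j X}" for j X
  have F0: "F 0 X = img g B X" for X
    unfolding F_def U0 one_defect[OF g] using img_closed(1)[OF g] by (auto simp: coset_eq_iff[OF g])
  have Fn: "F n X = Hom C X D" for X
    unfolding F_def Un carrier_defect[OF g] by blast
  have "\<exists>\<phi>\<in>Hom C Y X. y - x \<cdot> \<phi> \<in> F j Y"
    if j: "j < n" and x: "x \<in> F (Suc j) X" "x \<notin> F j X" and y: "y \<in> F (Suc j) Y" for j X Y x y
  proof -
    have xH: "x \<in> Hom C X D" and yH: "y \<in> Hom C Y D" using x y unfolding F_def by auto
    obtain Z f where f: "f \<in> Hom C Z D" and Uj: "U j = cyclic g B Z f"
      by (rule eff_subobject_is_cyclic[OF c Usub[of j]]) (use j in auto)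
    obtain Z' f' where f': "f' \<in> Hom C Z' D" and USj: "U (Suc j) = cyclic g B Z' f'"
      by (rule eff_subobject_is_cyclic[OF c Usub[of "Suc j"]]) (use j in auto)
    obtain S i1 i2 p1 p2 where S: "i1 \<in> Hom C Z S" "i2 \<in> Hom C X S" "p1 \<in> Hom C S Z" "p2 \<in> Hom C S X"
      "p1 \<cdot> i1 = ide C Z" "p2 \<cdot> i2 = ide C X" "p2 \<cdot> i1 = 0" "p1 \<cdot> i2 = 0"
      using direct_sum_exists[of Z X] unfolding direct_sum_def by blast
    define h where "h = f \<cdot> p1 + x \<cdot> p2"
    have h: "h \<in> Hom C S D" unfolding h_def by (intro Hom_add cmp_Hom[OF S(3) f] cmp_Hom[OF S(4) xH])
    have h_cmp: "h \<cdot> u = f \<cdot> (p1 \<cdot> u) + x \<cdot> (p2 \<cdot> u)" if "u \<in> Hom C W S" for W u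
      unfolding h_def cmp_add_left[OF that cmp_Hom[OF S(3) f] cmp_Hom[OF S(4) xH]]
        cmp_assoc[OF that S(3) f] cmp_assoc[OF that S(4) xH] ..
    have hi1: "h \<cdot> i1 = f" using h_cmp[OF S(1)] S f xH by (simp add: cmp_ide_right)
    have hi2: "h \<cdot> i2 = x" using h_cmp[OF S(2)] S f xH by (simp add: cmp_ide_right)
    let ?V = "cyclic g B S h"
    have V: "eff_subobject C E ?M ?V" by (rule eff_subobject_cyclic[OF c h])
    have "U j W \<subseteq> ?V W" for W
    proof
      fix a assume "a \<in> U j W"
      then obtain u where u: "u \<in> Hom C W Z" "a = coset g B W (f \<cdot> u)" unfolding Uj cyclic_def by blast
      show "a \<in> ?V W" unfolding cyclic_def u(2)
        by (rule image_eqI[OF _ cmp_Hom[OF u(1) S(1)]]) (simp add: cmp_reassoc[OF hi1 u(1) S(1) h])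
    qed
    then have le: "U j \<le> ?V" by (simp add: le_fun_def)
    have xV: "coset g B X x \<in> ?V X" unfolding cyclic_def using hi2 S(2) by blast
    have xU: "coset g B X x \<notin> U j X" using x xH unfolding F_def by blast
    have "U j \<noteq> ?V" using xV xU by metis
    with le have lt: "U j < ?V" by simp
    have "?V W \<subseteq> U (Suc j) W" for W
    proof
      fix a assume "a \<in> ?V W"
      then obtain u where u: "u \<in> Hom C W S" "a = coset g B W (h \<cdot> u)" unfolding cyclic_def by blast
      have 1: "coset g B W (f \<cdot> (p1 \<cdot> u)) \<in> U (Suc j) W"
      proof -
        have "cyclic g B Z f W \<subseteq> U (Suc j) W"
          using Uless[OF j] unfolding Uj by (metis le_funD order_less_imp_le)
        then show ?thesis using cmp_Hom[OF u(1) S(3)] unfolding cyclic_def by blast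
      qed
      have "coset g B X x \<in> U (Suc j) X" using x unfolding F_def by blast
      then have "fmor ?M W X (p2 \<cdot> u) (coset g B X x) \<in> U (Suc j) W"
      proof -
        have "fmor ?M W X (p2 \<cdot> u) ` U (Suc j) X \<subseteq> U (Suc j) W"
          using Usub[OF Suc_leI[OF j]] cmp_Hom[OF u(1) S(4)] unfolding eff_subobject_def by blast
        then show ?thesis using \<open>coset g B X x \<in> U (Suc j) X\<close> by blast
      qed
      then have 2: "coset g B W (x \<cdot> (p2 \<cdot> u)) \<in> U (Suc j) W"
        unfolding fmor_defect[OF g xH cmp_Hom[OF u(1) S(4)]] .
      have "subgroup (U (Suc j) W) (fob ?M W)" using Usub[of "Suc j"] j unfolding eff_subobject_def by auto
      from subgroup.m_closed[OF this 1 2]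
      show "a \<in> U (Suc j) W"
        unfolding mult_defect[OF g cmp_Hom[OF cmp_Hom[OF u(1) S(3)] f] cmp_Hom[OF cmp_Hom[OF u(1) S(4)] xH]]
          u(2) h_cmp[OF u(1)] .
    qed
    then have "?V \<le> U (Suc j)" by (simp add: le_fun_def)
    then have VU: "?V = U (Suc j)" using Usimple[OF j V lt] by (metis order_le_less)
    have "coset g B Y y \<in> ?V Y" unfolding VU using y unfolding F_def by blast
    then obtain u where u: "u \<in> Hom C Y S" "coset g B Y y = coset g B Y (h \<cdot> u)" unfolding cyclic_def by blast
    have "y - x \<cdot> (p2 \<cdot> u) \<in> Hom C Y D" by (rule Hom_diff[OF yH cmp_Hom[OF cmp_Hom[OF u(1) S(4)] xH]])
    moreover have "coset g B Y (y - x \<cdot> (p2 \<cdot> u)) = coset g B Y (f \<cdot> (p1 \<cdot> u))"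
      using u(2) h_cmp[OF u(1)] unfolding coset_eq_iff[OF g] by (simp add: algebra_simps)
    moreover have "coset g B Y (f \<cdot> (p1 \<cdot> u)) \<in> U j Y"
      unfolding Uj cyclic_def using cmp_Hom[OF u(1) S(3)] by blast
    ultimately have "y - x \<cdot> (p2 \<cdot> u) \<in> F j Y" unfolding F_def by simp
    then show ?thesis using cmp_Hom[OF u(1) S(4)] by blast
  qed
  with F0 Fn show ?thesis by (rule that)
qed

end

section \<open>Vector spaces over finite fields\<close>

lemma finite_span_finite_field:
  fixes scale :: "'k::{field, finite} \<Rightarrow> 'm::ab_group_add \<Rightarrow> 'm"
  assumes "vector_space scale" and "finite B"
  shows "finite (module.span scale B)"
    and "\<not> module.dependent scale B \<Longrightarrow> card (module.span scale B) = card (UNIV :: 'k set) ^ card B"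
proof -
  interpret vector_space scale by fact
  have ins: "span (insert b B) = (\<lambda>(k, y). y + scale k b) ` (UNIV \<times> span B)" for b B
  proof (intro equalityI subsetI)
    fix x assume "x \<in> span (insert b B)"
    then obtain k where "x - scale k b \<in> span B" unfolding span_insert by blast
    then show "x \<in> (\<lambda>(k, y). y + scale k b) ` (UNIV \<times> span B)"
      by (intro image_eqI[of _ _ "(k, x - scale k b)"]) auto
  next
    fix x assume "x \<in> (\<lambda>(k, y). y + scale k b) ` (UNIV \<times> span B)"
    then obtain k y where "y \<in> span B" "x = y + scale k b" by auto
    then have "x - scale k b \<in> span B" by simp
    then show "x \<in> span (insert b B)" unfolding span_insert by blast
  qed
  show "finite (span B)" using assms(2) by (induction B rule: finite_induct) (auto simp: ins)
  show "card (span B) = card (UNIV :: 'k set) ^ card B" if "independent B"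
    using assms(2) that
  proof (induction B rule: finite_induct)
    case (insert b B)
    then have b: "b \<notin> span B" and "independent B" by (auto simp: independent_insert)
    have "inj_on (\<lambda>(k, y). y + scale k b) (UNIV \<times> span B)"
    proof (rule inj_onI, clarify)
      fix k y k' y' assume y: "y \<in> span B" "y' \<in> span B" and eq: "y + scale k b = y' + scale k' b"
      have "scale (k' - k) b = y - y'" using eq by (simp add: scale_left_diff_distrib algebra_simps)
      then have "scale (k' - k) b \<in> span B" using y span_diff by metis
      then have "k' - k = 0" using b span_scale[of "scale (k' - k) b" B "inverse (k' - k)"]
        by (cases "k' - k = 0") (simp_all del: right_minus_eq)
      then show "k = k' \<and> y = y'" using eq by simp
    qed
    then have "card (span (insert b B)) = card (UNIV :: 'k set) * card (span B)"
      unfolding ins by (simp add: card_image card_cartesian_product)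
    then show ?case using insert \<open>independent B\<close> by simp
  qed simp
qed

lemma card_subspace_finite_field:
  fixes scale :: "'k::{field, finite} \<Rightarrow> 'm::ab_group_add \<Rightarrow> 'm"
  assumes "vector_space scale" and "module.subspace scale V" and "finite V"
  shows "card V = card (UNIV :: 'k set) ^ vector_space.dim scale V"
proof -
  interpret vector_space scale by fact
  obtain B where B: "B \<subseteq> V" "independent B" "V \<subseteq> span B" "card B = dim V" by (rule basis_exists)
  have "span B = V" using B assms(2) span_minimal by blast
  then show ?thesis
    using finite_span_finite_field(2)[OF assms(1) finite_subset[OF B(1) assms(3)] B(2)] B(4) by simp
qed

lemma finite_Hom_hom_finite:
  fixes C :: "('o, 'm::ab_group_add, 'k::{field, finite}) lincat"
  assumes "linear_category C" "hom_finite C"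
  shows "finite (Hom C X Y)"
proof -
  obtain B where "finite B" "Hom C X Y = module.span (lincat.scale C) B"
    using assms(2) unfolding hom_finite_def by blast
  then show ?thesis
    using finite_span_finite_field(1)[OF linear_category.vector_space[OF assms(1)]] by metis
qed

section \<open>Powers of endomorphisms\<close>

context linear_category
begin

definition endo_pow :: "'o \<Rightarrow> 'm \<Rightarrow> nat \<Rightarrow> 'm"
  where "endo_pow X e n = ((\<lambda>t. e \<cdot> t) ^^ n) (ide C X)"

lemma endo_pow_simps [simp]: "endo_pow X e 0 = ide C X" "endo_pow X e (Suc n) = e \<cdot> endo_pow X e n"
  unfolding endo_pow_def by simp_all

lemma endo_pow_Hom: "e \<in> Hom C X X \<Longrightarrow> endo_pow X e n \<in> Hom C X X"
  by (induction n) (auto intro: cmp_Hom)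

lemma endo_pow_add: "e \<in> Hom C X X \<Longrightarrow> endo_pow X e (m + n) = endo_pow X e m \<cdot> endo_pow X e n"
proof (induction m)
  case 0
  then show ?case using cmp_ide_left[OF endo_pow_Hom[OF 0]] by simp
next
  case (Suc m)
  then show ?case using cmp_assoc[OF endo_pow_Hom[OF Suc(2)] endo_pow_Hom[OF Suc(2)] Suc(2)] by simp
qed

text \<open>
  The powers of an element of a finite monoid are eventually periodic; an exponent that is a multiple
  of the period and past the preperiod gives an idempotent.
\<close>

lemma idempotent_power:
  assumes e: "e \<in> Hom C X X" and fin: "finite (Hom C X X)"
  obtains n where "endo_pow X e (Suc n) \<cdot> endo_pow X e (Suc n) = endo_pow X e (Suc n)"
proof -
  have "\<not> inj (endo_pow X e)"
    using finite_subset[OF _ fin, of "range (endo_pow X e)"] endo_pow_Hom[OF e] finite_imageD by blast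
  then obtain i j where "i < j" "endo_pow X e i = endo_pow X e j" unfolding inj_def by (metis nat_neq_iff)
  then obtain p where p: "0 < p" "endo_pow X e i = endo_pow X e (i + p)" by (metis less_imp_add_positive)
  have per: "endo_pow X e (i + k) = endo_pow X e (i + k + p)" for k
    using p(2) endo_pow_add[OF e, of i k] endo_pow_add[OF e, of "i + p" k] by (simp add: add_ac)
  have per': "endo_pow X e (i + k) = endo_pow X e (i + k + q * p)" for k q
  proof (induction q)
    case (Suc q)
    then show ?case using per[of "k + q * p"] by (simp add: add_ac)
  qed simp
  define n where "n = Suc i * p"
  have "Suc i * 1 \<le> n" unfolding n_def using p by (intro mult_le_mono2) simp
  then have "i \<le> n" "0 < n" by auto
  then have "endo_pow X e n = endo_pow X e (n + n)"
    using per'[of "n - i" "Suc i"] unfolding n_def[symmetric] by simp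
  then have "endo_pow X e n \<cdot> endo_pow X e n = endo_pow X e n" using endo_pow_add[OF e] by simp
  then show ?thesis using that[of "n - 1"] \<open>0 < n\<close> by simp
qed

end

section \<open>Comparing two exact structures\<close>

locale finite_exact_pair =
  additive_category C + E: exact_category C E + E': exact_category C E'
  for C :: "('o, 'm::ab_group_add, 'k::{field, finite}) lincat"
    and E E' :: "('o, 'm) pair_of_maps set" +
  assumes hom_finite: "hom_finite C" and idempotent_complete: "idempotent_complete C"
    and E'_subset: "E' \<subseteq> E" and admissible: "admissible C E"
begin

lemma finite_Hom [simp]: "finite (Hom C X Y)"
  by (rule finite_Hom_hom_finite[OF linear_category_axioms hom_finite])

text \<open>
  Morphisms \<open>f\<close> that factor through \<open>g : B \<rightarrow> D\<close> after composition with a deflation of \<open>E'\<close>. The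
  pullback of a conflation along \<open>f\<close> lies in \<open>E'\<close> exactly for these \<open>f\<close>; this form
  avoids constructing the pullback.
\<close>

definition lifts_locally :: "'m \<Rightarrow> 'o \<Rightarrow> 'o \<Rightarrow> 'm set"
  where "lifts_locally g B X = {f. \<exists>Y h. deflation E' Y X h \<and> f \<cdot> h \<in> img g B Y}"

context
  fixes A :: 'o and i :: 'm and B :: 'o and g :: 'm and D :: 'o
  assumes c: "(A, i, B, g, D) \<in> E"
begin

lemma gH: "g \<in> Hom C B D"
  using E.conflationD[OF c] by blast

lemma lifts_locallyI: "deflation E' Y X h \<Longrightarrow> f \<cdot> h \<in> img g B Y \<Longrightarrow> f \<in> lifts_locally g B X"
  unfolding lifts_locally_def by blast

lemma lifts_locally_img:
  assumes "f \<in> img g B X"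
  shows "f \<in> lifts_locally g B X"
proof (rule lifts_locallyI[OF E'.deflation_ide])
  have "f \<in> Hom C X D" using assms img_closed(1)[OF gH] by blast
  then show "f \<cdot> ide C X \<in> img g B X" using assms by (simp add: cmp_ide_right)
qed

lemma lifts_locally_cmp:
  assumes f: "f \<in> Hom C X D" "f \<in> lifts_locally g B X" and u: "u \<in> Hom C Z X"
  shows "f \<cdot> u \<in> lifts_locally g B Z"
proof -
  obtain Y h where h: "deflation E' Y X h" "f \<cdot> h \<in> img g B Y" using f unfolding lifts_locally_def by blast
  obtain P p' f' where pb: "pullback C Y X h Z u P p' f'" and p': "deflation E' P Z p'"
    using E'.deflation_pullback[OF h(1) u] by blast
  have H: "h \<in> Hom C Y X" "p' \<in> Hom C P Z" "f' \<in> Hom C P Y" "h \<cdot> f' = u \<cdot> p'"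
    using pb unfolding pullback_def by auto
  have "(f \<cdot> u) \<cdot> p' = (f \<cdot> h) \<cdot> f'"
    using cmp_assoc[OF H(2) u f(1)] cmp_assoc[OF H(3,1) f(1)] H(4) by simp
  then have "(f \<cdot> u) \<cdot> p' \<in> img g B P" using img_closed(6)[OF gH h(2) H(3)] by simp
  then show ?thesis by (rule lifts_locallyI[OF p'])
qed

lemma lifts_locally_local:
  assumes f: "f \<in> Hom C X D" and h: "deflation E' Y X h" and "f \<cdot> h \<in> lifts_locally g B Y"
  shows "f \<in> lifts_locally g B X"
proof -
  obtain Z k where k: "deflation E' Z Y k" "(f \<cdot> h) \<cdot> k \<in> img g B Z" using assms(3) unfolding lifts_locally_def by blast
  have "(f \<cdot> h) \<cdot> k = f \<cdot> (h \<cdot> k)" by (rule cmp_assoc[OF E'.deflation_Hom[OF k(1)] E'.deflation_Hom[OF h] f])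
  then have "f \<cdot> (h \<cdot> k) \<in> img g B Z" using k(2) by simp
  then show ?thesis by (rule lifts_locallyI[OF E'.deflation_cmp[OF k(1) h]])
qed

lemma lifts_locally_add:
  assumes f: "f \<in> Hom C X D" "f \<in> lifts_locally g B X" and f': "f' \<in> Hom C X D" "f' \<in> lifts_locally g B X"
  shows "f + f' \<in> lifts_locally g B X"
proof -
  obtain Y h where h: "deflation E' Y X h" "f \<cdot> h \<in> img g B Y" using f unfolding lifts_locally_def by blast
  have hH: "h \<in> Hom C Y X" by (rule E'.deflation_Hom[OF h(1)])
  have "f' \<cdot> h \<in> lifts_locally g B Y" by (rule lifts_locally_cmp[OF f' hH])
  then obtain Z k where k: "deflation E' Z Y k" "(f' \<cdot> h) \<cdot> k \<in> img g B Z" unfolding lifts_locally_def by blast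
  have kH: "k \<in> Hom C Z Y" by (rule E'.deflation_Hom[OF k(1)])
  have "((f + f') \<cdot> h) \<cdot> k = (f \<cdot> h) \<cdot> k + (f' \<cdot> h) \<cdot> k"
    unfolding cmp_add_left[OF hH f(1) f'(1)]
    by (rule cmp_add_left[OF kH cmp_Hom[OF hH f(1)] cmp_Hom[OF hH f'(1)]])
  then have "((f + f') \<cdot> h) \<cdot> k \<in> img g B Z"
    using img_closed(3)[OF gH img_closed(6)[OF gH h(2) kH] k(2)] by simp
  then have "(f + f') \<cdot> h \<in> lifts_locally g B Y" by (rule lifts_locallyI[OF k(1)])
  then show ?thesis by (rule lifts_locally_local[OF Hom_add[OF f(1) f'(1)] h(1)])
qed

lemma lifts_locally_ide:
  assumes "ide C D \<in> lifts_locally g B D"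
  shows "(A, i, B, g, D) \<in> E'"
proof -
  obtain Y h where h: "deflation E' Y D h" "ide C D \<cdot> h \<in> img g B Y" using assms unfolding lifts_locally_def by blast
  have "ide C D \<cdot> h = h" by (rule cmp_ide_left[OF E'.deflation_Hom[OF h(1)]])
  then obtain b where b: "b \<in> Hom C Y B" "h = g \<cdot> b" using imgE[OF h(2)] by metis
  show ?thesis
    by (rule E'.obscure_axiom[OF E.conflationD(4,5)[OF c] b(1)]) (use h b in simp)
qed

text \<open>
  The number \<open>J X f\<close> is the length of the subfunctor generated by \<open>f\<close>: it counts the steps of the
  composition series into which this subfunctor intrudes. If \<open>f u\<close> has the same length as
  \<open>f\<close>, then it intrudes into the same steps. As these are simple, descending along the series one
  can correct any \<open>f t\<close> by multiples of \<open>f u\<close> until it vanishes in the defect.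
\<close>

lemma finite_length_measure:
  obtains J :: "'o \<Rightarrow> 'm \<Rightarrow> nat"
  where "\<And>X Z f u. \<lbrakk>f \<in> Hom C X D; u \<in> Hom C Z X\<rbrakk> \<Longrightarrow> J Z (f \<cdot> u) \<le> J X f"
    and "\<And>X Z f u. \<lbrakk>f \<in> Hom C X D; u \<in> Hom C Z X; J Z (f \<cdot> u) = J X f\<rbrakk>
      \<Longrightarrow> \<exists>v\<in>Hom C X Z. f - f \<cdot> (u \<cdot> v) \<in> img g B X"
proof -
  obtain n :: nat and F :: "nat \<Rightarrow> 'o \<Rightarrow> 'm set"
    where F0: "\<And>X. F 0 X = img g B X" and Fn: "\<And>X. F n X = Hom C X D"
    and step: "\<And>j X Y x y. \<lbrakk>j < n; x \<in> F (Suc j) X; x \<notin> F j X; y \<in> F (Suc j) Y\<rbrakk>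
      \<Longrightarrow> \<exists>\<phi>\<in>Hom C Y X. y - x \<cdot> \<phi> \<in> F j Y"
    by (rule E.finite_length_chain[OF c admissible]) blast
  define J where "J X f = {j. j < n \<and> (\<exists>Y. \<exists>u\<in>Hom C Y X. f \<cdot> u \<in> F (Suc j) Y \<and> f \<cdot> u \<notin> F j Y)}" for X f
  have fin: "finite (J X f)" for X f unfolding J_def by simp
  have sub: "J Z (f \<cdot> u) \<subseteq> J X f" if f: "f \<in> Hom C X D" and u: "u \<in> Hom C Z X" for X Z f u
  proof
    fix j assume "j \<in> J Z (f \<cdot> u)"
    then obtain Y v where v: "j < n" "v \<in> Hom C Y Z" "(f \<cdot> u) \<cdot> v \<in> F (Suc j) Y" "(f \<cdot> u) \<cdot> v \<notin> F j Y"
      unfolding J_def by blast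
    then show "j \<in> J X f" unfolding J_def using cmp_assoc[OF v(2) u f] cmp_Hom[OF v(2) u] by auto
  qed
  have "\<exists>v\<in>Hom C X Z. f - f \<cdot> (u \<cdot> v) \<in> img g B X"
    if f: "f \<in> Hom C X D" and u: "u \<in> Hom C Z X" and eq: "J Z (f \<cdot> u) = J X f" for X Z f u
  proof -
    have fuv: "f \<cdot> (u \<cdot> v) \<in> Hom C Y D" if "v \<in> Hom C Y Z" for Y v
      by (rule cmp_Hom[OF cmp_Hom[OF that u] f])
    have "\<exists>v\<in>Hom C Y Z. f \<cdot> t - f \<cdot> (u \<cdot> v) \<in> img g B Y"
      if "j \<le> n" "t \<in> Hom C Y X" "f \<cdot> t \<in> F j Y" for j Y t
      using that
    proof (induction j arbitrary: t)
      case 0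
      then show ?case
        using F0 u f by (intro bexI[of _ 0]) auto
    next
      case (Suc j)
      show ?case
      proof (cases "f \<cdot> t \<in> F j Y")
        case True
        then show ?thesis using Suc by simp
      next
        case False
        then have "j \<in> J X f" unfolding J_def using Suc by auto
        then have "j \<in> J Z (f \<cdot> u)" unfolding eq .
        then obtain W s where s: "s \<in> Hom C W Z" "(f \<cdot> u) \<cdot> s \<in> F (Suc j) W" "(f \<cdot> u) \<cdot> s \<notin> F j W"
          unfolding J_def by blast
        obtain \<phi> where \<phi>: "\<phi> \<in> Hom C Y W" "f \<cdot> t - ((f \<cdot> u) \<cdot> s) \<cdot> \<phi> \<in> F j Y"
          using step[OF _ s(2,3) Suc.prems(3)] Suc.prems(1) by auto
        have s\<phi>: "s \<cdot> \<phi> \<in> Hom C Y Z" by (rule cmp_Hom[OF \<phi>(1) s(1)])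
        have us\<phi>: "u \<cdot> (s \<cdot> \<phi>) \<in> Hom C Y X" by (rule cmp_Hom[OF s\<phi> u])
        have "((f \<cdot> u) \<cdot> s) \<cdot> \<phi> = f \<cdot> (u \<cdot> (s \<cdot> \<phi>))"
          using cmp_assoc[OF \<phi>(1) s(1) cmp_Hom[OF u f]] cmp_assoc[OF s\<phi> u f] by simp
        then have "f \<cdot> (t - u \<cdot> (s \<cdot> \<phi>)) \<in> F j Y"
          using \<phi>(2) cmp_diff_right[OF Suc.prems(2) us\<phi> f] by simp
        then obtain v where v: "v \<in> Hom C Y Z" "f \<cdot> (t - u \<cdot> (s \<cdot> \<phi>)) - f \<cdot> (u \<cdot> v) \<in> img g B Y"
          using Suc.IH[OF _ Hom_diff[OF Suc.prems(2) us\<phi>]] Suc.prems(1) by auto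
        have "f \<cdot> (u \<cdot> (s \<cdot> \<phi> + v)) = f \<cdot> (u \<cdot> (s \<cdot> \<phi>)) + f \<cdot> (u \<cdot> v)"
          unfolding cmp_add_right[OF s\<phi> v(1) u] by (rule cmp_add_right[OF us\<phi> cmp_Hom[OF v(1) u] f])
        then have "f \<cdot> t - f \<cdot> (u \<cdot> (s \<cdot> \<phi> + v)) = f \<cdot> (t - u \<cdot> (s \<cdot> \<phi>)) - f \<cdot> (u \<cdot> v)"
          using cmp_diff_right[OF Suc.prems(2) us\<phi> f] by (simp add: algebra_simps)
        then show ?thesis using v Hom_add[OF s\<phi> v(1)] by metis
      qed
    qed
    from this[of n "ide C X" X] show ?thesis using f Fn by (simp add: cmp_ide_right)
  qed
  moreover have "J Z (f \<cdot> u) = J X f"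
    if "f \<in> Hom C X D" "u \<in> Hom C Z X" "card (J Z (f \<cdot> u)) = card (J X f)" for X Z f u
    using card_subset_eq[OF fin sub[OF that(1,2)] that(3)] .
  ultimately show ?thesis
    using that[of "\<lambda>X f. card (J X f)"] card_mono[OF fin sub] by blast
qed

text \<open>
  If \<open>e\<close> splits as \<open>s r\<close>, then \<open>t \<mapsto> s t r\<close> embeds the endomorphisms of the summand into those of
  \<open>X\<close>, and the identity of \<open>X\<close> is not in its image.
\<close>

lemma split_idempotent_smaller:
  assumes e: "e \<in> Hom C X X" "e \<cdot> e = e" "e \<noteq> ide C X"
  obtains Y s r where "s \<in> Hom C Y X" "r \<in> Hom C X Y" "s \<cdot> r = e" "card (Hom C Y Y) < card (Hom C X X)"
proof -
  obtain Y r s where rs: "r \<in> Hom C X Y" "s \<in> Hom C Y X" "s \<cdot> r = e" "r \<cdot> s = ide C Y"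
    using idempotent_complete e unfolding idempotent_complete_def by blast
  have sr_mem: "s \<cdot> (t \<cdot> r) \<in> Hom C X X" if "t \<in> Hom C Y Y" for t
    by (rule cmp_Hom[OF cmp_Hom[OF rs(1) that] rs(2)])
  have retract: "(r \<cdot> (s \<cdot> (t \<cdot> r))) \<cdot> s = t" if t: "t \<in> Hom C Y Y" for t
  proof -
    have "r \<cdot> (s \<cdot> (t \<cdot> r)) = t \<cdot> r"
      using cmp_reassoc[OF rs(4) cmp_Hom[OF rs(1) t] rs(2) rs(1)] cmp_ide_left[OF cmp_Hom[OF rs(1) t]] by simp
    then show ?thesis using cmp_assoc[OF rs(2,1) t] rs(4) cmp_ide_right[OF t] by simp
  qed
  have inj: "inj_on (\<lambda>t. s \<cdot> (t \<cdot> r)) (Hom C Y Y)"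
    by (rule inj_on_inverseI[where g = "\<lambda>x. (r \<cdot> x) \<cdot> s"]) (rule retract)
  have "ide C X \<notin> (\<lambda>t. s \<cdot> (t \<cdot> r)) ` Hom C Y Y"
  proof
    assume "ide C X \<in> (\<lambda>t. s \<cdot> (t \<cdot> r)) ` Hom C Y Y"
    then obtain t where t: "t \<in> Hom C Y Y" "ide C X = s \<cdot> (t \<cdot> r)" by blast
    have "r \<cdot> (s \<cdot> (t \<cdot> r)) = t \<cdot> r"
      using cmp_reassoc[OF rs(4) cmp_Hom[OF rs(1) t(1)] rs(2) rs(1)] cmp_ide_left[OF cmp_Hom[OF rs(1) t(1)]] by simp
    then have "e \<cdot> (s \<cdot> (t \<cdot> r)) = s \<cdot> (t \<cdot> r)"
      using cmp_assoc[OF sr_mem[OF t(1)] rs(1,2)] rs(3) by simp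
    then have "e = ide C X" using cmp_ide_right[OF e(1)] unfolding t(2)[symmetric] by simp
    then show False using e by blast
  qed
  then have "(\<lambda>t. s \<cdot> (t \<cdot> r)) ` Hom C Y Y \<subset> Hom C X X" using sr_mem ide_Hom[of X] by blast
  then have "card (Hom C Y Y) < card (Hom C X X)"
    using psubset_card_mono[OF finite_Hom] card_image[OF inj] by metis
  then show ?thesis using that rs by blast
qed

text \<open>
  The minimal choice described at the beginning is made lexicographically, first by length and then by
  the number of endomorphisms. Precomposing \<open>f\<close> never increases the length, so a summand of
  \<open>X\<close> would give a smaller pair.
\<close>

theorem nonconflation_detected_by_projective:
  assumes "(A, i, B, g, D) \<notin> E'"
  obtains X f where "indecomposable C (projectives C E') X" "f \<in> Hom C X D" "f \<notin> img g B X"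
proof -
  obtain J :: "'o \<Rightarrow> 'm \<Rightarrow> nat"
    where J_le: "\<And>X Z f u. \<lbrakk>f \<in> Hom C X D; u \<in> Hom C Z X\<rbrakk> \<Longrightarrow> J Z (f \<cdot> u) \<le> J X f"
    and J_eq: "\<And>X Z f u. \<lbrakk>f \<in> Hom C X D; u \<in> Hom C Z X; J Z (f \<cdot> u) = J X f\<rbrakk>
      \<Longrightarrow> \<exists>v\<in>Hom C X Z. f - f \<cdot> (u \<cdot> v) \<in> img g B X"
    by (rule finite_length_measure) blast
  define bad where "bad = {(X, f). f \<in> Hom C X D \<and> f \<notin> lifts_locally g B X}"
  have "(D, ide C D) \<in> bad" using lifts_locally_ide assms unfolding bad_def by auto
  moreover have "wf (measures [\<lambda>(X, f). J X f, \<lambda>(X, f). card (Hom C X X)])" by simp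
  ultimately obtain Xf where Xf: "Xf \<in> bad"
    and min: "\<And>q. (q, Xf) \<in> measures [\<lambda>(X, f). J X f, \<lambda>(X, f). card (Hom C X X)] \<Longrightarrow> q \<notin> bad"
    by (meson wfE_min)
  obtain X f where XXf: "Xf = (X, f)" by (cases Xf)
  have f: "f \<in> Hom C X D" "f \<notin> lifts_locally g B X" using Xf unfolding XXf bad_def by auto
  have min1: "f \<cdot> u \<in> lifts_locally g B Z \<or> J Z (f \<cdot> u) = J X f" if u: "u \<in> Hom C Z X" for Z u
    using min[of "(Z, f \<cdot> u)"] J_le[OF f(1) u] cmp_Hom[OF u f(1)] unfolding XXf bad_def by auto
  have min2: "f \<cdot> u \<in> lifts_locally g B Z" if u: "u \<in> Hom C Z X" and "card (Hom C Z Z) < card (Hom C X X)" for Z u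
  proof -
    have "J Z (f \<cdot> u) < J X f \<or> J Z (f \<cdot> u) = J X f" using J_le[OF f(1) u] by linarith
    then show ?thesis
      using min[of "(Z, f \<cdot> u)"] cmp_Hom[OF u f(1)] that(2) unfolding XXf bad_def by auto
  qed
  have fg: "f \<notin> img g B X" using lifts_locally_img f by blast
  have idem_ldef: "f \<cdot> e \<in> lifts_locally g B X" if e: "e \<in> Hom C X X" "e \<cdot> e = e" "e \<noteq> ide C X" for e
  proof -
    obtain Y s r where rs: "s \<in> Hom C Y X" "r \<in> Hom C X Y" "s \<cdot> r = e" "card (Hom C Y Y) < card (Hom C X X)"
      by (rule split_idempotent_smaller[OF e])
    have "(f \<cdot> s) \<cdot> r \<in> lifts_locally g B X" by (rule lifts_locally_cmp[OF cmp_Hom[OF rs(1) f(1)] min2[OF rs(1,4)] rs(2)])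
    then show ?thesis using cmp_assoc[OF rs(2,1) f(1)] rs(3) by simp
  qed
  \<comment> \<open>Otherwise \<open>f\<close> is the sum of \<open>f e\<close> and \<open>f (1 - e)\<close>, both of which lift locally by the
    minimality of \<open>X\<close>.\<close>
  have idem: "e = 0 \<or> e = ide C X" if e: "e \<in> Hom C X X" "e \<cdot> e = e" for e
  proof (rule ccontr)
    assume ne: "\<not> (e = 0 \<or> e = ide C X)"
    let ?e' = "ide C X - e"
    have e': "?e' \<in> Hom C X X" by (rule Hom_diff[OF ide_Hom e(1)])
    have "?e' \<cdot> ?e' = ?e'"
      unfolding cmp_diff_left[OF e' ide_Hom e(1)] cmp_diff_right[OF ide_Hom e(1) e(1)] cmp_ide_left[OF e']
        cmp_ide_right[OF e(1)] e(2) by simp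
    moreover have "?e' \<noteq> ide C X" using ne by simp
    ultimately have "f \<cdot> ?e' \<in> lifts_locally g B X" using idem_ldef e' by blast
    moreover have "f \<cdot> e \<in> lifts_locally g B X" using idem_ldef e ne by blast
    ultimately have "f \<cdot> e + f \<cdot> ?e' \<in> lifts_locally g B X"
      using lifts_locally_add cmp_Hom[OF e(1) f(1)] cmp_Hom[OF e' f(1)] by blast
    moreover have "f \<cdot> e + f \<cdot> ?e' = f"
      unfolding cmp_diff_right[OF ide_Hom e(1) f(1)] cmp_ide_right[OF f(1)] by simp
    ultimately show False using f by simp
  qed
  \<comment> \<open>Fitting's argument for \<open>u v\<close>, where \<open>f\<close> and \<open>f u v\<close> agree modulo \<open>g\<close>.\<close>
  have split: "\<exists>t\<in>Hom C X Z. u \<cdot> t = ide C X" if u: "u \<in> Hom C Z X" and nu: "f \<cdot> u \<notin> lifts_locally g B Z" for Z u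
  proof -
    obtain v where v: "v \<in> Hom C X Z" "f - f \<cdot> (u \<cdot> v) \<in> img g B X"
      using J_eq[OF f(1) u] min1[OF u] nu by blast
    let ?e = "u \<cdot> v"
    have e: "?e \<in> Hom C X X" by (rule cmp_Hom[OF v(1) u])
    have pw: "f - f \<cdot> endo_pow X ?e n \<in> img g B X" for n
    proof (induction n)
      case 0
      then show ?case using f img_closed(2)[OF gH] by (simp add: cmp_ide_right)
    next
      case (Suc n)
      have p: "endo_pow X ?e n \<in> Hom C X X" by (rule endo_pow_Hom[OF e])
      have "(f - f \<cdot> ?e) \<cdot> endo_pow X ?e n = f \<cdot> endo_pow X ?e n - f \<cdot> endo_pow X ?e (Suc n)"
        using cmp_diff_left[OF p f(1) cmp_Hom[OF e f(1)]] cmp_assoc[OF p e f(1)] by simp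
      then have eq: "f - f \<cdot> endo_pow X ?e (Suc n) = (f - f \<cdot> endo_pow X ?e n) + (f - f \<cdot> ?e) \<cdot> endo_pow X ?e n"
        by (simp only: diff_add_cancel) (simp only: algebra_simps)
      show ?case unfolding eq by (rule img_closed(3)[OF gH Suc img_closed(6)[OF gH v(2) p]])
    qed
    obtain n where n: "endo_pow X ?e (Suc n) \<cdot> endo_pow X ?e (Suc n) = endo_pow X ?e (Suc n)"
      by (rule idempotent_power[OF e finite_Hom])
    have "endo_pow X ?e (Suc n) \<noteq> 0"
    proof
      assume "endo_pow X ?e (Suc n) = 0"
      then have "f \<in> img g B X" using pw[of "Suc n"] cmp_0_right[OF f(1)] by simp
      then show False using fg by blast
    qed
    then have "endo_pow X ?e (Suc n) = ide C X" using idem[OF endo_pow_Hom[OF e] n] by blast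
    then have "u \<cdot> (v \<cdot> endo_pow X ?e n) = ide C X" using cmp_assoc[OF endo_pow_Hom[OF e] v(1) u] by simp
    then show ?thesis using cmp_Hom[OF endo_pow_Hom[OF e] v(1)] by blast
  qed
  have "X \<in> projectives C E'"
  proof (rule E'.projectiveI)
    fix L l assume l: "deflation E' L X l"
    then have "f \<cdot> l \<notin> lifts_locally g B L" using lifts_locally_local[OF f(1) l] f(2) by blast
    then show "\<exists>s\<in>Hom C X L. l \<cdot> s = ide C X" using split[OF E'.deflation_Hom[OF l]] by blast
  qed
  moreover have "\<not> zero_object C X"
  proof
    assume "zero_object C X"
    then have "f = 0" using zero_object_Hom(2) f(1) by blast
    then show False using fg img_closed(2)[OF gH] by blast
  qed
  moreover have "zero_object C M \<or> zero_object C N" if sum: "direct_sum C M N X" for M N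
  proof -
    obtain i1 i2 p1 p2 where S: "i1 \<in> Hom C M X" "i2 \<in> Hom C N X" "p1 \<in> Hom C X M" "p2 \<in> Hom C X N"
      "p1 \<cdot> i1 = ide C M" "p2 \<cdot> i2 = ide C N" "p2 \<cdot> i1 = 0" "p1 \<cdot> i2 = 0"
      using sum unfolding direct_sum_def by blast
    have ip: "i1 \<cdot> p1 \<in> Hom C X X" by (rule cmp_Hom[OF S(3,1)])
    have i: "(i1 \<cdot> p1) \<cdot> i1 = i1" using cmp_assoc[OF S(1,3,1)] S(5) cmp_ide_right[OF S(1)] by simp
    then have "(i1 \<cdot> p1) \<cdot> (i1 \<cdot> p1) = i1 \<cdot> p1" using cmp_reassoc[OF i S(3) S(1) ip] by simp
    then consider "i1 \<cdot> p1 = 0" | "i1 \<cdot> p1 = ide C X" using idem[OF ip] by blast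
    then show ?thesis
    proof cases
      case 1
      then have "i1 = 0" using i cmp_0_left[OF S(1)] by simp
      then have "ide C M = 0" using S(5) cmp_0_right[OF S(3)] by simp
      then show ?thesis using zero_objectI by blast
    next
      case 2
      have "p2 \<cdot> (i1 \<cdot> p1) = 0" using cmp_reassoc[OF S(7,3,1,4)] S(3) by simp
      then have "p2 = 0" using 2 cmp_ide_right[OF S(4)] by simp
      then have "ide C N = 0" using S(6) cmp_0_left[OF S(2)] by simp
      then show ?thesis using zero_objectI by blast
    qed
  qed
  ultimately have "indecomposable C (projectives C E') X" unfolding indecomposable_def by blast
  then show ?thesis using that f(1) fg by blast
qed

end
end

section \<open>The valuation\<close>

lemma (in exact_category) Ext1_midE:
  assumes "\<xi> \<in> Ext1_mid C E A D B"
  obtains i X p where "(D, i, X, p, A) \<in> E" "isomorphic C X B" "\<xi> = ext_equiv E C A D `` {(i, X, p)}"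
proof -
  obtain x where x: "x \<in> ext_conflations E A D" "\<xi> = ext_equiv E C A D `` {x}"
    and "\<exists>(i, X, p)\<in>\<xi>. isomorphic C X B"
    using assms unfolding Ext1_mid_def Ext1_def quotient_def by blast
  then obtain i' X' p' where 1: "(i', X', p') \<in> \<xi>" "isomorphic C X' B" by blast
  obtain i X p where xx: "x = (i, X, p)" by (cases x)
  have "(x, (i', X', p')) \<in> ext_equiv E C A D" using 1 x by blast
  then have "isomorphic C X X'" unfolding xx ext_equiv_def isomorphic_def by auto
  then have "isomorphic C X B" using 1 isomorphic_trans by blast
  then show ?thesis using that x unfolding xx ext_conflations_def by auto
qed

text \<open>
  A Yoneda class determines the isomorphism class of its middle term.
\<close>

lemma (in exact_category) finite_Ext1_middles:
  assumes "finite (Ext1 C E A D)"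
  shows "finite {b \<in> Iso C. Ext1_mid C E A D (rep b) \<noteq> {}}"
proof -
  define m where "m \<xi> = iso_class C (fst (snd (SOME x. x \<in> \<xi>)))" for \<xi> :: "('m \<times> 'o \<times> 'm) set"
  have "{b \<in> Iso C. Ext1_mid C E A D (rep b) \<noteq> {}} \<subseteq> m ` Ext1 C E A D"
  proof
    fix b assume b: "b \<in> {b \<in> Iso C. Ext1_mid C E A D (rep b) \<noteq> {}}"
    then obtain \<xi> where \<xi>: "\<xi> \<in> Ext1_mid C E A D (rep b)" by blast
    obtain i X p where X: "(D, i, X, p, A) \<in> E" "isomorphic C X (rep b)"
      "\<xi> = ext_equiv E C A D `` {(i, X, p)}" by (rule Ext1_midE[OF \<xi>])
    have "\<exists>x. x \<in> \<xi>" using \<xi> unfolding Ext1_mid_def by blast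
    then have "(SOME x. x \<in> \<xi>) \<in> \<xi>" by (rule someI_ex)
    then have "isomorphic C X (fst (snd (SOME x. x \<in> \<xi>)))"
      unfolding X(3) ext_equiv_def isomorphic_def by auto
    then have "m \<xi> = iso_class C (rep b)" unfolding m_def iso_class_eq_iff
      using X(2) isomorphic_sym isomorphic_trans by blast
    then have "m \<xi> = b" using iso_class_rep b by simp
    then show "b \<in> m ` Ext1 C E A D" using \<xi> unfolding Ext1_mid_def by blast
  qed
  then show ?thesis using assms finite_subset by blast
qed

context finite_exact_pair
begin

text \<open>
  All fibres of \<open>Hom(Q, X) \<rightarrow> Hom(Q, M)\<close> over its image are translates of \<open>Hom(Q, N)\<close>. Counting
  replaces a rank formula, as all spaces are finite.
\<close>

lemma card_Hom_exact:
  assumes k: "is_kernel C N i X p M"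
  shows "card (Hom C Q X) = card (img p X Q) * card (Hom C Q N)"
proof -
  have H: "i \<in> Hom C N X" "p \<in> Hom C X M" "p \<cdot> i = 0" using k unfolding is_kernel_def by auto
  have "\<forall>y\<in>img p X Q. \<exists>x\<in>Hom C Q X. p \<cdot> x = y" unfolding img_def by blast
  then obtain s where s: "\<And>y. y \<in> img p X Q \<Longrightarrow> s y \<in> Hom C Q X" "\<And>y. y \<in> img p X Q \<Longrightarrow> p \<cdot> s y = y"
    by metis
  let ?f = "\<lambda>(y, n). s y + i \<cdot> n"
  have pf: "p \<cdot> (s y + i \<cdot> n) = y" if "y \<in> img p X Q" "n \<in> Hom C Q N" for y n
    using cmp_add_right[OF s(1)[OF that(1)] cmp_Hom[OF that(2) H(1)] H(2)] s(2)[OF that(1)]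
      cmp_reassoc[OF H(3) that(2) H(1,2)] that(2) by simp
  have "bij_betw ?f (img p X Q \<times> Hom C Q N) (Hom C Q X)"
    unfolding bij_betw_def
  proof
    show "inj_on ?f (img p X Q \<times> Hom C Q N)"
    proof (rule inj_onI, clarify)
      fix y n y' n'
      assume a: "y \<in> img p X Q" "n \<in> Hom C Q N" "y' \<in> img p X Q" "n' \<in> Hom C Q N"
        and eq: "s y + i \<cdot> n = s y' + i \<cdot> n'"
      have y: "y = y'" using pf[OF a(1,2)] pf[OF a(3,4)] eq by simp
      then have "i \<cdot> n = i \<cdot> n'" using eq by simp
      then show "y = y' \<and> n = n'" using y kernel_mono[OF k a(2,4)] by blast
    qed
    show "?f ` (img p X Q \<times> Hom C Q N) = Hom C Q X"
    proof (intro equalityI subsetI)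
      fix x assume "x \<in> ?f ` (img p X Q \<times> Hom C Q N)"
      then show "x \<in> Hom C Q X" using s(1) cmp_Hom[OF _ H(1)] by (auto intro: Hom_add)
    next
      fix x assume x: "x \<in> Hom C Q X"
      have px: "p \<cdot> x \<in> img p X Q" by (rule imgI[OF x])
      have d: "x - s (p \<cdot> x) \<in> Hom C Q X" by (rule Hom_diff[OF x s(1)[OF px]])
      have "p \<cdot> (x - s (p \<cdot> x)) = 0" using cmp_diff_right[OF x s(1)[OF px] H(2)] s(2)[OF px] by simp
      then obtain n where n: "n \<in> Hom C Q N" "i \<cdot> n = x - s (p \<cdot> x)" using kernel_factor[OF k d] by blast
      show "x \<in> ?f ` (img p X Q \<times> Hom C Q N)"
        by (rule image_eqI[of _ _ "(p \<cdot> x, n)"]) (use n px in auto)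
    qed
  qed
  then show ?thesis using bij_betw_same_card card_cartesian_product by metis
qed

abbreviation dimHom :: "'o \<Rightarrow> 'o \<Rightarrow> nat"
  where "dimHom X Y \<equiv> vector_space.dim (scale C) (Hom C X Y)"

lemma card_Hom: "card (Hom C X Y) = card (UNIV :: 'k set) ^ dimHom X Y"
  by (rule card_subspace_finite_field[OF vector_space Hom_subspace finite_Hom])

lemma card_field: "1 < card (UNIV :: 'k set)"
proof -
  have "card {0, 1 :: 'k} \<le> card (UNIV :: 'k set)" by (rule card_mono) auto
  then show ?thesis by simp
qed

lemma dimHom_exact:
  assumes k: "is_kernel C N i X p M"
  shows "dimHom Q X \<le> dimHom Q M + dimHom Q N"
    and "dimHom Q X = dimHom Q M + dimHom Q N \<longleftrightarrow> img p X Q = Hom C Q M"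
proof -
  let ?q = "card (UNIV :: 'k set)"
  have sub: "img p X Q \<subseteq> Hom C Q M" using k img_closed(1) unfolding is_kernel_def by blast
  have pow: "?q ^ (dimHom Q M + dimHom Q N) = card (Hom C Q M) * card (Hom C Q N)"
    by (simp add: card_Hom power_add)
  have "?q ^ dimHom Q X \<le> ?q ^ (dimHom Q M + dimHom Q N)"
    unfolding pow card_Hom[symmetric] card_Hom_exact[OF k] by (simp add: card_mono sub)
  then show "dimHom Q X \<le> dimHom Q M + dimHom Q N" using card_field power_le_imp_le_exp by blast
  have "dimHom Q X = dimHom Q M + dimHom Q N \<longleftrightarrow> ?q ^ dimHom Q X = ?q ^ (dimHom Q M + dimHom Q N)"
    using card_field by (simp add: power_inject_exp)
  also have "\<dots> \<longleftrightarrow> card (img p X Q) = card (Hom C Q M)"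
    unfolding pow card_Hom[symmetric, of Q X] card_Hom_exact[OF k] using card_Hom[of Q N] by simp
  also have "\<dots> \<longleftrightarrow> img p X Q = Hom C Q M"
    using card_subset_eq[OF finite_Hom sub] by auto
  finally show "dimHom Q X = dimHom Q M + dimHom Q N \<longleftrightarrow> img p X Q = Hom C Q M" .
qed

lemma dimHom_eq_0: "dimHom X Y = 0 \<longleftrightarrow> Hom C X Y = {0}"
proof
  assume "dimHom X Y = 0"
  then have "card (Hom C X Y) = 1" by (simp add: card_Hom)
  then show "Hom C X Y = {0}" using Hom_0[of X Y] by (metis card_1_singletonE singletonD)
next
  assume "Hom C X Y = {0}"
  then have "card (UNIV :: 'k set) ^ dimHom X Y = 1" using card_Hom[of X Y] by simp
  then show "dimHom X Y = 0" using card_field by (simp add: nat_power_eq_Suc_0_iff)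
qed

lemma dimHom_iso:
  assumes "isomorphic C Y Y'"
  shows "dimHom X Y = dimHom X Y'"
proof -
  have le: "card (Hom C X Y) \<le> card (Hom C X Y')" if iso: "isomorphic C Y Y'" for Y Y'
  proof -
    obtain f g where fg: "f \<in> Hom C Y Y'" "g \<in> Hom C Y' Y" "g \<cdot> f = ide C Y"
      using iso unfolding isomorphic_def iso_morphism_def by blast
    have "inj_on (cmp C f) (Hom C X Y)"
      by (rule inj_on_inverseI[where g = "cmp C g"]) (use fg cmp_reassoc[OF fg(3) _ fg(1,2)] cmp_ide_left in simp)
    moreover have "cmp C f ` Hom C X Y \<subseteq> Hom C X Y'" using cmp_Hom[OF _ fg(1)] by blast
    ultimately show ?thesis using card_inj_on_le finite_Hom by blast
  qed
  have "card (Hom C X Y) = card (Hom C X Y')"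
    using le[OF assms] le[OF isomorphic_sym[OF assms]] by simp
  then show ?thesis using card_field by (simp add: card_Hom power_inject_exp)
qed

lemma lift_iso:
  assumes "isomorphic C Q P" and p: "p \<in> Hom C X M" and "img p X Q = Hom C Q M"
  shows "img p X P = Hom C P M"
proof
  show "img p X P \<subseteq> Hom C P M" by (rule img_closed(1)[OF p])
  show "Hom C P M \<subseteq> img p X P"
  proof
    fix f assume f: "f \<in> Hom C P M"
    obtain a b where ab: "a \<in> Hom C Q P" "b \<in> Hom C P Q" "a \<cdot> b = ide C P"
      using assms(1) unfolding isomorphic_def iso_morphism_def by blast
    have "f \<cdot> a \<in> img p X Q" using cmp_Hom[OF ab(1) f] assms(3) by simp
    then have "(f \<cdot> a) \<cdot> b \<in> img p X P" by (rule img_closed(6)[OF p _ ab(2)])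
    then show "f \<in> img p X P" using cmp_assoc[OF ab(2,1) f] ab(3) cmp_ide_right[OF f] by simp
  qed
qed

lemma img_projective:
  assumes "exact_category C E0" "P \<in> projectives C E0" "(N, i, X, p, M) \<in> E0"
  shows "img p X P = Hom C P M"
proof -
  interpret E0: exact_category C E0 by fact
  have p: "p \<in> Hom C X M" using E0.conflationD[OF assms(3)] by blast
  have "f \<in> img p X P" if "f \<in> Hom C P M" for f
    using E0.projective_lift[OF assms(2,3) that] imgI by metis
  then show ?thesis using img_closed(1)[OF p] by blast
qed

abbreviation new_projectives :: "'o set set"
  where "new_projectives \<equiv> ind C (projectives C E') - ind C (projectives C E)"

text \<open>
  Among the indecomposable projectives of \<open>E'\<close>, those of \<open>E\<close> lift along every deflation of \<open>E\<close>.
  So if a conflation is not in \<open>E'\<close>, the indecomposable projective detecting this is a new one.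
\<close>

lemma conflation_E'_iff_exact:
  assumes c: "(N, i, X, p, M) \<in> E"
  shows "(N, i, X, p, M) \<in> E' \<longleftrightarrow> (\<forall>P\<in>new_projectives. img p X (rep P) = Hom C (rep P) M)"
proof
  have p: "p \<in> Hom C X M" using E.conflationD[OF c] by blast
  show "\<forall>P\<in>new_projectives. img p X (rep P) = Hom C (rep P) M" if c': "(N, i, X, p, M) \<in> E'"
  proof
    fix P assume "P \<in> new_projectives"
    then obtain P0 where P0: "P = iso_class C P0" "P0 \<in> projectives C E'"
      unfolding ind_def indecomposable_def by blast
    have "isomorphic C P0 (rep P)" unfolding P0(1) using rep_iso_class isomorphic_sym by blast
    then show "img p X (rep P) = Hom C (rep P) M"
      by (rule lift_iso[OF _ p img_projective[OF E'.exact_category_axioms P0(2) c']])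
  qed
  show "(N, i, X, p, M) \<in> E'" if ex: "\<forall>P\<in>new_projectives. img p X (rep P) = Hom C (rep P) M"
  proof (rule ccontr)
    assume "(N, i, X, p, M) \<notin> E'"
    then obtain P f where P: "indecomposable C (projectives C E') P" "f \<in> Hom C P M" "f \<notin> img p X P"
      using nonconflation_detected_by_projective[OF c] by blast
    have "iso_class C P \<notin> ind C (projectives C E)"
    proof
      assume "iso_class C P \<in> ind C (projectives C E)"
      then obtain P1 where P1: "iso_class C P = iso_class C P1" "P1 \<in> projectives C E"
        unfolding ind_def indecomposable_def by blast
      then have "isomorphic C P1 P" using iso_class_eq_iff isomorphic_sym by blast
      then have "img p X P = Hom C P M"
        by (rule lift_iso[OF _ p img_projective[OF E.exact_category_axioms P1(2) c]])
      then show False using P by blast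
    qed
    then have "iso_class C P \<in> new_projectives" using P(1) unfolding ind_def by blast
    then have "img p X (rep (iso_class C P)) = Hom C (rep (iso_class C P)) M" using ex by blast
    then have "img p X P = Hom C P M" by (rule lift_iso[OF rep_iso_class p])
    then show False using P by blast
  qed
qed

end

locale exact_degeneration = finite_exact_pair C E E'
  for C :: "('o, 'm::ab_group_add, 'k::{field, finite}) lincat"
    and E E' :: "('o, 'm) pair_of_maps set" +
  assumes finite_support: "finite {P \<in> new_projectives. Hom C (rep P) M \<noteq> {0}}"
begin

abbreviation w :: "'o \<Rightarrow> nat"
  where "w M \<equiv> w_val C E E' (iso_class C M)"

text \<open>
  The index set in the definition of \<open>w_val\<close> depends on the object. To compare the values at several
  objects it is enlarged to one finite set that serves all of them.
\<close>

lemma w_sum: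
  assumes "finite S" "S \<subseteq> new_projectives" "{P \<in> new_projectives. Hom C (rep P) M \<noteq> {0}} \<subseteq> S"
  shows "w M = (\<Sum>P\<in>S. dimHom (rep P) M)"
proof -
  have dim: "dimHom Q (rep (iso_class C M)) = dimHom Q M" for Q by (rule dimHom_iso[OF rep_iso_class])
  have "w M = (\<Sum>P\<in>{P \<in> new_projectives. Hom C (rep P) M \<noteq> {0}}. dimHom (rep P) M)"
    unfolding w_val_def dimHom_eq_0[symmetric] dim ..
  also have "\<dots> = (\<Sum>P\<in>S. dimHom (rep P) M)"
    by (rule sum.mono_neutral_left[OF assms(1,3)]) (use assms(2) dimHom_eq_0 in blast)
  finally show ?thesis .
qed

text \<open>
  A sum of inequalities between numbers is an equality only if each of them is.
\<close>

lemma w_exact: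
  assumes k: "is_kernel C N i X p M"
  shows "w X \<le> w M + w N"
    and "w X = w M + w N \<longleftrightarrow> (\<forall>P\<in>new_projectives. img p X (rep P) = Hom C (rep P) M)"
proof -
  let ?S = "\<lambda>M. {P \<in> new_projectives. Hom C (rep P) M \<noteq> {0}}"
  define T where "T = ?S X \<union> ?S M \<union> ?S N"
  have T: "finite T" "T \<subseteq> new_projectives" unfolding T_def using finite_support by auto
  have w: "w X = (\<Sum>P\<in>T. dimHom (rep P) X)" "w M = (\<Sum>P\<in>T. dimHom (rep P) M)"
    "w N = (\<Sum>P\<in>T. dimHom (rep P) N)"
    by (rule w_sum[OF T]; simp add: T_def; blast)+
  have le: "dimHom (rep P) X \<le> dimHom (rep P) M + dimHom (rep P) N" for P by (rule dimHom_exact(1)[OF k])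
  show "w X \<le> w M + w N"
    unfolding w sum.distrib[symmetric] by (rule sum_mono[OF le])
  have p: "p \<in> Hom C X M" using k unfolding is_kernel_def by blast
  have triv: "img p X (rep P) = Hom C (rep P) M" if "P \<in> new_projectives" "P \<notin> T" for P
  proof -
    have "Hom C (rep P) M = {0}" using that unfolding T_def by simp
    then show ?thesis using img_closed(1)[OF p, of "rep P"] img_closed(2)[OF p, of "rep P"] by auto
  qed
  have "w X = w M + w N \<longleftrightarrow> (\<forall>P\<in>T. dimHom (rep P) X = dimHom (rep P) M + dimHom (rep P) N)"
    unfolding w sum.distrib[symmetric]
  proof
    assume eq: "(\<Sum>P\<in>T. dimHom (rep P) X) = (\<Sum>P\<in>T. dimHom (rep P) M + dimHom (rep P) N)"
    show "\<forall>P\<in>T. dimHom (rep P) X = dimHom (rep P) M + dimHom (rep P) N"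
      by (intro ballI) (rule sum_mono_inv[OF eq le _ T(1)])
  qed simp
  also have "\<dots> \<longleftrightarrow> (\<forall>P\<in>new_projectives. img p X (rep P) = Hom C (rep P) M)"
    unfolding dimHom_exact(2)[OF k] using triv T(2) by (metis subsetD)
  finally show "w X = w M + w N \<longleftrightarrow> (\<forall>P\<in>new_projectives. img p X (rep P) = Hom C (rep P) M)" .
qed

lemma w_conflation:
  assumes c: "(N, i, X, p, M) \<in> E"
  shows "w X \<le> w M + w N" and "w X = w M + w N \<longleftrightarrow> (N, i, X, p, M) \<in> E'"
  using w_exact[OF E.conflationD(4)[OF c]] conflation_E'_iff_exact[OF c] by auto

lemma w_direct_sum:
  assumes "direct_sum C M N S"
  shows "w S = w M + w N"
proof -
  obtain i1 i2 p1 p2 where S: "i1 \<in> Hom C M S" "i2 \<in> Hom C N S" "p1 \<in> Hom C S M" "p2 \<in> Hom C S N"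
    "p1 \<cdot> i1 = ide C M" "p2 \<cdot> i2 = ide C N" "p2 \<cdot> i1 = 0" "p1 \<cdot> i2 = 0" "i1 \<cdot> p1 + i2 \<cdot> p2 = ide C S"
    using assms unfolding direct_sum_def by blast
  have "is_kernel C N i2 S p1 M"
  proof (rule kernelI[OF S(2,3,8)])
    fix X f assume f: "f \<in> Hom C X S" "p1 \<cdot> f = 0"
    have "f = (i1 \<cdot> p1 + i2 \<cdot> p2) \<cdot> f" using cmp_ide_left[OF f(1)] S(9) by simp
    also have "\<dots> = i1 \<cdot> (p1 \<cdot> f) + i2 \<cdot> (p2 \<cdot> f)"
      using cmp_add_left[OF f(1) cmp_Hom[OF S(3,1)] cmp_Hom[OF S(4,2)]] cmp_assoc[OF f(1) S(3,1)]
        cmp_assoc[OF f(1) S(4,2)] by simp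
    also have "\<dots> = i2 \<cdot> (p2 \<cdot> f)" using f(2) cmp_0_right[OF S(1)] by simp
    finally show "\<exists>g\<in>Hom C X N. i2 \<cdot> g = f" using cmp_Hom[OF f(1) S(4)] by (intro bexI[of _ "p2 \<cdot> f"]) auto
  next
    fix X u assume u: "u \<in> Hom C X N" "i2 \<cdot> u = 0"
    then show "u = 0" using cmp_reassoc[OF S(6) u(1) S(2,4)] cmp_0_right[OF S(4)] cmp_ide_left[OF u(1)] by simp
  qed
  moreover have "img p1 S Q = Hom C Q M" for Q
  proof
    show "Hom C Q M \<subseteq> img p1 S Q"
    proof
      fix f assume f: "f \<in> Hom C Q M"
      then show "f \<in> img p1 S Q"
        using imgI[OF cmp_Hom[OF f S(1)], of p1] cmp_reassoc[OF S(5) f S(1,3)] cmp_ide_left[OF f] by simp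
    qed
  qed (rule img_closed(1)[OF S(3)])
  ultimately show ?thesis using w_exact(2) by blast
qed

lemma w_zero_object: "zero_object C Z \<Longrightarrow> w Z = 0"
proof -
  assume "zero_object C Z"
  then have "Hom C Q Z = {0}" for Q using zero_object_Hom(1) Hom_0 by blast
  then show ?thesis using w_sum[of "{}" Z] by simp
qed

lemma valuation_w: "valuation C E (w_val C E E')"
  unfolding valuation_def
proof (intro conjI allI impI)
  fix N i X p M S assume c: "(N, i, X, p, M) \<in> E" and S: "direct_sum C M N S"
  show "w X \<le> w S" using w_conflation(1)[OF c] w_direct_sum[OF S] by simp
qed (rule w_direct_sum)

lemma Ext1_mid_le:
  assumes "Ext1_mid C E A D B \<noteq> {}"
  shows "w B \<le> w A + w D"
proof -
  obtain \<xi> where \<xi>: "\<xi> \<in> Ext1_mid C E A D B" using assms by blast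
  obtain i X p where X: "(D, i, X, p, A) \<in> E" "isomorphic C X B" by (rule E.Ext1_midE[OF \<xi>])
  have "iso_class C X = iso_class C B" using X(2) iso_class_eq_iff by simp
  then show ?thesis using w_conflation(1)[OF X(1)] by simp
qed

text \<open>
  As \<open>E'\<close> is closed under isomorphism, a Yoneda class of \<open>E\<close> that meets \<open>E'\<close> lies in \<open>E'\<close>.
\<close>

lemma ext_class_E':
  assumes c: "(D, i, X, p, A) \<in> E'"
  shows "ext_equiv E' C A D `` {(i, X, p)} = ext_equiv E C A D `` {(i, X, p)}"
proof -
  have H: "p \<in> Hom C X A" "i \<in> Hom C D X" using E'.conflationD[OF c] by auto
  have "(D, i', X', p', A) \<in> E'"
    if c': "(D, i', X', p', A) \<in> E" and h: "iso_morphism C X X' h" "h \<cdot> i = i'" "p' \<cdot> h = p" for i' X' p' h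
    by (rule E'.iso_closed[OF c iso_morphism_ide h(1) iso_morphism_ide])
      (use E.conflationD[OF c'] h H cmp_ide_left cmp_ide_right in auto)
  then show ?thesis using E'_subset c unfolding ext_equiv_def ext_conflations_def by auto
qed

text \<open>
  All middle terms of a Yoneda class are isomorphic, so the weight of the middle term
  decides whether the class belongs to \<open>E'\<close>.
\<close>

lemma Ext1_mid_E':
  "Ext1_mid C E' A D B = (if w B = w A + w D then Ext1_mid C E A D B else {})"
proof -
  have 1: "w B = w A + w D \<and> \<xi> \<in> Ext1_mid C E A D B" if \<xi>: "\<xi> \<in> Ext1_mid C E' A D B" for \<xi>
  proof -
    obtain i X p where X: "(D, i, X, p, A) \<in> E'" "isomorphic C X B" 
      "\<xi> = ext_equiv E' C A D `` {(i, X, p)}" by (rule E'.Ext1_midE[OF \<xi>])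
    have "iso_class C X = iso_class C B" using X(2) iso_class_eq_iff by simp
    moreover have "w X = w A + w D" using w_conflation(2)[OF subsetD[OF E'_subset X(1)]] X(1) by blast
    ultimately have "w B = w A + w D" by simp
    moreover have "\<xi> \<in> Ext1 C E A D"
      unfolding X(3) ext_class_E'[OF X(1)] Ext1_def
      by (rule quotientI) (use X(1) E'_subset in \<open>auto simp: ext_conflations_def\<close>)
    moreover have "\<exists>(i, X, p)\<in>\<xi>. isomorphic C X B" using \<xi> unfolding Ext1_mid_def by blast
    ultimately show ?thesis unfolding Ext1_mid_def by blast
  qed
  have 2: "\<xi> \<in> Ext1_mid C E' A D B" if eq: "w B = w A + w D" and \<xi>: "\<xi> \<in> Ext1_mid C E A D B" for \<xi>
  proof -
    obtain i X p where X: "(D, i, X, p, A) \<in> E" "isomorphic C X B" 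
      "\<xi> = ext_equiv E C A D `` {(i, X, p)}" by (rule E.Ext1_midE[OF \<xi>])
    have "iso_class C X = iso_class C B" using X(2) iso_class_eq_iff by simp
    then have "w X = w A + w D" using eq by simp
    then have X': "(D, i, X, p, A) \<in> E'" using w_conflation(2)[OF X(1)] by blast
    have "\<xi> \<in> Ext1 C E' A D"
      unfolding X(3) ext_class_E'[OF X', symmetric] Ext1_def
      by (rule quotientI) (use X' in \<open>auto simp: ext_conflations_def\<close>)
    moreover have "\<exists>(i, X, p)\<in>\<xi>. isomorphic C X B" using \<xi> unfolding Ext1_mid_def by blast
    ultimately show ?thesis unfolding Ext1_mid_def by blast
  qed
  show ?thesis using 1 2 by auto
qed

end

section \<open>Filtered algebras with a weighted basis\<close>

lemma lookup_qscale [simp]: "Poly_Mapping.lookup (qscale c x) b = c * Poly_Mapping.lookup x b"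
  unfolding qscale_def by (simp add: Poly_Mapping.map.rep_eq when_def)

lemma vector_space_qscale: "vector_space qscale"
  by unfold_locales (auto intro!: poly_mapping_eqI simp: lookup_add algebra_simps)

lemma lookup_sum_single:
  "finite S \<Longrightarrow> Poly_Mapping.lookup (\<Sum>a\<in>S. Poly_Mapping.single a (g a)) b = (if b \<in> S then g b else 0)"
  by (simp add: lookup_sum lookup_single when_def)

lemma keys_subset_iff: "Poly_Mapping.keys x \<subseteq> S \<longleftrightarrow> (\<forall>b. Poly_Mapping.lookup x b \<noteq> 0 \<longrightarrow> b \<in> S)"
  by (auto simp: in_keys_iff)

lemma span_basis_vectors:
  "Modules.module.span qscale ((\<lambda>a. Poly_Mapping.single a 1) ` S) = {x. Poly_Mapping.keys x \<subseteq> S}"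
proof -
  interpret vector_space qscale by (rule vector_space_qscale)
  have "subspace {x :: 'a \<Rightarrow>\<^sub>0 rat. Poly_Mapping.keys x \<subseteq> S}"
    unfolding subspace_def keys_subset_iff by (auto simp: lookup_add) (metis add_0)
  then have "span ((\<lambda>a. Poly_Mapping.single a 1) ` S) \<subseteq> {x. Poly_Mapping.keys x \<subseteq> S}"
    by (intro span_minimal) auto
  moreover have "x \<in> span ((\<lambda>a. Poly_Mapping.single a 1) ` S)" if "Poly_Mapping.keys x \<subseteq> S" for x
  proof -
    have "x = (\<Sum>a\<in>Poly_Mapping.keys x. qscale (Poly_Mapping.lookup x a) (Poly_Mapping.single a 1))"
      by (rule poly_mapping_eqI) (simp add: lookup_sum lookup_single when_def in_keys_iff if_distrib cong: if_cong)
    also have "\<dots> \<in> span ((\<lambda>a. Poly_Mapping.single a 1) ` S)"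
      using that by (intro span_sum span_scale span_base) auto
    finally show ?thesis .
  qed
  ultimately show ?thesis by blast
qed

definition bilinear_extension ::
  "('b \<Rightarrow> 'b \<Rightarrow> ('b \<Rightarrow>\<^sub>0 rat)) \<Rightarrow> ('b \<Rightarrow>\<^sub>0 rat) \<Rightarrow> ('b \<Rightarrow>\<^sub>0 rat) \<Rightarrow> ('b \<Rightarrow>\<^sub>0 rat)" where
  "bilinear_extension m x y =
    (\<Sum>a\<in>Poly_Mapping.keys x. \<Sum>c\<in>Poly_Mapping.keys y.
      qscale (Poly_Mapping.lookup x a * Poly_Mapping.lookup y c) (m a c))"

definition basis_algebra ::
  "'b set \<Rightarrow> 'b \<Rightarrow> ('b \<Rightarrow> 'b \<Rightarrow> ('b \<Rightarrow>\<^sub>0 rat)) \<Rightarrow> (rat, 'b \<Rightarrow>\<^sub>0 rat) module" where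
  "basis_algebra I e m =
    \<lparr>carrier = {x. Poly_Mapping.keys x \<subseteq> I}, monoid.mult = bilinear_extension m,
     one = Poly_Mapping.single e 1, zero = 0, add = (+), smult = qscale\<rparr>"

lemma basis_algebra_simps [simp]:
  "carrier (basis_algebra I e m) = {x. Poly_Mapping.keys x \<subseteq> I}"
  "mult (basis_algebra I e m) = bilinear_extension m"
  "one (basis_algebra I e m) = Poly_Mapping.single e 1"
  "zero (basis_algebra I e m) = 0"
  "add (basis_algebra I e m) = (+)"
  "smult (basis_algebra I e m) = qscale"
  by (simp_all add: basis_algebra_def)

lemma hall_algebra_eq_basis_algebra:
  "hall_algebra C E = basis_algebra (Iso C) (iso_class C (SOME Z. zero_object C Z)) (hall_basis_mult C E)"
  unfolding hall_algebra_def basis_algebra_def hall_basis_def hall_mult_def bilinear_extension_def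
  by (simp add: fun_eq_iff)

lemma lookup_bilinear_extension:
  assumes "finite S" "Poly_Mapping.keys x \<subseteq> S" "Poly_Mapping.keys y \<subseteq> S"
  shows "Poly_Mapping.lookup (bilinear_extension m x y) b =
    (\<Sum>a\<in>S. \<Sum>c\<in>S. Poly_Mapping.lookup x a * Poly_Mapping.lookup y c * Poly_Mapping.lookup (m a c) b)"
proof -
  have "(\<Sum>c\<in>Poly_Mapping.keys y. Poly_Mapping.lookup x a * Poly_Mapping.lookup y c * Poly_Mapping.lookup (m a c) b)
    = (\<Sum>c\<in>S. Poly_Mapping.lookup x a * Poly_Mapping.lookup y c * Poly_Mapping.lookup (m a c) b)" for a
    by (rule sum.mono_neutral_left) (use assms in \<open>auto simp: in_keys_iff\<close>)
  then have "Poly_Mapping.lookup (bilinear_extension m x y) b =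
    (\<Sum>a\<in>Poly_Mapping.keys x. \<Sum>c\<in>S. Poly_Mapping.lookup x a * Poly_Mapping.lookup y c * Poly_Mapping.lookup (m a c) b)"
    unfolding bilinear_extension_def by (simp add: lookup_sum)
  also have "\<dots> = (\<Sum>a\<in>S. \<Sum>c\<in>S. Poly_Mapping.lookup x a * Poly_Mapping.lookup y c * Poly_Mapping.lookup (m a c) b)"
    by (rule sum.mono_neutral_left) (use assms in \<open>auto simp: in_keys_iff\<close>)
  finally show ?thesis .
qed

lemma abelian_group_basis_algebra: "abelian_group (basis_algebra I e m)"
proof (rule abelian_groupI)
  fix x assume "x \<in> carrier (basis_algebra I e m)"
  then show "\<exists>y\<in>carrier (basis_algebra I e m). y \<oplus>\<^bsub>basis_algebra I e m\<^esub> x = \<zero>\<^bsub>basis_algebra I e m\<^esub>"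
    by (intro bexI[of _ "- x"]) auto
qed (use Poly_Mapping.keys_add in \<open>fastforce simp: add_ac\<close>)+

lemma finsum_basis_algebra:
  assumes "finite T" "\<And>k. k \<in> T \<Longrightarrow> Poly_Mapping.keys (f k) \<subseteq> I"
  shows "finsum (basis_algebra I e m) f T = sum f T"
proof -
  interpret abelian_group "basis_algebra I e m" by (rule abelian_group_basis_algebra)
  show ?thesis
    using assms by (induction T rule: finite_induct) (auto simp: finsum_insert Pi_iff)
qed

text \<open>
  For the intended \<open>m\<close> and \<open>m'\<close>, the structure constants of the Hall algebras of \<open>E\<close> and
  \<open>E'\<close>, the two conditions on the weight are the valuation inequality and its equality case.
\<close>

locale degenerating_basis_algebra =
  fixes I :: "'b set" and e :: 'b and w :: "'b \<Rightarrow> nat"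
    and m m' :: "'b \<Rightarrow> 'b \<Rightarrow> ('b \<Rightarrow>\<^sub>0 rat)"
  assumes unit_basis: "e \<in> I" and unit_weight: "w e = 0"
    and mult_support: "\<lbrakk>a \<in> I; c \<in> I; Poly_Mapping.lookup (m a c) b \<noteq> 0\<rbrakk> \<Longrightarrow> b \<in> I \<and> w b \<le> w a + w c"
    and mult_top: "\<lbrakk>a \<in> I; c \<in> I\<rbrakk> \<Longrightarrow> Poly_Mapping.lookup (m' a c) b =
      (if w b = w a + w c then Poly_Mapping.lookup (m a c) b else 0)"
begin

abbreviation H where "H \<equiv> basis_algebra I e m"
abbreviation H' where "H' \<equiv> basis_algebra I e m'"

definition F :: "nat \<Rightarrow> ('b \<Rightarrow>\<^sub>0 rat) set"
  where "F n = {x. Poly_Mapping.keys x \<subseteq> {a \<in> I. w a \<le> n}}"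

lemma F_lookup: "x \<in> F n \<longleftrightarrow> (\<forall>b. Poly_Mapping.lookup x b \<noteq> 0 \<longrightarrow> b \<in> I \<and> w b \<le> n)"
  unfolding F_def mem_Collect_eq keys_subset_iff ..

lemma gr_prev_lookup:
  "x \<in> gr_prev H F n \<longleftrightarrow> (\<forall>b. Poly_Mapping.lookup x b \<noteq> 0 \<longrightarrow> b \<in> I \<and> w b < n)"
  unfolding gr_prev_def
  by (cases n) (auto simp: F_lookup less_Suc_eq_le intro: poly_mapping_eqI)

lemma mem_gr_coset: "y \<in> gr_coset H F n x \<longleftrightarrow> y - x \<in> gr_prev H F n"
  unfolding gr_coset_def a_r_coset_def' by (auto intro: bexI[of _ "y - x"])

lemma gr_coset_eq_iff:
  assumes "x \<in> F n" "y \<in> F n"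
  shows "gr_coset H F n x = gr_coset H F n y \<longleftrightarrow>
    (\<forall>b. w b = n \<longrightarrow> Poly_Mapping.lookup x b = Poly_Mapping.lookup y b)"
proof
  assume eq: "gr_coset H F n x = gr_coset H F n y"
  have "x \<in> gr_coset H F n x" by (simp add: mem_gr_coset gr_prev_lookup)
  then have "x - y \<in> gr_prev H F n" unfolding eq mem_gr_coset .
  then show "\<forall>b. w b = n \<longrightarrow> Poly_Mapping.lookup x b = Poly_Mapping.lookup y b"
    unfolding gr_prev_lookup by (auto simp: lookup_minus)
next
  assume eq: "\<forall>b. w b = n \<longrightarrow> Poly_Mapping.lookup x b = Poly_Mapping.lookup y b"
  have d: "b \<in> I \<and> w b < n" if "Poly_Mapping.lookup x b \<noteq> Poly_Mapping.lookup y b" for b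
  proof -
    have "Poly_Mapping.lookup x b \<noteq> 0 \<or> Poly_Mapping.lookup y b \<noteq> 0" using that by auto
    then have "b \<in> I \<and> w b \<le> n" using assms unfolding F_lookup by blast
    moreover have "w b \<noteq> n" using eq that by blast
    ultimately show ?thesis by simp
  qed
  have "z - x \<in> gr_prev H F n \<longleftrightarrow> z - y \<in> gr_prev H F n" for z
    unfolding gr_prev_lookup lookup_minus using d by (metis (full_types) right_minus_eq)
  then show "gr_coset H F n x = gr_coset H F n y" by (auto simp: mem_gr_coset)
qed

lemma gr_coset_0: "gr_coset H F n 0 = gr_prev H F n"
  by (auto simp: mem_gr_coset)

lemma mem_gr_coset_top:
  assumes "x \<in> F n"
  shows "y \<in> gr_coset H F n x \<longleftrightarrow>
    y \<in> F n \<and> (\<forall>b. w b = n \<longrightarrow> Poly_Mapping.lookup y b = Poly_Mapping.lookup x b)"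
proof
  assume y: "y \<in> gr_coset H F n x"
  then have d: "b \<in> I \<and> w b < n" if "Poly_Mapping.lookup y b \<noteq> Poly_Mapping.lookup x b" for b
    using that unfolding mem_gr_coset gr_prev_lookup by (simp add: lookup_minus)
  have "b \<in> I \<and> w b \<le> n" if "Poly_Mapping.lookup y b \<noteq> 0" for b
    using d[of b] assms that unfolding F_lookup by (metis order_less_imp_le)
  then show "y \<in> F n \<and> (\<forall>b. w b = n \<longrightarrow> Poly_Mapping.lookup y b = Poly_Mapping.lookup x b)"
    unfolding F_lookup using d by blast
next
  assume "y \<in> F n \<and> (\<forall>b. w b = n \<longrightarrow> Poly_Mapping.lookup y b = Poly_Mapping.lookup x b)"
  then have "gr_coset H F n y = gr_coset H F n x" using gr_coset_eq_iff assms by blast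
  moreover have "y \<in> gr_coset H F n y" by (simp add: mem_gr_coset gr_prev_lookup)
  ultimately show "y \<in> gr_coset H F n x" by simp
qed

lemma mult_F:
  assumes x: "x \<in> F k" and y: "y \<in> F l"
  shows "bilinear_extension m x y \<in> F (k + l)"
  unfolding F_lookup
proof (intro allI impI)
  fix b assume nz: "Poly_Mapping.lookup (bilinear_extension m x y) b \<noteq> 0"
  have "\<exists>a c. Poly_Mapping.lookup x a * Poly_Mapping.lookup y c * Poly_Mapping.lookup (m a c) b \<noteq> 0"
  proof (rule ccontr)
    assume "\<not> ?thesis"
    then have "Poly_Mapping.lookup (bilinear_extension m x y) b = 0"
      unfolding bilinear_extension_def lookup_sum lookup_qscale by (intro sum.neutral ballI) auto
    then show False using nz by blast
  qed
  then obtain a c where "Poly_Mapping.lookup x a \<noteq> 0" "Poly_Mapping.lookup y c \<noteq> 0"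
    and *: "Poly_Mapping.lookup (m a c) b \<noteq> 0" by auto
  then have "a \<in> I" "w a \<le> k" "c \<in> I" "w c \<le> l" using x y unfolding F_lookup by auto
  then show "b \<in> I \<and> w b \<le> k + l" using mult_support[OF _ _ *] by fastforce
qed

lemma algebra_filtration_F: "algebra_filtration H F"
proof -
  interpret abelian_group H by (rule abelian_group_basis_algebra)
  have "additive_subgroup (F n) H" for n
  proof (rule additive_subgroup.intro, rule add.subgroupI)
    show "F n \<subseteq> carrier H" unfolding F_def by auto
    show "F n \<noteq> {}" unfolding F_def using keys_zero by fastforce
    show "\<ominus>\<^bsub>H\<^esub> x \<in> F n" if "x \<in> F n" for x
    proof -
      have "\<ominus>\<^bsub>H\<^esub> x = - x"
        by (rule minus_equality) (use that in \<open>auto simp: F_def\<close>)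
      then show ?thesis using that by (simp add: F_def)
    qed
    show "x \<oplus>\<^bsub>H\<^esub> y \<in> F n" if "x \<in> F n" "y \<in> F n" for x y
      using that Poly_Mapping.keys_add[of x y] unfolding F_def by auto
  qed
  moreover have "(\<Union>n. F n) = carrier H"
  proof (intro equalityI subsetI)
    fix x assume "x \<in> carrier H"
    then have "x \<in> F (\<Sum>a\<in>Poly_Mapping.keys x. w a)"
      unfolding F_def by (auto intro: member_le_sum)
    then show "x \<in> (\<Union>n. F n)" by blast
  qed (auto simp: F_def)
  moreover have "Poly_Mapping.single e 1 \<in> F 0"
    unfolding F_def using unit_basis unit_weight by simp
  moreover have "F n \<subseteq> F (Suc n)" for n unfolding F_def by auto
  moreover have "qscale c x \<in> F n" if "x \<in> F n" for c x n using that unfolding F_lookup by simp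
  ultimately show ?thesis
    unfolding algebra_filtration_def basis_algebra_simps by (intro conjI allI ballI mult_F)
qed

definition part :: "nat \<Rightarrow> ('b \<Rightarrow>\<^sub>0 rat) \<Rightarrow> ('b \<Rightarrow>\<^sub>0 rat)"
  where "part n x = (\<Sum>a\<in>{a \<in> Poly_Mapping.keys x. w a = n}. Poly_Mapping.single a (Poly_Mapping.lookup x a))"

lemma lookup_part: "Poly_Mapping.lookup (part n x) b = (if w b = n then Poly_Mapping.lookup x b else 0)"
  unfolding part_def by (subst lookup_sum_single) (auto simp: in_keys_iff)

lemma part_F: "Poly_Mapping.keys x \<subseteq> I \<Longrightarrow> part n x \<in> F n"
  unfolding F_lookup keys_subset_iff by (auto simp: lookup_part split: if_splits)

text \<open>
  The symbol map: in degree \<open>n\<close> it takes the class of the component of weight \<open>n\<close>.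
\<close>

definition symb :: "('b \<Rightarrow>\<^sub>0 rat) \<Rightarrow> nat \<Rightarrow> ('b \<Rightarrow>\<^sub>0 rat) set"
  where "symb x n = gr_coset H F n (part n x)"

text \<open>
  Let \<open>b\<close> have weight \<open>n\<close>. In a product of representatives of degrees \<open>k\<close> and \<open>n - k\<close>, basis elements
  of smaller weight contribute nothing to the coefficient of \<open>b\<close>. Those of weight exactly
  \<open>k\<close> and \<open>n - k\<close> contribute through \<open>m'\<close>, with coefficients that do not depend on the choice
  of the representatives.
\<close>

lemma mult_top_degree:
  assumes x: "Poly_Mapping.keys x \<subseteq> I" and y: "Poly_Mapping.keys y \<subseteq> I"
    and x': "\<And>k. k \<le> n \<Longrightarrow> x' k \<in> symb x k" and y': "\<And>k. k \<le> n \<Longrightarrow> y' k \<in> symb y k"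
    and b: "w b = n"
  shows "Poly_Mapping.lookup (\<Sum>k\<le>n. bilinear_extension m (x' k) (y' (n - k))) b =
    Poly_Mapping.lookup (bilinear_extension m' x y) b"
proof -
  have xF: "x' k \<in> F k" "\<And>a. w a = k \<Longrightarrow> Poly_Mapping.lookup (x' k) a = Poly_Mapping.lookup x a" if "k \<le> n" for k
    using x'[OF that] unfolding symb_def mem_gr_coset_top[OF part_F[OF x]] lookup_part by auto
  have yF: "y' k \<in> F k" "\<And>a. w a = k \<Longrightarrow> Poly_Mapping.lookup (y' k) a = Poly_Mapping.lookup y a" if "k \<le> n" for k
    using y'[OF that] unfolding symb_def mem_gr_coset_top[OF part_F[OF y]] lookup_part by auto
  define S where "S = Poly_Mapping.keys x \<union> Poly_Mapping.keys y \<union>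
    (\<Union>k\<le>n. Poly_Mapping.keys (x' k) \<union> Poly_Mapping.keys (y' k))"
  have S: "finite S" unfolding S_def by simp
  have SI: "S \<subseteq> I" using x y xF(1) yF(1) unfolding S_def F_def by blast
  have summand: "Poly_Mapping.lookup (x' k) a * Poly_Mapping.lookup (y' (n - k)) c * Poly_Mapping.lookup (m a c) b =
      (if w a = k then Poly_Mapping.lookup x a * Poly_Mapping.lookup y c * Poly_Mapping.lookup (m' a c) b else 0)"
    if k: "k \<le> n" and a: "a \<in> S" and c: "c \<in> S" for k a c
  proof -
    have I: "a \<in> I" "c \<in> I" using a c SI by auto
    have x0: "Poly_Mapping.lookup (x' k) a = 0" if "k < w a"
      using xF(1)[OF k] that unfolding F_lookup by (meson not_less)
    have y0: "Poly_Mapping.lookup (y' (n - k)) c = 0" if "n - k < w c"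
      using yF(1)[of "n - k"] that unfolding F_lookup by (meson diff_le_self not_less)
    have m0: "Poly_Mapping.lookup (m a c) b = 0" if "w a + w c < n"
      using mult_support[OF I] that b by (meson not_less)
    consider "w a = k" "w c = n - k" | "w a > k" | "w c > n - k" | "w a \<le> k" "w c \<le> n - k" "w a + w c < n"
      using k by linarith
    then show ?thesis
    proof cases
      case 1
      then show ?thesis using xF(2)[OF k] yF(2)[of "n - k"] mult_top[OF I, of b] b k by simp
    next
      case 2
      then show ?thesis using x0 by simp
    next
      case 3
      have "w a = k \<Longrightarrow> w b \<noteq> w a + w c" using 3 b k by linarith
      then show ?thesis using 3 y0 mult_top[OF I, of b] by auto
    next
      case 4
      then show ?thesis using m0 mult_top[OF I, of b] b by simp
    qed
  qed
  have outside: "Poly_Mapping.lookup x a * Poly_Mapping.lookup y c * Poly_Mapping.lookup (m' a c) b = 0"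
    if "a \<in> S" "c \<in> S" "n < w a" for a c
  proof -
    have "a \<in> I" "c \<in> I" using that SI by auto
    then show ?thesis using mult_top[of a c b] b that by auto
  qed
  have "Poly_Mapping.lookup (\<Sum>k\<le>n. bilinear_extension m (x' k) (y' (n - k))) b =
    (\<Sum>k\<le>n. \<Sum>a\<in>S. \<Sum>c\<in>S.
      Poly_Mapping.lookup (x' k) a * Poly_Mapping.lookup (y' (n - k)) c * Poly_Mapping.lookup (m a c) b)"
    unfolding lookup_sum
  proof (intro sum.cong refl lookup_bilinear_extension[OF S])
    fix k assume "k \<in> {..n}"
    then have "k \<le> n" "n - k \<le> n" by auto
    then show "Poly_Mapping.keys (x' k) \<subseteq> S" "Poly_Mapping.keys (y' (n - k)) \<subseteq> S"
      unfolding S_def by blast+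
  qed
  also have "\<dots> = (\<Sum>k\<le>n. \<Sum>a\<in>S. \<Sum>c\<in>S.
      if w a = k then Poly_Mapping.lookup x a * Poly_Mapping.lookup y c * Poly_Mapping.lookup (m' a c) b else 0)"
    by (intro sum.cong refl summand) auto
  also have "\<dots> = (\<Sum>a\<in>S. \<Sum>c\<in>S. \<Sum>k\<le>n.
      if w a = k then Poly_Mapping.lookup x a * Poly_Mapping.lookup y c * Poly_Mapping.lookup (m' a c) b else 0)"
    by (subst sum.swap, rule sum.cong[OF refl], subst sum.swap, rule refl)
  also have "\<dots> = (\<Sum>a\<in>S. \<Sum>c\<in>S.
      Poly_Mapping.lookup x a * Poly_Mapping.lookup y c * Poly_Mapping.lookup (m' a c) b)"
    by (intro sum.cong refl) (auto dest: outside)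
  also have "\<dots> = Poly_Mapping.lookup (bilinear_extension m' x y) b"
    by (rule lookup_bilinear_extension[OF S, symmetric]) (auto simp: S_def)
  finally show ?thesis .
qed

lemma mult'_carrier:
  assumes x: "Poly_Mapping.keys x \<subseteq> I" and y: "Poly_Mapping.keys y \<subseteq> I"
  shows "Poly_Mapping.keys (bilinear_extension m' x y) \<subseteq> I"
proof -
  have zero: "Poly_Mapping.lookup (m' a c) b = 0" if "a \<in> I" "c \<in> I" "b \<notin> I" for a b c
    using mult_support[of a c b] mult_top[of a c b] that by auto
  then have "Poly_Mapping.lookup (bilinear_extension m' x y) b = 0" if "b \<notin> I" for b
    unfolding bilinear_extension_def lookup_sum lookup_qscale
    by (intro sum.neutral ballI) (simp add: zero[OF subsetD[OF x] subsetD[OF y] that])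
  then show ?thesis by (auto simp: in_keys_iff)
qed

lemma symb_mult:
  assumes x: "Poly_Mapping.keys x \<subseteq> I" and y: "Poly_Mapping.keys y \<subseteq> I"
  shows "symb (bilinear_extension m' x y) = symb x \<otimes>\<^bsub>assoc_graded H F\<^esub> symb y"
proof
  fix n
  have eq: "gr_coset H F n (\<Oplus>\<^bsub>H\<^esub>k\<in>{..n}. x' k \<otimes>\<^bsub>H\<^esub> y' (n - k)) = symb (bilinear_extension m' x y) n"
    if x': "x' \<in> Pi {..n} (symb x)" and y': "y' \<in> Pi {..n} (symb y)" for x' y'
  proof -
    have xF: "x' k \<in> F k" if "k \<le> n" for k
      using x' that by (auto simp: Pi_iff symb_def mem_gr_coset_top[OF part_F[OF x]])
    have yF: "y' k \<in> F k" if "k \<le> n" for k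
      using y' that by (auto simp: Pi_iff symb_def mem_gr_coset_top[OF part_F[OF y]])
    have summand: "bilinear_extension m (x' k) (y' (n - k)) \<in> F n" if "k \<le> n" for k
      using mult_F[OF xF[OF that] yF[of "n - k"]] that by simp
    have "(\<Oplus>\<^bsub>H\<^esub>k\<in>{..n}. x' k \<otimes>\<^bsub>H\<^esub> y' (n - k)) = (\<Sum>k\<le>n. bilinear_extension m (x' k) (y' (n - k)))"
      by (subst finsum_basis_algebra) (use summand in \<open>auto simp: F_def\<close>)
    moreover have "(\<Sum>k\<le>n. bilinear_extension m (x' k) (y' (n - k))) \<in> F n"
      unfolding F_lookup lookup_sum
    proof (intro allI impI)
      fix b assume "(\<Sum>k\<le>n. Poly_Mapping.lookup (bilinear_extension m (x' k) (y' (n - k))) b) \<noteq> 0"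
      then obtain k where "k \<le> n" "Poly_Mapping.lookup (bilinear_extension m (x' k) (y' (n - k))) b \<noteq> 0"
        by (meson atMost_iff sum.not_neutral_contains_not_neutral)
      then show "b \<in> I \<and> w b \<le> n" using summand unfolding F_lookup by blast
    qed
    ultimately show ?thesis
      unfolding symb_def
      using gr_coset_eq_iff[OF _ part_F[OF mult'_carrier[OF x y]]] mult_top_degree[OF x y, of n x' y'] x' y'
      by (auto simp: lookup_part Pi_iff)
  qed
  have "(\<lambda>k. part k x) \<in> Pi {..n} (symb x)" "(\<lambda>k. part k y) \<in> Pi {..n} (symb y)"
    unfolding symb_def by (auto simp: mem_gr_coset gr_prev_lookup)
  then show "symb (bilinear_extension m' x y) n = (symb x \<otimes>\<^bsub>assoc_graded H F\<^esub> symb y) n"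
    unfolding assoc_graded_def using eq by simp blast
qed

lemma symb_add:
  assumes x: "Poly_Mapping.keys x \<subseteq> I" and y: "Poly_Mapping.keys y \<subseteq> I"
  shows "symb (x + y) = symb x \<oplus>\<^bsub>assoc_graded H F\<^esub> symb y"
proof
  fix n
  have part: "part n (x + y) = part n x + part n y"
    by (rule poly_mapping_eqI) (simp add: lookup_part lookup_add)
  have closed: "u + v \<in> gr_prev H F n" if "u \<in> gr_prev H F n" "v \<in> gr_prev H F n" for u v
    using that unfolding gr_prev_lookup lookup_add by (metis add.right_neutral)
  have "symb (x + y) n = symb x n <+>\<^bsub>H\<^esub> symb y n"
  proof (intro equalityI subsetI)
    fix z assume "z \<in> symb (x + y) n"
    then have "z - part n y \<in> symb x n" "part n y \<in> symb y n"
      unfolding symb_def mem_gr_coset part by (simp_all add: diff_diff_eq add.commute gr_prev_lookup)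
    then show "z \<in> symb x n <+>\<^bsub>H\<^esub> symb y n"
      unfolding set_add_def' by (intro UN_I[of "z - part n y"] UN_I[of "part n y"]) auto
  next
    fix z assume "z \<in> symb x n <+>\<^bsub>H\<^esub> symb y n"
    then obtain u v where u: "u \<in> symb x n" "v \<in> symb y n" "z = u + v"
      unfolding set_add_def' by auto
    then show "z \<in> symb (x + y) n"
      using closed[of "u - part n x" "v - part n y"] unfolding symb_def mem_gr_coset part
      by (simp add: algebra_simps)
  qed
  then show "symb (x + y) n = (symb x \<oplus>\<^bsub>assoc_graded H F\<^esub> symb y) n"
    unfolding assoc_graded_def by simp
qed

lemma symb_smult:
  assumes x: "Poly_Mapping.keys x \<subseteq> I"
  shows "symb (qscale c x) = c \<odot>\<^bsub>assoc_graded H F\<^esub> symb x"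
proof
  fix n
  have "gr_coset H F n (qscale c u) = symb (qscale c x) n" if u: "u \<in> symb x n" for u
  proof -
    have "u \<in> F n" "\<And>b. w b = n \<Longrightarrow> Poly_Mapping.lookup u b = Poly_Mapping.lookup x b"
      using u unfolding symb_def mem_gr_coset_top[OF part_F[OF x]] lookup_part by auto
    moreover from this(1) have "qscale c u \<in> F n" unfolding F_lookup by auto
    moreover have "Poly_Mapping.keys (qscale c x) \<subseteq> I" using x unfolding keys_subset_iff by auto
    ultimately show ?thesis
      unfolding symb_def using gr_coset_eq_iff[OF _ part_F] by (simp add: lookup_part)
  qed
  moreover have "part n x \<in> symb x n" unfolding symb_def by (simp add: mem_gr_coset gr_prev_lookup)
  ultimately show "symb (qscale c x) n = (c \<odot>\<^bsub>assoc_graded H F\<^esub> symb x) n"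
    unfolding assoc_graded_def by simp blast
qed

lemma symb_single:
  assumes "a \<in> I"
  shows "symb (Poly_Mapping.single a 1) = gr_class H F (w a) (Poly_Mapping.single a 1)"
proof
  fix n
  have "part n (Poly_Mapping.single a 1) = (if n = w a then Poly_Mapping.single a 1 else 0)"
    by (rule poly_mapping_eqI) (auto simp: lookup_part lookup_single when_def)
  then show "symb (Poly_Mapping.single a 1) n = gr_class H F (w a) (Poly_Mapping.single a 1) n"
    unfolding symb_def gr_class_def by (simp add: gr_coset_0)
qed

lemma bij_betw_symb: "bij_betw symb (carrier H') (carrier (assoc_graded H F))"
  unfolding bij_betw_def
proof
  show "inj_on symb (carrier H')"
  proof (rule inj_onI)
    fix x y assume "x \<in> carrier H'" "y \<in> carrier H'" and eq: "symb x = symb y"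
    then have xy: "Poly_Mapping.keys x \<subseteq> I" "Poly_Mapping.keys y \<subseteq> I" by auto
    show "x = y"
    proof (rule poly_mapping_eqI)
      fix b
      have "gr_coset H F (w b) (part (w b) x) = gr_coset H F (w b) (part (w b) y)"
        using eq unfolding symb_def by metis
      then show "Poly_Mapping.lookup x b = Poly_Mapping.lookup y b"
        unfolding gr_coset_eq_iff[OF part_F[OF xy(1)] part_F[OF xy(2)]] lookup_part by auto
    qed
  qed
  show "symb ` carrier H' = carrier (assoc_graded H F)"
  proof (intro equalityI subsetI)
    fix \<xi> assume "\<xi> \<in> symb ` carrier H'"
    then obtain x where x: "Poly_Mapping.keys x \<subseteq> I" "\<xi> = symb x" by auto
    have "symb x n \<in> gr_coset H F n ` F n" for n
      unfolding symb_def using part_F[OF x(1)] by blast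
    moreover have "{n. symb x n \<noteq> gr_prev H F n} \<subseteq> w ` Poly_Mapping.keys x"
    proof
      fix n assume "n \<in> {n. symb x n \<noteq> gr_prev H F n}"
      then have "part n x \<noteq> 0" unfolding symb_def using gr_coset_0 by force
      then obtain b where "Poly_Mapping.lookup (part n x) b \<noteq> 0" by (metis lookup_zero poly_mapping_eqI)
      then show "n \<in> w ` Poly_Mapping.keys x" by (auto simp: lookup_part in_keys_iff split: if_splits)
    qed
    then have "finite {n. symb x n \<noteq> gr_prev H F n}" by (rule finite_subset) simp
    ultimately show "\<xi> \<in> carrier (assoc_graded H F)" unfolding assoc_graded_def x(2) by simp
  next
    fix \<xi> assume "\<xi> \<in> carrier (assoc_graded H F)"
    then have \<xi>: "\<And>n. \<xi> n \<in> gr_coset H F n ` F n" "finite {n. \<xi> n \<noteq> gr_prev H F n}"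
      unfolding assoc_graded_def by auto
    have ex: "\<exists>z. z \<in> F n \<and> \<xi> n = gr_coset H F n z" for n using \<xi>(1)[of n] by blast
    define z where "z n = (SOME z. z \<in> F n \<and> \<xi> n = gr_coset H F n z)" for n
    have "z n \<in> F n \<and> \<xi> n = gr_coset H F n (z n)" for n
      unfolding z_def by (rule someI_ex[OF ex])
    then have z: "\<And>n. z n \<in> F n" "\<And>n. \<xi> n = gr_coset H F n (z n)" by auto
    define N where "N = {n. \<xi> n \<noteq> gr_prev H F n}"
    define x where "x = (\<Sum>n\<in>N. part n (z n))"
    have lx: "Poly_Mapping.lookup x b = (if w b \<in> N then Poly_Mapping.lookup (z (w b)) b else 0)" for b
      unfolding x_def lookup_sum lookup_part using \<xi>(2) by (simp add: N_def)
    have xI: "Poly_Mapping.keys x \<subseteq> I"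
      unfolding keys_subset_iff lx using z(1) unfolding F_lookup by (meson)
    have "symb x n = \<xi> n" for n
    proof (cases "n \<in> N")
      case True
      then show ?thesis unfolding symb_def z(2) gr_coset_eq_iff[OF part_F[OF xI] z(1)]
        by (simp add: lookup_part lx)
    next
      case False
      then have "part n x = 0" by (intro poly_mapping_eqI) (simp add: lookup_part lx)
      then show ?thesis using False unfolding symb_def N_def by (simp add: gr_coset_0)
    qed
    then show "\<xi> \<in> symb ` carrier H'" using xI by (intro image_eqI[of _ _ x]) auto
  qed
qed

theorem symb_ring_iso: "symb \<in> ring_iso H' (assoc_graded H F)"
proof (rule ring_iso_memI)
  show "symb x \<in> carrier (assoc_graded H F)" if "x \<in> carrier H'" for x
    using bij_betw_symb that unfolding bij_betw_def by blast
  show "symb \<one>\<^bsub>H'\<^esub> = \<one>\<^bsub>assoc_graded H F\<^esub>"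
    using symb_single[OF unit_basis] unit_weight by (simp add: assoc_graded_def)
qed (use symb_mult symb_add bij_betw_symb in simp_all)

end

section \<open>Hall algebras\<close>

lemma (in exact_category) lookup_hall_basis_mult:
  assumes "ext_finite C E"
  shows "Poly_Mapping.lookup (hall_basis_mult C E a c) b =
    (if b \<in> Iso C then of_nat (card (Ext1_mid C E (rep a) (rep c) (rep b))) / of_nat (card (Hom C (rep a) (rep c)))
     else 0)"
  unfolding hall_basis_mult_def
  using assms finite_Ext1_middles[of "rep a" "rep c"] unfolding ext_finite_def
  by (subst lookup_sum_single) auto

lemma hall_filtration_eq:
  "hall_filtration C w n = {x. Poly_Mapping.keys x \<subseteq> {a \<in> Iso C. w a \<le> n}}"
proof -
  have "{hall_basis C M | M. w (iso_class C M) \<le> n} = (\<lambda>a. Poly_Mapping.single a 1) ` {a \<in> Iso C. w a \<le> n}"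
    unfolding hall_basis_def Iso_def by blast
  then show ?thesis unfolding hall_filtration_def by (simp add: span_basis_vectors)
qed

text \<open>
  The structure constants of both Hall algebras count Yoneda classes with prescribed middle term and
  have the same denominators, so they are compared by \<open>Ext1_mid_E'\<close>.
\<close>

lemma (in exact_degeneration) hall_degeneration:
  assumes E: "ext_finite C E" and E': "ext_finite C E'"
  shows "degenerating_basis_algebra (Iso C) (iso_class C (SOME Z. zero_object C Z)) (w_val C E E')
    (hall_basis_mult C E) (hall_basis_mult C E')"
proof
  show "w_val C E E' (iso_class C (SOME Z. zero_object C Z)) = 0"
    by (rule w_zero_object[OF someI_ex[OF zero_object_exists]])
next
  fix a b c assume a: "a \<in> Iso C" and c: "c \<in> Iso C"
  note w_rep = iso_class_rep[OF a] iso_class_rep[OF c]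
  show "b \<in> Iso C \<and> w_val C E E' b \<le> w_val C E E' a + w_val C E E' c"
    if nz: "Poly_Mapping.lookup (hall_basis_mult C E a c) b \<noteq> 0"
  proof -
    have b: "b \<in> Iso C" and "Ext1_mid C E (rep a) (rep c) (rep b) \<noteq> {}"
      using nz unfolding E.lookup_hall_basis_mult[OF E] by (auto split: if_splits)
    then show ?thesis using Ext1_mid_le[of "rep a" "rep c" "rep b"] iso_class_rep[OF b] w_rep by simp
  qed
  show "Poly_Mapping.lookup (hall_basis_mult C E' a c) b =
    (if w_val C E E' b = w_val C E E' a + w_val C E E' c
     then Poly_Mapping.lookup (hall_basis_mult C E a c) b else 0)"
  proof (cases "b \<in> Iso C")
    case True
    then show ?thesis
      unfolding E.lookup_hall_basis_mult[OF E] E'.lookup_hall_basis_mult[OF E'] Ext1_mid_E'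
      using w_rep iso_class_rep[OF True] by simp
  qed (simp add: E.lookup_hall_basis_mult[OF E] E'.lookup_hall_basis_mult[OF E'])
qed simp

theorem theorem5:
  fixes C :: "('o, 'm::ab_group_add, 'k::{field, finite}) lincat"
    and E E' :: "('o, 'm) pair_of_maps set"
  assumes "additive_category C" and "hom_finite C" and "idempotent_complete C"
    and "exact_structure C E" and "ext_finite C E" and "admissible C E"
    and "exact_structure C E'" and "ext_finite C E'" and "admissible C E'"
    and "E' \<subset> E"
    and "\<And>M. finite {P \<in> ind C (projectives C E') - ind C (projectives C E).
                 Hom C (rep P) M \<noteq> {0}}"
  defines "w \<equiv> w_val C E E'"
  defines "F \<equiv> hall_filtration C w"
  shows "valuation C E w \<and>
    algebra_filtration (hall_algebra C E) F \<and>
    (\<exists>\<Phi> \<in> ring_iso (hall_algebra C E') (assoc_graded (hall_algebra C E) F).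
      (\<forall>c. \<forall>x\<in>carrier (hall_algebra C E').
        \<Phi> (c \<odot>\<^bsub>hall_algebra C E'\<^esub> x) = c \<odot>\<^bsub>assoc_graded (hall_algebra C E) F\<^esub> \<Phi> x) \<and>
      (\<forall>M. \<Phi> (hall_basis C M) =
        gr_class (hall_algebra C E) F (w (iso_class C M)) (hall_basis C M)))"
proof -
  interpret exact_degeneration C E E'
    using assms(1-4,6,7,10,11)
    by (intro exact_degeneration.intro finite_exact_pair.intro exact_category.intro
        finite_exact_pair_axioms.intro exact_degeneration_axioms.intro) auto
  interpret D: degenerating_basis_algebra "Iso C" "iso_class C (SOME Z. zero_object C Z)"
    "w_val C E E'" "hall_basis_mult C E" "hall_basis_mult C E'"
    by (rule hall_degeneration[OF assms(5,8)])
  have F: "F = D.F" unfolding F_def w_def D.F_def hall_filtration_eq by (rule ext) simp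
  have "\<forall>M. D.symb (hall_basis C M) = gr_class D.H D.F (w (iso_class C M)) (hall_basis C M)"
    unfolding w_def hall_basis_def using D.symb_single by simp
  then show ?thesis
    unfolding hall_algebra_eq_basis_algebra F
    using valuation_w D.algebra_filtration_F D.symb_ring_iso D.symb_smult
    by (intro conjI bexI[of _ D.symb] allI ballI) (auto simp: w_def)
qed

end
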